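(* Let $X$ be a connected graph equipped with a navigable and undirected path system $\mathcal P$. There is a full contraction gauge $K_0$ such that for every contraction triple $\mathcal K=(K,n,\mathcal P)$ with $K$ full and $K\ge K_0$ pointwise, a special path $h\in\mathcal P$ is Morse if and only if $\iota_{\mathcal K}\circ h$ is a quasi-geodesic in the contraction space $\hat X_{\mathcal K}$, quantitatively: for every Morse gauge $M$ there is $Q\ge1$ such that $\iota_{\mathcal K}\circ h$ is a $(Q,Q)$-quasi-geodesic for every $M$-Morse $h\in\mathcal P$, and for every $Q\ge1$ there is a Morse gauge $M$ such that every $h\in\mathcal P$ for which $\iota_{\mathcal K}\circ h$ is a $(Q,Q)$-quasi-geodesic is $M$-Morse.
   Context: Graphs carry the path metric $d$ with edges of length 1. A $(\lambda,\kappa)$-quasi-geodesic ($\lambda\ge1,\kappa\ge0$) is a map $\gamma:I\to X$, $I\subseteq\mathbb R$ an interval, with $\frac1\lambda|t_1-t_2|-\kappa\le d(\gamma(t_1),\gamma(t_2))\le\lambda|t_1-t_2|+\kappa$. Convention: quasi-geodesics in $X$ are improved, i.e. continuous and such that the length of $\gamma|_{[t,t']}$ is at most $k_1d(\gamma(t),\gamma(t'))+k_2$, where $\kappa'=2(\lambda+\kappa)$, $k_1=\lambda(\lambda+\kappa)$, $k_2=(\lambda\kappa'+3)(\lambda+\kappa)$. For $p:[a,b]\to X$: $p^-=p(a)$, $p^+=p(b)$, $|p|=b-a$, $\|p\|$ is the length, the midpoint is the image of $(a+b)/2$, $p^{-1}$ is the reversed path. A path system $\mathcal P$ on $X$ is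 a set of quasi-geodesic segments, all $(\lambda_0,\kappa_0)$-quasi-geodesics for a common pair, containing all trivial paths, closed under passing to subsegments, and containing for all $x,y\in X$ a path from $x$ to $y$. Its elements are called special paths. It is undirected if closed under $h\mapsto h^{-1}$. An $(n,\mathcal P)$-polygonal line is a concatenation of at most $n$ special paths. $\mathcal P$ is navigable if there are $C\ge1$ and an integer $k\ge1$ such that for every $R\ge C$, $m\in X$, $n$, and $(n,\mathcal P)$-polygonal line $\alpha$ with $d(\alpha,m)\ge R$ and $d(\alpha^\pm,m)\le2R$, there is a $(kn,\mathcal P)$-polygonal line $p$ with the same endpoints as $\alpha$, $\|p\|\le CnR$, avoiding the closed ball $B(m,R/C)$. A Morse gauge is a function $M:\mathbb R_{\ge1}\times\mathbb R_{\ge0}\to\mathbb R_{\ge0}$, non-decreasing in each variable and continuous in the second. A quasi-geodesic $\gamma$ is $M$-Morse if every $(Q,q)$-quasi-geodesic with endpoints $\gamma(s),\gamma(t)$ lies in the $M(Q,q)$-neighbourhood of $\gamma|_{[s,t]}$. A contraction gauge is a non-decreasing function $K:\mathbb R_{\ge0}\to\mathbb R_{\ge0}\cup\{\infty\}$; it is full if it never takes the value $\infty$. A contraction triple is $\mathcal K=(K,n,\mathcal P)$ with $K$ a contraction gauge and $n\ge7$ an integer. A special path $h$ is $\mathcal K$-midthin if for some $r\ge0$ one has $|h|\ge K(r)$ and every $(n,\mathcal P)$-polygonal line from $h^+$ to $h^-$ meets the closed $r$-ball around the midpoint of $h$. A special path is $\mathcal K$-anti-contracting if none of its subsegments is $\mathcal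 K$-midthin. A pair of vertices $(x,y)$ is $\mathcal K$-anti-contracting if some special path from $x$ to $y$ is $\mathcal K$-anti-contracting. $\hat X_{\mathcal K}$ is the graph obtained from $X$ by adding an edge between every $\mathcal K$-anti-contracting pair of vertices; $\iota_{\mathcal K}:X\to\hat X_{\mathcal K}$ is the inclusion. *)

theory Defs
  imports "HOL-Analysis.Analysis" "Graph_Theory.Digraph_Component"
begin

section \<open>Metric graphs\<close>

text \<open>
  A graph is given by a well-formed directed multigraph (loops and parallel edges are allowed,
  nothing needs to be finite).  The orientation of an arc only serves to parametrise the corresponding
  edge by the unit interval, from its tail to its head; connectedness
  (\<^const>\<open>Digraph_Component.connected\<close>) and the path metric below ignore it.

  The points of the geometric realisation are the vertices together with, for each edge, the
  parameters strictly between 0 and 1.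
\<close>

datatype ('v, 'e) gpoint = Vertex 'v | Inner 'e real

definition gpoints :: "('v, 'e) pre_digraph \<Rightarrow> ('v, 'e) gpoint set" where
  "gpoints G = Vertex ` verts G \<union> {Inner e t | e t. e \<in> arcs G \<and> 0 < t \<and> t < 1}"

definition edge_point :: "('v, 'e) pre_digraph \<Rightarrow> 'e \<Rightarrow> real \<Rightarrow> ('v, 'e) gpoint" where
  "edge_point G e t =
     (if t = 0 then Vertex (tail G e) else if t = 1 then Vertex (head G e) else Inner e t)"

text \<open>
  \<open>pl_path G x y l\<close>: there is a piecewise linear path from \<open>x\<close> to \<open>y\<close> of length \<open>l\<close>, i.e. a
  finite succession of moves, each inside one closed edge.
\<close>

inductive pl_path ::
  "('v, 'e) pre_digraph \<Rightarrow> ('v, 'e) gpoint \<Rightarrow> ('v, 'e) gpoint \<Rightarrow> real \<Rightarrow> bool"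
  for G where
  refl: "x \<in> gpoints G \<Longrightarrow> pl_path G x x 0"
| step: "\<lbrakk>pl_path G x (edge_point G e s) l; e \<in> arcs G; s \<in> {0..1}; t \<in> {0..1}\<rbrakk>
    \<Longrightarrow> pl_path G x (edge_point G e t) (l + \<bar>s - t\<bar>)"

text \<open>
  In a connected graph the default value 0 is only taken outside \<^term>\<open>gpoints G\<close>
  (\<^const>\<open>Metric_space\<close> asks for non-negativity and symmetry on the whole type).
\<close>

definition gdist :: "('v, 'e) pre_digraph \<Rightarrow> ('v, 'e) gpoint \<Rightarrow> ('v, 'e) gpoint \<Rightarrow> real" where
  "gdist G x y = (if \<exists>l. pl_path G x y l then Inf {l. pl_path G x y l} else 0)"

definition graph_metric :: "('v, 'e) pre_digraph \<Rightarrow> ('v, 'e) gpoint metric" where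
  "graph_metric G = metric (gpoints G, gdist G)"

lemma edge_point_in: "wf_digraph G \<Longrightarrow> e \<in> arcs G \<Longrightarrow> t \<in> {0..1} \<Longrightarrow> edge_point G e t \<in> gpoints G"
  by (auto simp: edge_point_def gpoints_def wf_digraph.head_in_verts wf_digraph.tail_in_verts)

lemma gpoints_edge_point:
  assumes "Inner e t \<in> gpoints G"
  shows "e \<in> arcs G" "0 < t" "t < 1" "Inner e t = edge_point G e t"
  using assms by (auto simp: gpoints_def edge_point_def)

lemma pl_path_start: "pl_path G x y l \<Longrightarrow> x \<in> gpoints G"
  by (induction rule: pl_path.induct) auto

lemma pl_path_nonneg: "pl_path G x y l \<Longrightarrow> 0 \<le> l"
  by (induction rule: pl_path.induct) auto

lemma pl_path_trans: "pl_path G y z k \<Longrightarrow> pl_path G x y l \<Longrightarrow> pl_path G x z (l + k)"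
proof (induction rule: pl_path.induct)
  case (step y e s k t)
  then show ?case
    using pl_path.step[of G x e s "l + k" t] by (simp add: add.assoc)
qed simp

lemma pl_path_edge:
  assumes "wf_digraph G" "e \<in> arcs G" "s \<in> {0..1}" "t \<in> {0..1}"
  shows "pl_path G (edge_point G e s) (edge_point G e t) \<bar>s - t\<bar>"
  using pl_path.step[OF pl_path.refl[OF edge_point_in[OF assms(1-3)]] assms(2-4)] by simp

lemma pl_path_sym:
  assumes "wf_digraph G"
  shows "pl_path G x y l \<Longrightarrow> pl_path G y x l"
proof (induction rule: pl_path.induct)
  case (step x e s l t)
  have "pl_path G (edge_point G e t) (edge_point G e s) \<bar>s - t\<bar>"
    using pl_path_edge[OF assms, of e t s] step by (simp add: abs_minus_commute)
  from pl_path_trans[OF step.IH this] show ?case by (simp add: add.commute)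
qed (rule pl_path.refl)

lemma pl_path_connected_vertices:
  assumes "wf_digraph G" "Digraph_Component.connected G" "u \<in> verts G" "v \<in> verts G"
  shows "\<exists>l. pl_path G (Vertex u) (Vertex v) l"
proof -
  have "(u, v) \<in> rtrancl_on (verts G)
      (arcs_ends (with_proj (mk_symmetric G)))"
    using assms(2-4)
    by (auto simp: Digraph_Component.connected_def strongly_connected_def reachable_def
        mk_symmetric_def)
  then show ?thesis
  proof (induction rule: rtrancl_on.induct)
    case (rtrancl_on_refl a)
    then show ?case by (auto simp: gpoints_def intro!: pl_path.refl exI[of _ 0])
  next
    case (rtrancl_on_into_rtrancl_on a v w)
    then obtain e where e: "e \<in> arcs G"
        "(v = tail G e \<and> w = head G e) \<or> (v = head G e \<and> w = tail G e)"
      by (auto simp: arcs_ends_def arc_to_ends_def mk_symmetric_def)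
    have "pl_path G (Vertex (tail G e)) (Vertex (head G e)) 1"
      using pl_path_edge[OF assms(1) e(1), of 0 1] by (simp add: edge_point_def)
    with e(2) pl_path_sym[OF assms(1)] have "pl_path G (Vertex v) (Vertex w) 1" by auto
    then show ?case using rtrancl_on_into_rtrancl_on.IH by (auto dest: pl_path_trans)
  qed
qed

lemma pl_path_connected:
  assumes "wf_digraph G" "Digraph_Component.connected G" "x \<in> gpoints G" "y \<in> gpoints G"
  shows "\<exists>l. pl_path G x y l"
proof -
  have 1: "\<exists>v\<in>verts G. \<exists>l. pl_path G x (Vertex v) l" if "x \<in> gpoints G" for x
  proof (cases x)
    case (Vertex v)
    then show ?thesis using that pl_path.refl[OF that] by (auto simp: gpoints_def)
  next
    case (Inner e t)
    note * = gpoints_edge_point[OF that[unfolded Inner]]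
    have "pl_path G x (edge_point G e 0) \<bar>t - 0\<bar>"
      unfolding Inner *(4) using pl_path_edge[OF assms(1) *(1), of t 0] *(2,3) by simp
    then show ?thesis
      using *(1) assms(1) by (auto simp: edge_point_def wf_digraph.tail_in_verts)
  qed
  from 1[OF assms(3)] 1[OF assms(4)] obtain u v k l where
    "u \<in> verts G" "v \<in> verts G" "pl_path G x (Vertex u) k" "pl_path G (Vertex v) y l"
    using pl_path_sym[OF assms(1)] by blast
  moreover from this(1,2) obtain j where "pl_path G (Vertex u) (Vertex v) j"
    using pl_path_connected_vertices[OF assms(1,2)] by blast
  ultimately show ?thesis using pl_path_trans by blast
qed

lemma pl_path_from_Inner:
  assumes "pl_path G x y l" "x = Inner e t" "0 < t" "t < 1"
  shows "min t (1 - t) \<le> l \<or> (\<exists>s. 0 < s \<and> s < 1 \<and> y = Inner e s \<and> \<bar>s - t\<bar> \<le> l)"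
  using assms
proof (induction rule: pl_path.induct)
  case (refl x)
  then show ?case by auto
next
  case (step x e' s l t')
  then show ?case
    by (auto simp: edge_point_def split: if_splits)
qed

lemma pl_path_from_Vertex:
  assumes "pl_path G x y l" "x = Vertex v"
  shows "y = Vertex v \<or> 1 \<le> l \<or> (\<exists>e s. y = Inner e s \<and> 0 < s \<and> s < 1 \<and>
      (tail G e = v \<and> s \<le> l \<or> head G e = v \<and> 1 - s \<le> l))"
  using assms
proof (induction rule: pl_path.induct)
  case (refl x)
  then show ?case by auto
next
  case (step x e' s l t')
  then show ?case using pl_path_nonneg[OF step.hyps(1)]
    by (auto simp: edge_point_def split: if_splits)
qed

lemma Metric_space_gdist:
  assumes G: "wf_digraph G" "Digraph_Component.connected G"
  shows "Metric_space (gpoints G) (gdist G)"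
proof
  have ex: "\<exists>l. pl_path G x y l" if "x \<in> gpoints G" "y \<in> gpoints G" for x y
    by (rule pl_path_connected[OF G that])
  have gd: "gdist G x y = Inf {l. pl_path G x y l}" if "x \<in> gpoints G" "y \<in> gpoints G" for x y
    using ex[OF that] by (simp add: gdist_def)
  have lower: "gdist G x y \<le> l" if "pl_path G x y l" for x y l
  proof -
    have "bdd_below {l. pl_path G x y l}"
      using pl_path_nonneg by (intro bdd_belowI[of _ 0]) auto
    then show ?thesis using that by (auto simp: gdist_def intro: cInf_lower)
  qed
  have greatest: "c \<le> gdist G x y"
    if "x \<in> gpoints G" "y \<in> gpoints G" "\<And>l. pl_path G x y l \<Longrightarrow> c \<le> l" for x y c
    unfolding gd[OF that(1,2)] using ex[OF that(1,2)] that(3) by (intro cInf_greatest) auto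
  show nonneg: "0 \<le> gdist G x y" for x y
  proof (cases "\<exists>l. pl_path G x y l")
    case True
    then have "0 \<le> Inf {l. pl_path G x y l}"
      using pl_path_nonneg by (intro cInf_greatest) auto
    then show ?thesis by (simp add: gdist_def)
  qed (simp add: gdist_def)
  have "pl_path G x y = pl_path G y x" for x y
    using pl_path_sym[OF G(1)] by (intro ext iffI)
  then show comm: "gdist G x y = gdist G y x" for x y
    by (simp add: gdist_def)
  have pos: "0 < gdist G x y" if "x = Inner e t" "x \<noteq> y" "x \<in> gpoints G" "y \<in> gpoints G"
    for x y e t
  proof -
    note * = gpoints_edge_point[OF that(3)[unfolded that(1)]]
    show ?thesis
    proof (cases "\<exists>s. y = Inner e s")
      case True
      then obtain s where s: "y = Inner e s" by auto
      have "min (min t (1 - t)) \<bar>s - t\<bar> \<le> gdist G x y"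
        using pl_path_from_Inner[OF _ \<open>x = Inner e t\<close> *(2,3)] s that
        by (intro greatest) fastforce+
      moreover have "0 < min (min t (1 - t)) \<bar>s - t\<bar>" using * s that by auto
      ultimately show ?thesis by linarith
    next
      case False
      have "min t (1 - t) \<le> gdist G x y"
        using pl_path_from_Inner[OF _ \<open>x = Inner e t\<close> *(2,3)] False that
        by (intro greatest) blast+
      moreover have "0 < min t (1 - t)" using * by auto
      ultimately show ?thesis by linarith
    qed
  qed
  fix x y assume x: "x \<in> gpoints G" and y: "y \<in> gpoints G"
  have "0 < gdist G x y" if "x \<noteq> y"
  proof (cases x)
    case (Inner e t)
    then show ?thesis using pos that x y by blast
  next
    case x': (Vertex v)
    show ?thesis
    proof (cases y)
      case (Inner e t)
      then show ?thesis using pos[OF Inner _ y x] that comm by simp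
    next
      case (Vertex w)
      have "1 \<le> gdist G x y"
        using pl_path_from_Vertex[OF _ x', of G y] x' that Vertex
        by (intro greatest x y) auto
      then show ?thesis by simp
    qed
  qed
  moreover have "gdist G x x \<le> 0" using lower pl_path.refl[OF x] .
  ultimately show "gdist G x y = 0 \<longleftrightarrow> x = y"
    using nonneg[of x y] by (cases "x = y") auto
  fix z assume z: "z \<in> gpoints G"
  have "gdist G x z - k \<le> gdist G x y" if "pl_path G y z k" for k
    using lower[OF pl_path_trans[OF that]] by (intro greatest x y) (simp add: algebra_simps)
  then have "gdist G x z - gdist G x y \<le> gdist G y z"
    by (intro greatest y z) (simp add: algebra_simps)
  then show "gdist G x z \<le> gdist G x y + gdist G y z" by simp
qed

lemma
  assumes "wf_digraph G" "Digraph_Component.connected G"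
  shows mspace_graph_metric: "mspace (graph_metric G) = gpoints G"
    and mdist_graph_metric: "mdist (graph_metric G) = gdist G"
  using Metric_space_gdist[OF assms]
  by (simp_all add: graph_metric_def Metric_space.mspace_metric Metric_space.mdist_metric)

section \<open>Quasi-geodesics\<close>

definition quasi_geodesic ::
  "'p metric \<Rightarrow> real \<Rightarrow> real \<Rightarrow> real set \<Rightarrow> (real \<Rightarrow> 'p) \<Rightarrow> bool" where
  "quasi_geodesic m L \<kappa> I \<gamma> \<longleftrightarrow>
     1 \<le> L \<and> 0 \<le> \<kappa> \<and> is_interval I \<and> \<gamma> \<in> I \<rightarrow> mspace m \<and>
     (\<forall>t1\<in>I. \<forall>t2\<in>I. 1 / L * \<bar>t1 - t2\<bar> - \<kappa> \<le> mdist m (\<gamma> t1) (\<gamma> t2) \<and>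
        mdist m (\<gamma> t1) (\<gamma> t2) \<le> L * \<bar>t1 - t2\<bar> + \<kappa>)"

definition curve_length :: "'p metric \<Rightarrow> (real \<Rightarrow> 'p) \<Rightarrow> real \<Rightarrow> real \<Rightarrow> ennreal" where
  "curve_length m \<gamma> a b =
     Sup {\<Sum>i<n. ennreal (mdist m (\<gamma> (t i)) (\<gamma> (t (Suc i)))) | (n :: nat) (t :: nat \<Rightarrow> real).
            t 0 = a \<and> t n = b \<and> (\<forall>i<n. t i \<le> t (Suc i))}"

text \<open>The quasi-geodesics in \<open>X\<close> are by convention the improved ones.\<close>

definition improved_quasi_geodesic ::
  "'p metric \<Rightarrow> real \<Rightarrow> real \<Rightarrow> real set \<Rightarrow> (real \<Rightarrow> 'p) \<Rightarrow> bool" where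
  "improved_quasi_geodesic m L \<kappa> I \<gamma> \<longleftrightarrow>
     quasi_geodesic m L \<kappa> I \<gamma> \<and>
     continuous_map (top_of_set I) (mtopology_of m) \<gamma> \<and>
     (let \<kappa>' = 2 * (L + \<kappa>); k1 = L * (L + \<kappa>); k2 = (L * \<kappa>' + 3) * (L + \<kappa>)
      in \<forall>t\<in>I. \<forall>t'\<in>I. t \<le> t' \<longrightarrow>
           curve_length m \<gamma> t t' \<le> ennreal (k1 * mdist m (\<gamma> t) (\<gamma> t') + k2))"

definition set_mdist :: "'p metric \<Rightarrow> 'p set \<Rightarrow> 'p \<Rightarrow> real" where
  "set_mdist m A x = (INF a\<in>A. mdist m a x)"

definition morse_gauge :: "(real \<Rightarrow> real \<Rightarrow> real) \<Rightarrow> bool" where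
  "morse_gauge M \<longleftrightarrow>
     (\<forall>Q\<ge>1. \<forall>q\<ge>0. 0 \<le> M Q q) \<and>
     (\<forall>q\<ge>0. mono_on {1..} (\<lambda>Q. M Q q)) \<and>
     (\<forall>Q\<ge>1. mono_on {0..} (M Q)) \<and>
     (\<forall>Q\<ge>1. continuous_on {0..} (M Q))"

text \<open>Neighbourhoods are closed, so that the value 0 of a gauge is meaningful.\<close>

definition morse ::
  "'p metric \<Rightarrow> (real \<Rightarrow> real \<Rightarrow> real) \<Rightarrow> real set \<Rightarrow> (real \<Rightarrow> 'p) \<Rightarrow> bool" where
  "morse m M I \<gamma> \<longleftrightarrow>
     (\<forall>Q\<ge>1. \<forall>q\<ge>0. \<forall>s\<in>I. \<forall>t\<in>I. \<forall>a b \<eta>.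
        s \<le> t \<longrightarrow> a \<le> b \<longrightarrow> improved_quasi_geodesic m Q q {a..b} \<eta> \<longrightarrow> \<eta> a = \<gamma> s \<longrightarrow> \<eta> b = \<gamma> t \<longrightarrow>
        (\<forall>u\<in>{a..b}. set_mdist m (\<gamma> ` {s..t}) (\<eta> u) \<le> M Q q))"

section \<open>Path systems\<close>

text \<open>
  A path is a map on a compact interval.  The values outside the interval are normalised
  (\<^const>\<open>extensional\<close>), so that equality of segments is equality of paths.
\<close>

datatype 'p seg = Seg (lo: real) (hi: real) (pt: "real \<Rightarrow> 'p")

definition is_seg :: "'p set \<Rightarrow> 'p seg \<Rightarrow> bool" where
  "is_seg S p \<longleftrightarrow> lo p \<le> hi p \<and> pt p \<in> {lo p..hi p} \<rightarrow>\<^sub>E S"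

abbreviation seg_dom :: "'p seg \<Rightarrow> real set" where "seg_dom p \<equiv> {lo p..hi p}"
definition seg_start :: "'p seg \<Rightarrow> 'p" where "seg_start p = pt p (lo p)"
definition seg_end :: "'p seg \<Rightarrow> 'p" where "seg_end p = pt p (hi p)"
definition seg_dur :: "'p seg \<Rightarrow> real" where "seg_dur p = hi p - lo p"
definition seg_mid :: "'p seg \<Rightarrow> 'p" where "seg_mid p = pt p ((lo p + hi p) / 2)"
definition seg_image :: "'p seg \<Rightarrow> 'p set" where "seg_image p = pt p ` seg_dom p"

definition seg_length :: "'p metric \<Rightarrow> 'p seg \<Rightarrow> ennreal" where
  "seg_length m p = curve_length m (pt p) (lo p) (hi p)"

definition const_seg :: "real \<Rightarrow> 'p \<Rightarrow> 'p seg" where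
  "const_seg a x = Seg a a (\<lambda>t\<in>{a}. x)"

definition subseg :: "'p seg \<Rightarrow> real \<Rightarrow> real \<Rightarrow> 'p seg" where
  "subseg p s t = Seg s t (restrict (pt p) {s..t})"

definition rev_seg :: "'p seg \<Rightarrow> 'p seg" where
  "rev_seg p = Seg (lo p) (hi p) (\<lambda>t\<in>seg_dom p. pt p (lo p + hi p - t))"

text \<open>The domain of the second path is shifted so as to start where that of the first one ends.\<close>

definition join_seg :: "'p seg \<Rightarrow> 'p seg \<Rightarrow> 'p seg" where
  "join_seg p q = Seg (lo p) (hi p + seg_dur q)
     (\<lambda>t\<in>{lo p..hi p + seg_dur q}. if t \<le> hi p then pt p t else pt q (t - hi p + lo q))"

definition path_system :: "'p metric \<Rightarrow> 'p seg set \<Rightarrow> bool" where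
  "path_system m P \<longleftrightarrow>
     (\<exists>L0 k0. \<forall>p\<in>P. is_seg (mspace m) p \<and> improved_quasi_geodesic m L0 k0 (seg_dom p) (pt p)) \<and>
     (\<forall>a. \<forall>x\<in>mspace m. const_seg a x \<in> P) \<and>
     (\<forall>p\<in>P. \<forall>s t. lo p \<le> s \<and> s \<le> t \<and> t \<le> hi p \<longrightarrow> subseg p s t \<in> P) \<and>
     (\<forall>x\<in>mspace m. \<forall>y\<in>mspace m. \<exists>p\<in>P. seg_start p = x \<and> seg_end p = y)"

definition undirected :: "'p seg set \<Rightarrow> bool" where
  "undirected P \<longleftrightarrow> (\<forall>h\<in>P. rev_seg h \<in> P)"

inductive concatenation :: "'p seg set \<Rightarrow> nat \<Rightarrow> 'p seg \<Rightarrow> bool" for P where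
  single: "p \<in> P \<Longrightarrow> concatenation P 1 p"
| join: "\<lbrakk>concatenation P n \<alpha>; p \<in> P; seg_end \<alpha> = seg_start p\<rbrakk>
    \<Longrightarrow> concatenation P (Suc n) (join_seg \<alpha> p)"

definition polygonal_line :: "nat \<Rightarrow> 'p seg set \<Rightarrow> 'p seg \<Rightarrow> bool" where
  "polygonal_line n P \<alpha> \<longleftrightarrow> (\<exists>j\<le>n. concatenation P j \<alpha>)"

definition navigable :: "'p metric \<Rightarrow> 'p seg set \<Rightarrow> bool" where
  "navigable m P \<longleftrightarrow>
     (\<exists>C k. (1::real) \<le> C \<and> (1::nat) \<le> k \<and>
       (\<forall>R\<ge>C. \<forall>c\<in>mspace m. \<forall>n \<alpha>.
          polygonal_line n P \<alpha> \<and> R \<le> set_mdist m (seg_image \<alpha>) c \<and>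
          mdist m (seg_start \<alpha>) c \<le> 2 * R \<and> mdist m (seg_end \<alpha>) c \<le> 2 * R \<longrightarrow>
          (\<exists>p. polygonal_line (k * n) P p \<and>
             seg_start p = seg_start \<alpha> \<and> seg_end p = seg_end \<alpha> \<and>
             seg_length m p \<le> ennreal (C * real n * R) \<and>
             seg_image p \<inter> mcball_of m c (R / C) = {})))"

section \<open>Contraction spaces\<close>

text \<open>Gauges are functions on the non-negative reals; arguments below 0 are irrelevant.\<close>

definition contraction_gauge :: "(real \<Rightarrow> ennreal) \<Rightarrow> bool" where
  "contraction_gauge K \<longleftrightarrow> mono_on {0..} K"

definition full_gauge :: "(real \<Rightarrow> ennreal) \<Rightarrow> bool" where
  "full_gauge K \<longleftrightarrow> (\<forall>r\<ge>0. K r \<noteq> \<infinity>)"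

type_synonym 'p triple = "(real \<Rightarrow> ennreal) \<times> nat \<times> 'p seg set"

fun contraction_triple :: "'p metric \<Rightarrow> 'p triple \<Rightarrow> bool" where
  "contraction_triple m (K, n, P) \<longleftrightarrow> contraction_gauge K \<and> 7 \<le> n \<and> path_system m P"

fun midthin :: "'p metric \<Rightarrow> 'p triple \<Rightarrow> 'p seg \<Rightarrow> bool" where
  "midthin m (K, n, P) h \<longleftrightarrow>
     (\<exists>r\<ge>0. K r \<le> ennreal (seg_dur h) \<and>
        (\<forall>\<alpha>. polygonal_line n P \<alpha> \<and> seg_start \<alpha> = seg_end h \<and> seg_end \<alpha> = seg_start h \<longrightarrow>
           seg_image \<alpha> \<inter> mcball_of m (seg_mid h) r \<noteq> {}))"

definition anti_contracting :: "'p metric \<Rightarrow> 'p triple \<Rightarrow> 'p seg \<Rightarrow> bool" where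
  "anti_contracting m \<K> h \<longleftrightarrow>
     (\<forall>s t. lo h \<le> s \<and> s \<le> t \<and> t \<le> hi h \<longrightarrow> \<not> midthin m \<K> (subseg h s t))"

fun anti_contracting_pair :: "'p metric \<Rightarrow> 'p triple \<Rightarrow> 'p \<Rightarrow> 'p \<Rightarrow> bool" where
  "anti_contracting_pair m (K, n, P) x y \<longleftrightarrow>
     (\<exists>h\<in>P. seg_start h = x \<and> seg_end h = y \<and> anti_contracting m (K, n, P) h)"

text \<open>
  One new edge for each ordered pair of vertices; doubled edges and loops do not affect the metric.
\<close>

definition contraction_graph ::
  "('v, 'e) pre_digraph \<Rightarrow> ('v, 'e) gpoint triple \<Rightarrow> ('v, 'e + 'v \<times> 'v) pre_digraph" where
  "contraction_graph X \<K> =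
     \<lparr>verts = verts X,
      arcs = Inl ` arcs X \<union>
        Inr ` {(x, y). x \<in> verts X \<and> y \<in> verts X \<and>
                 anti_contracting_pair (graph_metric X) \<K> (Vertex x) (Vertex y)},
      tail = case_sum (tail X) fst,
      head = case_sum (head X) snd\<rparr>"

definition contraction_space ::
  "('v, 'e) pre_digraph \<Rightarrow> ('v, 'e) gpoint triple \<Rightarrow> ('v, 'e + 'v \<times> 'v) gpoint metric" where
  "contraction_space X \<K> = graph_metric (contraction_graph X \<K>)"

fun contraction_incl :: "('v, 'e) gpoint \<Rightarrow> ('v, 'e + 'v \<times> 'v) gpoint" where
  "contraction_incl (Vertex v) = Vertex v"
| "contraction_incl (Inner e t) = Inner (Inl e) t"

lemma wf_contraction_graph: "wf_digraph X \<Longrightarrow> wf_digraph (contraction_graph X \<K>)"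
  by unfold_locales
    (auto simp: contraction_graph_def wf_digraph.tail_in_verts wf_digraph.head_in_verts)

lemma connected_iff_rtrancl_on:
  "Digraph_Component.connected G \<longleftrightarrow> verts G \<noteq> {} \<and> (\<forall>u\<in>verts G. \<forall>v\<in>verts G.
     (u, v) \<in> rtrancl_on (verts G) (\<Union>e\<in>arcs G. {(tail G e, head G e), (head G e, tail G e)}))"
proof -
  have "verts (with_proj (mk_symmetric G)) = verts G"
    and "arcs_ends (with_proj (mk_symmetric G))
      = (\<Union>e\<in>arcs G. {(tail G e, head G e), (head G e, tail G e)})"
    by (simp_all add: mk_symmetric_def arcs_ends_def arc_to_ends_def)
  then show ?thesis
    by (simp only: Digraph_Component.connected_def strongly_connected_def reachable_def)
qed

lemma connected_contraction_graph:
  assumes "Digraph_Component.connected X"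
  shows "Digraph_Component.connected (contraction_graph X \<K>)"
proof -
  let ?Y = "contraction_graph X \<K>"
  have "(\<Union>e\<in>arcs X. {(tail X e, head X e), (head X e, tail X e)})
    \<subseteq> (\<Union>e\<in>arcs ?Y. {(tail ?Y e, head ?Y e), (head ?Y e, tail ?Y e)})"
    by (simp add: contraction_graph_def)
  from rtrancl_on_mono[OF this subset_refl] have "\<forall>u\<in>verts X. \<forall>v\<in>verts X. (u, v) \<in>
      rtrancl_on (verts X) (\<Union>e\<in>arcs ?Y. {(tail ?Y e, head ?Y e), (head ?Y e, tail ?Y e)})"
    using assms unfolding connected_iff_rtrancl_on[of X] by blast
  moreover have "verts ?Y = verts X" by (simp add: contraction_graph_def)
  ultimately show ?thesis
    using assms unfolding connected_iff_rtrancl_on by (simp only: simp_thms)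
qed

end

theory Submission
  imports Defs
begin

text \<open>
  Call a special path \<open>h\<close> thin if every polygonal line with a bounded number of sides between two of its
  points passes uniformly close to all points of \<open>h\<close> in between.  Both properties of the theorem are
  compared with thinness.

  If \<open>h\<close> is thin for 5-gons, then a special path whose projection to \<open>h\<close> is long must come close to
  \<open>h\<close>: close up with the two special paths realising the projections of its endpoints.  As for strongly
  contracting sets, it follows that \<open>h\<close> is Morse.

  If the image of \<open>h\<close> in the contraction space is a quasi-geodesic, then long subsegments of \<open>h\<close> between
  vertices cannot be anti-contracting, so midpoints of midthin subsegments are dense in \<open>h\<close>.  A 5-gon with
  endpoints on \<open>h\<close> together with two pieces of \<open>h\<close> is a 7-gon, hence comes close to these midpoints.

  If \<open>h\<close> is Morse and a polygonal line avoids a large ball around a point of \<open>h\<close>, navigability provides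
  a path of linear length around a ball of proportional radius.  A shortest path for the metric multiplied
  by a large constant inside this ball still avoids a smaller ball, and it is a quasi-geodesic for the
  original metric with constants that do not depend on the radius; this contradicts the Morse property.
  Thus \<open>h\<close> is thin.  A special path with long projection to \<open>h\<close> then follows \<open>h\<close> and has a
  midthin subsegment, so the endpoints of each edge of the contraction graph have close projections and
  distances along \<open>h\<close> are linearly bounded by those in the contraction space.
\<close>

section \<open>Discrete paths and weighted shortest paths\<close>

text \<open>The graph need not be locally finite, so compactness provides no minimisers. Hence
  weights are natural numbers, for which a least total weight is attained, and paths are replaced by
  sequences with steps of bounded size until a continuous curve is required. The Morse gauge is
  arbitrary, so the quasi-geodesic constants of a detour must be fixed before the radius. This works
  because navigability bounds the length of the detour from above and the radius of the avoided ball
  from below, both linearly in \<open>R\<close>: the weight has to beat only their ratio. The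
  numbers of sides fit as follows. Closing up a special path with two projecting paths and two short
  connections takes 5 sides, and adding two pieces of \<open>h\<close> makes 7, the lower bound for
  \<open>n\<close>. In the other direction two short sides turn an \<open>n\<close>-gon on a special
  path into an \<open>(n + 2)\<close>-gon on \<open>h\<close>; the Morse property yields thinness
  for every number of sides, with a radius depending on it, so \<open>n + 2\<close> is
  available.\<close>

lemma mdist_self [simp]: "x \<in> mspace m \<Longrightarrow> mdist m x x = 0"
  by simp

text \<open>The least point of the compact set where \<open>f\<close> is at most \<open>R\<close>: a
  value below \<open>R\<close> there would, by the intermediate value theorem, produce an earlier
  point of the set.\<close>

lemma first_crossing:
  fixes f :: "real \<Rightarrow> real"
  assumes "continuous_on {a..b} f" "R \<le> f a" "f b \<le> R" "a \<le> b"
  obtains v where "v \<in> {a..b}" "f v = R" "\<And>w. w \<in> {a..v} \<Longrightarrow> R \<le> f w"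
proof -
  let ?K = "{a..b} \<inter> f -` {..R}"
  have "closed ?K" by (intro continuous_closed_preimage assms) auto
  then have "compact ({a..b} \<inter> ?K)" by (intro compact_Int_closed) auto
  moreover have "b \<in> {a..b} \<inter> ?K" using assms by auto
  ultimately obtain v where v: "v \<in> {a..b} \<inter> ?K" "\<forall>w\<in>{a..b} \<inter> ?K. v \<le> w"
    using continuous_attains_inf[of "{a..b} \<inter> ?K" "\<lambda>x. x"] continuous_on_id by blast
  have "f v = R"
  proof (rule ccontr)
    assume "f v \<noteq> R"
    then have "f v \<le> R" using v by auto
    moreover have "continuous_on {a..v} f"
      using v by (intro continuous_on_subset[OF assms(1)]) auto
    ultimately obtain w where w: "a \<le> w" "w \<le> v" "f w = R"
      using IVT2'[of f v R a] assms(2) v by auto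
    then have "v \<le> w" using v by auto
    with w \<open>f v \<noteq> R\<close> show False by simp
  qed
  moreover have "R \<le> f w" if "w \<in> {a..v}" for w
  proof (rule ccontr)
    assume "\<not> ?thesis"
    moreover from this have "v \<le> w" using that v by auto
    ultimately show False using that \<open>f v = R\<close> by auto
  qed
  ultimately show ?thesis using that v by blast
qed

lemma last_crossing:
  fixes f :: "real \<Rightarrow> real"
  assumes "continuous_on {a..b} f" "f a \<le> R" "R \<le> f b" "a \<le> b"
  obtains v where "v \<in> {a..b}" "f v = R" "\<And>w. w \<in> {v..b} \<Longrightarrow> R \<le> f w"
proof -
  have "continuous_on {-b..-a} (f \<circ> uminus)"
    by (intro continuous_on_compose continuous_intros) (simp add: assms)
  then obtain v where v: "v \<in> {-b..-a}" "f (-v) = R" "\<And>w. w \<in> {-b..v} \<Longrightarrow> R \<le> f (-w)"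
    using first_crossing[of "-b" "-a" "f \<circ> uminus" R] assms by auto
  have "R \<le> f w" if "w \<in> {-v..b}" for w using v(3)[of "-w"] that by auto
  with v that[of "-v"] show ?thesis by auto
qed

text \<open>Lengths are counted in steps of size at most \<open>\<sigma>\<close>: the distance
  covered by a special path in unit time is at most \<open>L + \<kappa>\<close>, so one step stands
  for one unit of duration. The set \<open>A\<close> records where the sequence may go.\<close>

inductive hops :: "'p metric \<Rightarrow> real \<Rightarrow> 'p set \<Rightarrow> nat \<Rightarrow> 'p \<Rightarrow> 'p \<Rightarrow> bool" for m \<sigma> A where
  hops_0: "x \<in> A \<Longrightarrow> hops m \<sigma> A 0 x x"
| hops_Suc: "hops m \<sigma> A k x y \<Longrightarrow> z \<in> A \<Longrightarrow> mdist m y z \<le> \<sigma> \<Longrightarrow> hops m \<sigma> A (Suc k) x z"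

lemma hops_trans: "hops m \<sigma> A k y z \<Longrightarrow> hops m \<sigma> A l x y \<Longrightarrow> hops m \<sigma> A (l + k) x z"
  by (induction rule: hops.induct) (auto intro: hops.intros)

lemma hops_mono: "hops m \<sigma> A k x y \<Longrightarrow> A \<subseteq> B \<Longrightarrow> hops m \<sigma> B k x y"
  by (induction rule: hops.induct) (auto intro: hops.intros)

lemma hops_in: "hops m \<sigma> A k x y \<Longrightarrow> x \<in> A \<and> y \<in> A"
  by (induction rule: hops.induct) auto

lemma hops_sequence:
  assumes "\<And>i. i \<le> k \<Longrightarrow> f i \<in> A" "\<And>i. i < k \<Longrightarrow> mdist m (f i) (f (Suc i)) \<le> \<sigma>"
  shows "hops m \<sigma> A k (f 0) (f k)"
  using assms by (induction k) (auto intro: hops.intros)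

lemma hops_curve:
  assumes "a \<le> b" "\<And>t. t \<in> {a..b} \<Longrightarrow> f t \<in> A"
    and "\<And>s t. s \<in> {a..b} \<Longrightarrow> t \<in> {a..b} \<Longrightarrow> \<bar>s - t\<bar> \<le> 1 \<Longrightarrow> mdist m (f s) (f t) \<le> \<sigma>"
  obtains k where "hops m \<sigma> A k (f a) (f b)" "real k \<le> b - a + 1"
proof -
  define k where "k = nat \<lceil>b - a\<rceil>"
  define t where "t = (\<lambda>i. a + real i * ((b - a) / real k))"
  have k: "b - a \<le> real k" "real k \<le> b - a + 1" using assms(1) unfolding k_def by linarith+
  \<comment> \<open>For \<open>k = 0\<close> the quotient is 0 by convention, and
    \<open>b = a\<close>.\<close>
  have stp: "0 \<le> (b - a) / real k" "(b - a) / real k \<le> 1"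
    using k(1) assms(1) by (auto simp: divide_le_eq_1)
  have last: "t k = b" using k(1) assms(1) by (cases "k = 0") (auto simp: t_def)
  have diff: "t (Suc i) = t i + (b - a) / real k" for i
    by (simp add: t_def distrib_right add_divide_distrib)
  have t_mono: "i \<le> j \<Longrightarrow> t i \<le> t j" for i j
    using stp unfolding t_def by (intro add_left_mono mult_right_mono) auto
  have t_in: "t i \<in> {a..b}" if "i \<le> k" for i
    using t_mono[of 0 i] t_mono[OF that] last by (auto simp: t_def)
  have "hops m \<sigma> A k ((\<lambda>i. f (t i)) 0) ((\<lambda>i. f (t i)) k)"
  proof (rule hops_sequence)
    show "f (t i) \<in> A" if "i \<le> k" for i using assms(2) t_in that by blast
    show "mdist m (f (t i)) (f (t (Suc i))) \<le> \<sigma>" if "i < k" for i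
      using t_in[of i] t_in[of "Suc i"] that t_mono[of i "Suc i"] stp(2) diff[of i]
      by (intro assms(3)) auto
  qed
  moreover have "t 0 = a" by (simp add: t_def)
  ultimately show ?thesis using that k last by simp
qed

text \<open>
  Shortest paths for a bounded integer weight are quasi-geodesics of the original metric, with
  constants depending only on the bound.
\<close>

inductive weighted ::
  "'p metric \<Rightarrow> real \<Rightarrow> ('p \<Rightarrow> nat) \<Rightarrow> 'p \<Rightarrow> 'p \<Rightarrow> nat \<Rightarrow> bool" for m \<sigma> w where
  nil: "x \<in> mspace m \<Longrightarrow> weighted m \<sigma> w x x 0"
| snoc: "\<lbrakk>weighted m \<sigma> w x y n; z \<in> mspace m; mdist m y z \<le> \<sigma>\<rbrakk> \<Longrightarrow> weighted m \<sigma> w x z (n + w y)"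

text \<open>With natural weights the least total weight is attained in any space. Where no sequence
  exists the value is unspecified, hence the witnesses \<open>weighted m \<sigma> w x y n\<close> in
  \<open>weighted_wdist\<close> and \<open>shortest_sequence\<close>.\<close>

definition wdist :: "'p metric \<Rightarrow> real \<Rightarrow> ('p \<Rightarrow> nat) \<Rightarrow> 'p \<Rightarrow> 'p \<Rightarrow> nat" where
  "wdist m \<sigma> w x y = (LEAST n. weighted m \<sigma> w x y n)"

lemma wdist_le: "weighted m \<sigma> w x y n \<Longrightarrow> wdist m \<sigma> w x y \<le> n"
  unfolding wdist_def by (rule Least_le)

lemma weighted_wdist: "weighted m \<sigma> w x y n \<Longrightarrow> weighted m \<sigma> w x y (wdist m \<sigma> w x y)"
  unfolding wdist_def by (rule LeastI)

lemma weighted_hops: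
  assumes "hops m \<sigma> A k y z" "weighted m \<sigma> w x y n" "A \<subseteq> mspace m" "\<forall>a\<in>A. w a \<le> W"
  shows "\<exists>n'. weighted m \<sigma> w x z n' \<and> n' \<le> n + W * k"
  using assms(1,2)
proof (induction rule: hops.induct)
  case (hops_Suc k y v z)
  from hops_Suc.IH[OF hops_Suc.prems] obtain n' where
    n': "weighted m \<sigma> w x v n'" "n' \<le> n + W * k" by (elim exE conjE)
  have "v \<in> A" using hops_in[OF hops_Suc.hyps(1)] by simp
  then have "n' + w v \<le> n + W * Suc k" using n'(2) bspec[OF assms(4) \<open>v \<in> A\<close>] by simp
  moreover have "z \<in> mspace m" using hops_Suc.hyps(2) assms(3) by blast
  ultimately show ?case using weighted.snoc[OF n'(1) _ hops_Suc.hyps(3)] by blast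
qed auto

text \<open>An initial piece of a shortest sequence is shortest, since a lighter way to
  \<open>y\<close> would give a lighter way to the last point. So the weighted distance from
  \<open>x\<close> grows along the sequence by exactly the weight of the point that is left.\<close>

lemma shortest_sequence:
  assumes "weighted m \<sigma> w x y n" "n = wdist m \<sigma> w x y"
  shows "\<exists>j z. z 0 = x \<and> z j = y \<and> (\<forall>i\<le>j. z i \<in> mspace m) \<and>
    (\<forall>i<j. mdist m (z i) (z (Suc i)) \<le> \<sigma> \<and>
       wdist m \<sigma> w x (z (Suc i)) = wdist m \<sigma> w x (z i) + w (z i)) \<and>
    (\<forall>i\<le>j. \<exists>n. weighted m \<sigma> w x (z i) n)"
  using assms
proof (induction rule: weighted.induct)
  case (nil x)
  then show ?case using weighted.nil[OF nil(1)] by (intro exI[of _ 0] exI[of _ "\<lambda>_. x"]) auto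
next
  case (snoc x y n v)
  have "wdist m \<sigma> w x v \<le> wdist m \<sigma> w x y + w y"
    by (intro wdist_le weighted.snoc weighted_wdist[OF snoc.hyps(1)] snoc.hyps)
  moreover have le: "wdist m \<sigma> w x y \<le> n" using wdist_le[OF snoc.hyps(1)] .
  ultimately have n: "n = wdist m \<sigma> w x y" using snoc.prems by simp
  from snoc.IH[OF this] obtain j z where z: "z 0 = x" "z j = y" "\<forall>i\<le>j. z i \<in> mspace m"
    "\<forall>i<j. mdist m (z i) (z (Suc i)) \<le> \<sigma> \<and>
       wdist m \<sigma> w x (z (Suc i)) = wdist m \<sigma> w x (z i) + w (z i)"
    "\<forall>i\<le>j. \<exists>n. weighted m \<sigma> w x (z i) n" by blast
  have *: "weighted m \<sigma> w x v (n + w y)" by (intro weighted.snoc snoc.hyps)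
  show ?case
  proof (rule exI[of _ "Suc j"], rule exI[of _ "z(Suc j := v)"], intro conjI allI impI)
    show "(z(Suc j := v)) 0 = x" "(z(Suc j := v)) (Suc j) = v" using z(1) by simp_all
    fix i
    show "(z(Suc j := v)) i \<in> mspace m" if "i \<le> Suc j"
      using that z(3) snoc.hyps(2) by (cases "i = Suc j") auto
    show "\<exists>n. weighted m \<sigma> w x ((z(Suc j := v)) i) n" if "i \<le> Suc j"
      using that z(5) * by (cases "i = Suc j") auto
    show "mdist m ((z(Suc j := v)) i) ((z(Suc j := v)) (Suc i)) \<le> \<sigma>" if "i < Suc j"
      using that z(2,4) snoc.hyps(3) by (cases "i = j") auto
    show "wdist m \<sigma> w x ((z(Suc j := v)) (Suc i)) =
        wdist m \<sigma> w x ((z(Suc j := v)) i) + w ((z(Suc j := v)) i)" if "i < Suc j"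
    proof (cases "i = j")
      case True
      have "wdist m \<sigma> w x v = wdist m \<sigma> w x y + w y" using n snoc.prems by linarith
      then show ?thesis using True z(2) by simp
    next
      case False
      then show ?thesis using that z(4) by simp
    qed
  qed
qed

lemma shortest_sequence_lower:
  assumes "\<forall>i<j. wdist m \<sigma> w x (z (Suc i)) = wdist m \<sigma> w x (z i) + w (z i)"
    "\<And>i. b \<le> i \<Longrightarrow> i < b' \<Longrightarrow> c \<le> w (z i)" "b \<le> b'" "b' \<le> j"
  shows "wdist m \<sigma> w x (z b) + (b' - b) * c \<le> wdist m \<sigma> w x (z b')"
  using assms(3,2,4)
proof (induction b' rule: dec_induct)
  case (step n)
  have "wdist m \<sigma> w x (z (Suc n)) = wdist m \<sigma> w x (z n) + w (z n)" using assms(1) step by simp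
  moreover have "c \<le> w (z n)" using step by simp
  moreover have "wdist m \<sigma> w x (z b) + (n - b) * c \<le> wdist m \<sigma> w x (z n)" using step by simp
  moreover have "(Suc n - b) * c = (n - b) * c + c" using step by (simp add: Suc_diff_le)
  ultimately show ?case by simp
qed simp

section \<open>Length of curves\<close>

lemma curve_length_lipschitz:
  assumes \<eta>: "\<And>s t. s \<in> {a..b} \<Longrightarrow> t \<in> {a..b} \<Longrightarrow> mdist m (\<eta> s) (\<eta> t) \<le> \<Lambda> * \<bar>s - t\<bar>" and "0 \<le> \<Lambda>"
    "a \<le> b"
  shows "curve_length m \<eta> a b \<le> ennreal (\<Lambda> * (b - a))"
  unfolding curve_length_def
proof (rule Sup_least, clarify)
  fix n :: nat and t :: "nat \<Rightarrow> real"
  assume t: "\<forall>i<n. t i \<le> t (Suc i)" and ab: "a = t 0" "b = t n"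
  have mono: "t i \<le> t k" if "i \<le> k" "k \<le> n" for i k
    using that by (induction k rule: dec_induct) (use t in \<open>auto intro: order_trans\<close>)
  have "mdist m (\<eta> (t i)) (\<eta> (t (Suc i))) \<le> \<Lambda> * (t (Suc i) - t i)" if "i < n" for i
    using \<eta>[of "t i" "t (Suc i)"] mono[of 0 i] mono[of i n] mono[of 0 "Suc i"] mono[of "Suc i" n]
      mono[of i "Suc i"] that ab by auto
  then have "(\<Sum>i<n. mdist m (\<eta> (t i)) (\<eta> (t (Suc i)))) \<le> (\<Sum>i<n. \<Lambda> * (t (Suc i) - t i))"
    by (intro sum_mono) auto
  also have "\<dots> = \<Lambda> * (t n - t 0)"
    by (simp add: sum_distrib_left[symmetric] sum_lessThan_telescope)
  finally show "(\<Sum>i<n. ennreal (mdist m (\<eta> (t i)) (\<eta> (t (Suc i))))) \<le> ennreal (\<Lambda> * (t n - t 0))"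
    by (simp add: sum_ennreal ennreal_leI)
qed

lemma curve_length_ge:
  assumes "t 0 = a" "t n = b" "\<forall>i<n. t i \<le> t (Suc i)" "curve_length m \<eta> a b \<le> ennreal l" "0 \<le> l"
  shows "(\<Sum>i<n. mdist m (\<eta> (t i)) (\<eta> (t (Suc i)))) \<le> l"
proof -
  have "(\<Sum>i<n. ennreal (mdist m (\<eta> (t i)) (\<eta> (t (Suc i))))) \<le> curve_length m \<eta> a b"
    unfolding curve_length_def
    by (rule Sup_upper, rule CollectI, rule exI[of _ n], rule exI[of _ t]) (use assms(1-3) in simp)
  then have "ennreal (\<Sum>i<n. mdist m (\<eta> (t i)) (\<eta> (t (Suc i)))) \<le> ennreal l"
    using assms(4) by (simp add: sum_ennreal)
  then show ?thesis using assms(5) by simp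
qed

text \<open>Induction on \<open>J\<close>: a point between the values at 0 and \<open>Suc J\<close>
  but not between those at 0 and \<open>J\<close> lies between the last two values, which differ by
  at most \<open>p\<close>.\<close>

lemma discrete_ivt:
  fixes \<tau> :: "nat \<Rightarrow> real"
  assumes "\<And>i. i < J \<Longrightarrow> \<bar>\<tau> i - \<tau> (Suc i)\<bar> \<le> p" "x \<in> {min (\<tau> 0) (\<tau> J)..max (\<tau> 0) (\<tau> J)}" "0 \<le> p"
  shows "\<exists>i\<le>J. \<bar>\<tau> i - x\<bar> \<le> p"
  using assms
proof (induction J)
  case (Suc J)
  show ?case
  proof (cases "x \<in> {min (\<tau> 0) (\<tau> J)..max (\<tau> 0) (\<tau> J)}")
    case True
    then have "\<exists>i\<le>J. \<bar>\<tau> i - x\<bar> \<le> p" using Suc by simp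
    then show ?thesis using le_SucI by blast
  next
    case False
    have "\<bar>\<tau> J - \<tau> (Suc J)\<bar> \<le> p" using Suc.prems(1) by simp
    with False Suc.prems(2) have "\<bar>\<tau> J - x\<bar> \<le> p" by (auto simp: min_def max_def split: if_splits)
    then show ?thesis by (intro exI[of _ J]) simp
  qed
qed auto

section \<open>Length metrics: continuous interpolation and detours around a ball\<close>

locale length_metric =
  fixes m :: "'p metric"
  \<comment> \<open>The slack 1 avoids deciding whether the infimum of path lengths is
    attained.\<close>
  assumes lipschitz_path: "\<lbrakk>x \<in> mspace m; y \<in> mspace m\<rbrakk> \<Longrightarrow> \<exists>f l. 0 \<le> l \<and> l \<le> mdist m x y + 1 \<and>
    f 0 = x \<and> f l = y \<and> (\<forall>t\<in>{0..l}. f t \<in> mspace m) \<and>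
    (\<forall>s\<in>{0..l}. \<forall>t\<in>{0..l}. mdist m (f s) (f t) \<le> \<bar>s - t\<bar>)"
begin

lemma hops_exist:
  assumes "x \<in> mspace m" "y \<in> mspace m" "1 \<le> \<sigma>"
  obtains k where "hops m \<sigma> (mspace m) k x y" "real k \<le> mdist m x y + 2"
proof -
  obtain f l where f: "0 \<le> l" "l \<le> mdist m x y + 1" "f 0 = x" "f l = y"
    "\<forall>t\<in>{0..l}. f t \<in> mspace m" "\<forall>s\<in>{0..l}. \<forall>t\<in>{0..l}. mdist m (f s) (f t) \<le> \<bar>s - t\<bar>"
    using lipschitz_path assms by metis
  have "mdist m (f s) (f t) \<le> \<sigma>" if "s \<in> {0..l}" "t \<in> {0..l}" "\<bar>s - t\<bar> \<le> 1" for s t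
    using f(6) that assms(3) by (meson order_trans)
  then obtain k where "hops m \<sigma> (mspace m) k (f 0) (f l)" "real k \<le> l - 0 + 1"
    using hops_curve[of 0 l f "mspace m" m \<sigma>] f by blast
  with f that show ?thesis by simp
qed

text \<open>The Morse property tests continuous curves, so a discrete detour has to be filled in.
  Each step is bridged by a Lipschitz path rescaled to a unit interval; its original duration is at
  most \<open>\<sigma> + 1\<close>, which becomes the Lipschitz constant.\<close>

lemma interpolate:
  assumes "\<And>i. i \<le> j \<Longrightarrow> z i \<in> mspace m" "\<And>i. i < j \<Longrightarrow> mdist m (z i) (z (Suc i)) \<le> \<sigma>" "0 \<le> \<sigma>"
  shows "\<exists>\<eta>. (\<forall>i\<le>j. \<eta> (real i) = z i) \<and> (\<forall>t\<in>{0..real j}. \<eta> t \<in> mspace m) \<and>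
    (\<forall>s\<in>{0..real j}. \<forall>t\<in>{0..real j}. mdist m (\<eta> s) (\<eta> t) \<le> (\<sigma> + 1) * \<bar>s - t\<bar>)"
  using assms
proof (induction j)
  case 0
  have "z 0 \<in> mspace m" using 0(1)[of 0] by simp
  then show ?case by (intro exI[of _ "\<lambda>_. z 0"]) auto
next
  case (Suc j)
  then obtain \<eta> where \<eta>: "\<And>i. i \<le> j \<Longrightarrow> \<eta> (real i) = z i" "\<And>t. t \<in> {0..real j} \<Longrightarrow> \<eta> t \<in> mspace m"
    "\<And>s t. s \<in> {0..real j} \<Longrightarrow> t \<in> {0..real j} \<Longrightarrow> mdist m (\<eta> s) (\<eta> t) \<le> (\<sigma> + 1) * \<bar>s - t\<bar>"
    by (metis le_SucI less_SucI)
  obtain f l where f: "0 \<le> l" "l \<le> mdist m (z j) (z (Suc j)) + 1" "f 0 = z j" "f l = z (Suc j)"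
    "\<And>t. t \<in> {0..l} \<Longrightarrow> f t \<in> mspace m"
    "\<And>s t. s \<in> {0..l} \<Longrightarrow> t \<in> {0..l} \<Longrightarrow> mdist m (f s) (f t) \<le> \<bar>s - t\<bar>"
    using lipschitz_path[of "z j" "z (Suc j)"] Suc.prems(1) by (metis le_SucI order_refl)
  have l: "l \<le> \<sigma> + 1" using f(2) Suc.prems(2)[of j] by simp
  define \<theta> where "\<theta> = (\<lambda>t. if t \<le> real j then \<eta> t else f ((t - real j) * l))"
  have sc: "(t - real j) * l \<in> {0..l}" if "t \<in> {real j..real (Suc j)}" for t
    using that f(1) mult_right_mono[of "t - real j" 1 l] by auto
  have \<theta>1: "\<theta> t = \<eta> t" if "t \<in> {0..real j}" for t using that by (simp add: \<theta>_def)
  have \<theta>2: "\<theta> t = f ((t - real j) * l)" if "t \<in> {real j..real (Suc j)}" for t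
    using that \<eta>(1)[of j] f(3) by (auto simp: \<theta>_def)
  have in_S: "\<theta> t \<in> mspace m" if "t \<in> {0..real (Suc j)}" for t
    using that \<theta>1[of t] \<theta>2[of t] \<eta>(2)[of t] f(5)[OF sc[of t]] by (cases "t \<le> real j") auto
  have 1: "mdist m (\<theta> s) (\<theta> t) \<le> (\<sigma> + 1) * \<bar>s - t\<bar>" if "s \<in> {0..real j}" "t \<in> {0..real j}" for s t
    using \<eta>(3)[OF that] \<theta>1 that by simp
  have 2: "mdist m (\<theta> s) (\<theta> t) \<le> (\<sigma> + 1) * \<bar>s - t\<bar>"
    if "s \<in> {real j..real (Suc j)}" "t \<in> {real j..real (Suc j)}" for s t
  proof -
    have "mdist m (\<theta> s) (\<theta> t) \<le> \<bar>(s - real j) * l - (t - real j) * l\<bar>"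
      using f(6)[OF sc[OF that(1)] sc[OF that(2)]] \<theta>2 that by simp
    also have "\<dots> = l * \<bar>s - t\<bar>"
      using f(1) by (simp add: left_diff_distrib[symmetric] abs_mult)
    also have "\<dots> \<le> (\<sigma> + 1) * \<bar>s - t\<bar>" using l by (intro mult_right_mono) auto
    finally show ?thesis .
  qed
  have 3: "mdist m (\<theta> s) (\<theta> t) \<le> (\<sigma> + 1) * \<bar>s - t\<bar>"
    if "s \<in> {0..real j}" "t \<in> {real j..real (Suc j)}" for s t
  proof -
    have "mdist m (\<theta> s) (\<theta> t) \<le> mdist m (\<theta> s) (\<theta> (real j)) + mdist m (\<theta> (real j)) (\<theta> t)"
      using that by (intro mdist_triangle in_S) auto
    also have "\<dots> \<le> (\<sigma> + 1) * \<bar>s - real j\<bar> + (\<sigma> + 1) * \<bar>real j - t\<bar>"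
      using that by (intro add_mono 1 2) auto
    also have "\<dots> = (\<sigma> + 1) * \<bar>s - t\<bar>"
      using that by (simp add: distrib_left[symmetric])
    finally show ?thesis .
  qed
  have "mdist m (\<theta> s) (\<theta> t) \<le> (\<sigma> + 1) * \<bar>s - t\<bar>"
    if "s \<in> {0..real (Suc j)}" "t \<in> {0..real (Suc j)}" for s t
    using that 1[of s t] 2[of s t] 3[of s t]
      3[of t s, unfolded mdist_commute[of m "\<theta> t" "\<theta> s"] abs_minus_commute[of t s]]
    by (cases "s \<le> real j"; cases "t \<le> real j") auto
  moreover have "\<theta> (real i) = z i" if "i \<le> Suc j" for i
    using that \<eta>(1)[of i] f(4) by (cases "i = Suc j") (auto simp: \<theta>_def)
  ultimately show ?case using in_S by blast
qed

text \<open>The Lipschitz bound serves the upper estimate and the length, the hypothesis on integer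
  parameters serves the lower estimate. Rounding both parameters down costs
  \<open>2 * \<Lambda>\<close> in distance and 1 in duration; together with the 2 of the hypothesis
  this makes \<open>q1 = 3 + 2 * \<Lambda>\<close>.\<close>

lemma improved_interpolate:
  assumes z: "\<And>i. i \<le> j \<Longrightarrow> z i \<in> mspace m" "\<And>i. i < j \<Longrightarrow> mdist m (z i) (z (Suc i)) \<le> \<sigma>" "0 \<le> \<sigma>"
    and W: "1 \<le> W" "\<And>i i'. i \<le> i' \<Longrightarrow> i' \<le> j \<Longrightarrow> real (i' - i) \<le> W * (mdist m (z i) (z i') + 2)"
  obtains \<eta> where "\<forall>i\<le>j. \<eta> (real i) = z i"
    "improved_quasi_geodesic m (W + \<sigma> + 1) (2 * \<sigma> + 5) {0..real j} \<eta>"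
proof -
  define \<Lambda> where "\<Lambda> = \<sigma> + 1"
  define L1 where "L1 = W + \<sigma> + 1"
  define q1 where "q1 = 2 * \<sigma> + 5"
  have L1: "1 \<le> L1" "\<Lambda> \<le> L1" "W \<le> L1" "0 \<le> q1" "0 \<le> \<Lambda>" "q1 = 3 + 2 * \<Lambda>"
    using z(3) W(1) by (simp_all add: L1_def q1_def \<Lambda>_def)
  obtain \<eta> where \<eta>: "\<And>i. i \<le> j \<Longrightarrow> \<eta> (real i) = z i" "\<And>t. t \<in> {0..real j} \<Longrightarrow> \<eta> t \<in> mspace m"
    and lip: "\<And>s t. s \<in> {0..real j} \<Longrightarrow> t \<in> {0..real j} \<Longrightarrow> mdist m (\<eta> s) (\<eta> t) \<le> \<Lambda> * \<bar>s - t\<bar>"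
    using interpolate[of j z \<sigma>, OF z] unfolding \<Lambda>_def by blast
  have low': "t - s \<le> W * (mdist m (\<eta> s) (\<eta> t) + q1)"
    if st: "s \<in> {0..real j}" "t \<in> {0..real j}" "s \<le> t" for s t
  proof -
    define i where "i = nat \<lfloor>s\<rfloor>"
    define i' where "i' = nat \<lfloor>t\<rfloor>"
    have i: "real i \<le> s" "s - real i \<le> 1" and i': "real i' \<le> t" "t - real i' \<le> 1" and ii: "i \<le> i'"
      using st unfolding i_def i'_def by (auto intro: nat_mono floor_mono) linarith+
    have j: "i \<le> j" "i' \<le> j" using i i' st by auto
    have "mdist m (\<eta> (real i)) (\<eta> s) \<le> \<Lambda> * 1"
      using lip[of "real i" s] i st j L1(5) mult_left_mono[of "\<bar>real i - s\<bar>" 1 \<Lambda>] by auto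
    moreover have "mdist m (\<eta> t) (\<eta> (real i')) \<le> \<Lambda> * 1"
      using lip[of t "real i'"] i' st j L1(5) mult_left_mono[of "\<bar>t - real i'\<bar>" 1 \<Lambda>] by auto
    moreover have "mdist m (\<eta> (real i)) (\<eta> (real i'))
        \<le> mdist m (\<eta> (real i)) (\<eta> s) + mdist m (\<eta> s) (\<eta> t) + mdist m (\<eta> t) (\<eta> (real i'))"
      using mdist_triangle[of "\<eta> (real i)" m "\<eta> s" "\<eta> (real i')"]
        mdist_triangle[of "\<eta> s" m "\<eta> t" "\<eta> (real i')"] \<eta>(2)[of "real i"] \<eta>(2)[of "real i'"]
        \<eta>(2)[OF st(1)] \<eta>(2)[OF st(2)] j by auto
    ultimately have "mdist m (z i) (z i') \<le> mdist m (\<eta> s) (\<eta> t) + 2 * \<Lambda>"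
      using \<eta>(1) j by simp
    then have "W * (mdist m (z i) (z i') + 2) \<le> W * (mdist m (\<eta> s) (\<eta> t) + 2 * \<Lambda> + 2)"
      using W(1) by (intro mult_left_mono) auto
    then have "real (i' - i) \<le> W * (mdist m (\<eta> s) (\<eta> t) + 2 * \<Lambda> + 2)"
      using W(2)[OF ii j(2)] by linarith
    moreover have "t - s \<le> real (i' - i) + 1"
      using i i' ii by (simp add: of_nat_diff)
    moreover have "W * (mdist m (\<eta> s) (\<eta> t) + q1) = W * (mdist m (\<eta> s) (\<eta> t) + 2 * \<Lambda> + 2) + W"
      by (simp add: L1(6) algebra_simps)
    ultimately show ?thesis using W(1) by linarith
  qed
  have low: "\<bar>s - t\<bar> \<le> L1 * (mdist m (\<eta> s) (\<eta> t) + q1)"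
    if st: "s \<in> {0..real j}" "t \<in> {0..real j}" for s t
  proof -
    have "\<bar>s - t\<bar> \<le> W * (mdist m (\<eta> s) (\<eta> t) + q1)"
      using low'[of s t] low'[of t s] st mdist_commute[of m "\<eta> s" "\<eta> t"] by (cases "s \<le> t") auto
    also have "\<dots> \<le> L1 * (mdist m (\<eta> s) (\<eta> t) + q1)"
      using L1 by (intro mult_right_mono) auto
    finally show ?thesis .
  qed
  have qg: "quasi_geodesic m L1 q1 {0..real j} \<eta>"
    unfolding quasi_geodesic_def
  proof (intro conjI ballI)
    fix s t assume st: "s \<in> {0..real j}" "t \<in> {0..real j}"
    show "1 / L1 * \<bar>s - t\<bar> - q1 \<le> mdist m (\<eta> s) (\<eta> t)"
      using low[OF st] L1(1) by (simp add: field_simps)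
    have "\<Lambda> * \<bar>s - t\<bar> \<le> L1 * \<bar>s - t\<bar>" using L1 by (intro mult_right_mono) auto
    with lip[OF st] show "mdist m (\<eta> s) (\<eta> t) \<le> L1 * \<bar>s - t\<bar> + q1" using L1 by linarith
  qed (use L1 \<eta> in \<open>auto simp: is_interval_cc\<close>)
  have cont: "continuous_map (top_of_set {0..real j}) (mtopology_of m) \<eta>"
    unfolding mtopology_of_def
  proof (subst Metric_space.continuous_map_to_metric[OF Metric_space_mspace_mdist], intro ballI allI impI)
    fix s and e :: real assume s: "s \<in> topspace (top_of_set {0..real j})" and e: "0 < e"
    let ?U = "{0..real j} \<inter> ball s (e / (\<Lambda> + 1))"
    have "\<eta> t \<in> Metric_space.mball (mspace m) (mdist m) (\<eta> s) e" if t: "t \<in> ?U" for t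
    proof -
      have "mdist m (\<eta> s) (\<eta> t) \<le> \<Lambda> * \<bar>s - t\<bar>" using lip s t by simp
      also have "\<dots> \<le> (\<Lambda> + 1) * \<bar>s - t\<bar>" by (intro mult_right_mono) auto
      also have "\<dots> < (\<Lambda> + 1) * (e / (\<Lambda> + 1))"
        using t L1 by (intro mult_strict_left_mono) (auto simp: dist_real_def)
      also have "\<dots> = e" using L1 by simp
      finally show ?thesis
        using \<eta>(2) s t by (simp add: Metric_space.in_mball[OF Metric_space_mspace_mdist])
    qed
    moreover have "openin (top_of_set {0..real j}) ?U" by (simp add: openin_open_Int)
    moreover have "s \<in> ?U" using s e L1 by simp
    ultimately show "\<exists>U. openin (top_of_set {0..real j}) U \<and> s \<in> U \<and>
        (\<forall>y\<in>U. \<eta> y \<in> Metric_space.mball (mspace m) (mdist m) (\<eta> s) e)" by blast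
  qed
  have "curve_length m \<eta> t t' \<le> ennreal (L1 * (L1 + q1) * mdist m (\<eta> t) (\<eta> t') +
      (L1 * (2 * (L1 + q1)) + 3) * (L1 + q1))"
    if t: "t \<in> {0..real j}" "t' \<in> {0..real j}" "t \<le> t'" for t t'
  proof -
    let ?d = "mdist m (\<eta> t) (\<eta> t')"
    have "curve_length m \<eta> t t' \<le> ennreal (\<Lambda> * (t' - t))"
      using t L1 by (intro curve_length_lipschitz lip) auto
    moreover have "\<Lambda> * (t' - t) \<le> \<Lambda> * (L1 * (?d + q1))"
      using low[OF t(1,2)] t L1 by (intro mult_left_mono) auto
    moreover have "\<Lambda> * (L1 * (?d + q1)) \<le> (L1 + q1) * (L1 * (?d + q1))"
      using L1 by (intro mult_right_mono) auto
    \<comment> \<open>The constant \<open>k2\<close> of improved quasi-geodesics leaves room: its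
      factor \<open>L1 * (2 * (L1 + q1)) + 3\<close> exceeds \<open>L1 * q1\<close>.\<close>
    moreover have "(L1 + q1) * (L1 * (?d + q1))
        \<le> L1 * (L1 + q1) * ?d + (L1 * (2 * (L1 + q1)) + 3) * (L1 + q1)"
    proof -
      have "(L1 + q1) * (L1 * q1) \<le> (L1 + q1) * (L1 * (2 * (L1 + q1)) + 3)"
        using L1 by (intro mult_left_mono add_increasing2) auto
      then show ?thesis by (simp add: algebra_simps)
    qed
    ultimately have "\<Lambda> * (t' - t) \<le> L1 * (L1 + q1) * ?d + (L1 * (2 * (L1 + q1)) + 3) * (L1 + q1)"
      by linarith
    then show ?thesis
      by (rule order_trans[OF \<open>curve_length m \<eta> t t' \<le> _\<close> ennreal_leI])
  qed
  with qg cont have "improved_quasi_geodesic m L1 q1 {0..real j} \<eta>"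
    by (simp add: improved_quasi_geodesic_def Let_def)
  with that[of \<eta>] \<eta>(1) show ?thesis unfolding L1_def q1_def by blast
qed

text \<open>Take a sequence of least weight from \<open>x\<close> to \<open>y\<close>, where points
  of the closed \<open>\<rho>\<close>-ball cost \<open>W\<close> and all others 1. The given chain
  avoids the ball, so the least weight is at most \<open>k\<close>. A visit to the ball of half the
  radius would be preceded by about \<open>\<rho> / (2 * \<sigma>)\<close> points of the large ball,
  whose weight alone exceeds \<open>k\<close>. As all weights lie between 1 and \<open>W\<close>,
  the minimiser is a quasi-geodesic of the unweighted metric, with a constant independent of
  \<open>\<rho>\<close>.\<close>

lemma avoiding_quasi_geodesic:
  assumes c: "c \<in> mspace m" and hops: "hops m \<sigma> A k x y" and A: "A \<subseteq> mspace m" "\<forall>a\<in>A. \<rho> < mdist m a c"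
    and \<sigma>: "1 \<le> \<sigma>" "4 * \<sigma> \<le> \<rho>" and W: "1 \<le> W" "real k * (4 * \<sigma>) < real W * \<rho>"
  obtains j z where "z 0 = x" "z j = y" "\<forall>i\<le>j. z i \<in> mspace m"
    "\<forall>i\<le>j. \<rho> / 2 < mdist m (z i) c" "\<forall>i<j. mdist m (z i) (z (Suc i)) \<le> \<sigma>"
    "\<forall>i i'. i \<le> i' \<longrightarrow> i' \<le> j \<longrightarrow> real (i' - i) \<le> real W * (mdist m (z i) (z i') + 2)"
proof -
  define w where "w = (\<lambda>a. if mdist m a c \<le> \<rho> then W else (1::nat))"
  define D where "D = wdist m \<sigma> w x"
  have xy: "x \<in> A" "y \<in> A" using hops_in[OF hops] by simp_all
  have "x \<in> mspace m" using xy A by blast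
  moreover have "\<forall>a\<in>A. w a \<le> 1" using A(2) by (auto simp: w_def)
  ultimately obtain n where n: "weighted m \<sigma> w x y n" "n \<le> 0 + 1 * k"
    using weighted_hops[OF hops weighted.nil A(1)] by blast
  have Dy: "D y \<le> k" using wdist_le[OF n(1)] n(2) by (simp add: D_def)
  obtain j z where z0: "z 0 = x" and zj: "z j = y" and z_in: "\<forall>i\<le>j. z i \<in> mspace m"
    and stp: "\<forall>i<j. mdist m (z i) (z (Suc i)) \<le> \<sigma> \<and> D (z (Suc i)) = D (z i) + w (z i)"
    and wz: "\<forall>i\<le>j. \<exists>n. weighted m \<sigma> w x (z i) n"
    using shortest_sequence[OF weighted_wdist[OF n(1)] HOL.refl] unfolding D_def by blast
  have D_lower: "D (z b) + (b' - b) * v \<le> D (z b')"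
    if "\<And>i. b \<le> i \<Longrightarrow> i < b' \<Longrightarrow> v \<le> w (z i)" "b \<le> b'" "b' \<le> j" for b b' v
    using stp shortest_sequence_lower[of j m \<sigma> w x z b b' v] that unfolding D_def by simp
  have dist_le: "mdist m (z b) (z b') \<le> real (b' - b) * \<sigma>" if "b \<le> b'" "b' \<le> j" for b b'
    using that
  proof (induction b' rule: dec_induct)
    case (step b')
    then have "mdist m (z b) (z b') \<le> real (b' - b) * \<sigma>" "mdist m (z b') (z (Suc b')) \<le> \<sigma>"
      using stp by auto
    moreover have "real (Suc b' - b) * \<sigma> = real (b' - b) * \<sigma> + \<sigma>"
      using step by (simp add: Suc_diff_le distrib_right)
    moreover have "mdist m (z b) (z (Suc b')) \<le> mdist m (z b) (z b') + mdist m (z b') (z (Suc b'))"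
      using step z_in by (intro mdist_triangle) auto
    ultimately show ?case by linarith
  qed (use z_in in simp)
  have avoid: "\<rho> / 2 < mdist m (z i) c" if i: "i \<le> j" for i
  proof (rule ccontr)
    assume *: "\<not> ?thesis"
    \<comment> \<open>Steps have size at most \<open>\<sigma>\<close>, so the \<open>K\<close>
      points before \<open>z i\<close> stay within \<open>\<rho> / 2\<close> of \<open>z i\<close>
      and hence in the \<open>\<rho>\<close>-ball.\<close>
    define K where "K = nat \<lfloor>\<rho> / (2 * \<sigma>)\<rfloor>"
    have q: "2 \<le> \<rho> / (2 * \<sigma>)" using \<sigma> by (simp add: field_simps)
    then have K: "real K \<le> \<rho> / (2 * \<sigma>)" "\<rho> / (2 * \<sigma>) - 1 \<le> real K" unfolding K_def by linarith+
    have close: "mdist m (z l) c \<le> \<rho>" if "l \<le> i" "i - l \<le> K" for l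
    proof -
      have "real (i - l) * \<sigma> \<le> (\<rho> / (2 * \<sigma>)) * \<sigma>"
        using that K(1) \<sigma>(1) by (intro mult_right_mono) auto
      also have "\<dots> = \<rho> / 2" using \<sigma>(1) by simp
      finally have "mdist m (z l) (z i) \<le> \<rho> / 2" using dist_le[OF that(1) i] by linarith
      moreover have "mdist m (z l) c \<le> mdist m (z l) (z i) + mdist m (z i) c"
        using that i z_in c by (intro mdist_triangle) auto
      ultimately show ?thesis using * by linarith
    qed
    \<comment> \<open>The sequence starts outside the ball, so there are indeed \<open>K\<close>
      points before \<open>z i\<close>.\<close>
    have Ki: "K < i"
    proof (rule ccontr)
      assume "\<not> K < i"
      then have "mdist m (z 0) c \<le> \<rho>" by (intro close) auto
      then show False using z0 A(2) xy by fastforce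
    qed
    have "D (z (i - K)) + (i - (i - K)) * W \<le> D (z i)"
    proof (rule D_lower)
      fix l assume "i - K \<le> l" "l < i"
      then have "mdist m (z l) c \<le> \<rho>" using Ki by (intro close) auto
      then show "W \<le> w (z l)" by (simp add: w_def)
    qed (use i in auto)
    moreover have "D (z i) + (j - i) * 0 \<le> D (z j)" using i by (intro D_lower) auto
    ultimately have "K * W \<le> k" using Ki Dy zj by simp
    then have "real K * real W \<le> real k" by (metis of_nat_le_iff of_nat_mult)
    \<comment> \<open>As \<open>\<rho> / (2 * \<sigma>)\<close> is at least 2, rounding it down
      loses at most half.\<close>
    moreover have "\<rho> / (4 * \<sigma>) \<le> real K"
    proof -
      have "\<rho> / (2 * \<sigma>) = 2 * (\<rho> / (4 * \<sigma>))" by simp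
      then show ?thesis using K(2) q by linarith
    qed
    then have "\<rho> / (4 * \<sigma>) * real W \<le> real K * real W" by (intro mult_right_mono) auto
    ultimately have "\<rho> / (4 * \<sigma>) * real W \<le> real k" by linarith
    then show False using W(2) \<sigma>(1) by (simp add: field_simps)
  qed
  have qg: "real (i' - i) \<le> real W * (mdist m (z i) (z i') + 2)" if i: "i \<le> i'" "i' \<le> j" for i i'
  proof -
    have in_S: "z i \<in> mspace m" "z i' \<in> mspace m" using z_in i by auto
    obtain kk where kk: "hops m \<sigma> (mspace m) kk (z i) (z i')" "real kk \<le> mdist m (z i) (z i') + 2"
      by (rule hops_exist[OF in_S \<sigma>(1)])
    obtain n0 where n0: "weighted m \<sigma> w x (z i) n0" using wz i by force
    have "\<forall>a\<in>mspace m. w a \<le> W" using W(1) by (simp add: w_def)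
    with weighted_hops[OF kk(1) weighted_wdist[OF n0] order_refl]
    obtain n' where "weighted m \<sigma> w x (z i') n'" "n' \<le> D (z i) + W * kk"
      unfolding D_def by blast
    then have "D (z i') \<le> D (z i) + W * kk" using wdist_le unfolding D_def by (meson order_trans)
    moreover have "D (z i) + (i' - i) * 1 \<le> D (z i')"
      using i W(1) by (intro D_lower) (auto simp: w_def)
    ultimately have "i' - i \<le> W * kk" by simp
    then have "real (i' - i) \<le> real W * real kk" by (metis of_nat_le_iff of_nat_mult)
    also have "\<dots> \<le> real W * (mdist m (z i) (z i') + 2)" using kk by (intro mult_left_mono) auto
    finally show ?thesis .
  qed
  show ?thesis
    by (rule that[OF z0 zj z_in]) (use avoid stp qg in auto)
qed

end

section \<open>Polygonal lines and coarse projections\<close>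

lemma seg_simps [simp]:
  "seg_start (subseg p s t) = (if s \<le> t then pt p s else undefined)"
  "seg_end (subseg p s t) = (if s \<le> t then pt p t else undefined)"
  "seg_dur (subseg p s t) = t - s" "lo (subseg p s t) = s" "hi (subseg p s t) = t"
  "seg_image (subseg p s t) = pt p ` {s..t}"
  "seg_start (const_seg a x) = x" "seg_end (const_seg a x) = x"
  "seg_image (const_seg a x) = {x}" "seg_dur (const_seg a x) = 0"
  by (auto simp: subseg_def const_seg_def seg_start_def seg_end_def seg_image_def seg_dur_def)

lemma seg_mid_subseg: "s \<le> t \<Longrightarrow> seg_mid (subseg p s t) = pt p ((s + t) / 2)"
  by (simp add: seg_mid_def subseg_def field_simps)

lemma rev_seg_simps:
  assumes "lo p \<le> hi p"
  shows "seg_start (rev_seg p) = seg_end p" "seg_end (rev_seg p) = seg_start p"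
    "seg_image (rev_seg p) = seg_image p"
proof -
  have "(\<lambda>t. lo p + hi p - t) ` {lo p..hi p} = {lo p..hi p}"
    by (simp add: image_diff_atLeastAtMost)
  then have "pt p ` {lo p..hi p} = (\<lambda>t. pt p (lo p + hi p - t)) ` {lo p..hi p}"
    by (metis image_image)
  then show "seg_image (rev_seg p) = seg_image p"
    by (simp add: seg_image_def rev_seg_def)
qed (use assms in \<open>auto simp: rev_seg_def seg_start_def seg_end_def\<close>)

lemma join_seg_simps:
  assumes "lo p \<le> hi p" "lo q \<le> hi q" "seg_end p = seg_start q"
  shows "seg_start (join_seg p q) = seg_start p" "seg_end (join_seg p q) = seg_end q"
    "seg_image (join_seg p q) = seg_image p \<union> seg_image q"
    "lo (join_seg p q) \<le> hi (join_seg p q)"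
proof -
  let ?f = "pt (join_seg p q)"
  have 1: "?f t = pt p t" if "t \<in> {lo p..hi p}" for t
    using that assms(2) by (auto simp: join_seg_def seg_dur_def)
  have 2: "?f t = pt q (t - hi p + lo q)" if "t \<in> {hi p..hi p + seg_dur q}" for t
    using that assms by (auto simp: join_seg_def seg_dur_def seg_start_def seg_end_def)
  show "seg_start (join_seg p q) = seg_start p"
    using 1[of "lo p"] assms(1) by (simp add: seg_start_def) (simp add: join_seg_def)
  show "seg_end (join_seg p q) = seg_end q"
    using 2[of "hi p + seg_dur q"] assms(2)
    by (simp add: seg_end_def seg_dur_def) (simp add: join_seg_def seg_dur_def)
  show "lo (join_seg p q) \<le> hi (join_seg p q)"
    using assms by (simp add: join_seg_def seg_dur_def)
  have "seg_image (join_seg p q) = ?f ` {lo p..hi p} \<union> ?f ` {hi p..hi p + seg_dur q}"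
    using assms(1,2) unfolding image_Un[symmetric] seg_image_def
    by (intro arg_cong[where f = "image ?f"]) (auto simp: join_seg_def seg_dur_def)
  also have "?f ` {lo p..hi p} = seg_image p"
    using 1 by (auto simp: seg_image_def)
  also have "?f ` {hi p..hi p + seg_dur q} = pt q ` ((\<lambda>t. t - hi p + lo q) ` {hi p..hi p + seg_dur q})"
    using 2 by (simp add: image_image)
  also have "(\<lambda>t. t - hi p + lo q) ` {hi p..hi p + seg_dur q} = {lo q..hi q}"
  proof -
    have "(\<lambda>t. t - hi p + lo q) = (\<lambda>t. t + (lo q - hi p))" by auto
    then show ?thesis using assms(2) by (simp only: image_add_atLeastAtMost') (simp add: seg_dur_def)
  qed
  finally show "seg_image (join_seg p q) = seg_image p \<union> seg_image q"
    by (simp add: seg_image_def)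
qed

locale path_system_on =
  fixes m :: "'p metric" and P :: "'p seg set" and L \<kappa> :: real
  assumes L: "1 \<le> L" and \<kappa>: "0 \<le> \<kappa>"
    and P_seg: "p \<in> P \<Longrightarrow> is_seg (mspace m) p"
    and P_improved: "p \<in> P \<Longrightarrow> improved_quasi_geodesic m L \<kappa> (seg_dom p) (pt p)"
    and P_const: "x \<in> mspace m \<Longrightarrow> const_seg a x \<in> P"
    and P_sub: "\<lbrakk>p \<in> P; lo p \<le> s; s \<le> t; t \<le> hi p\<rbrakk> \<Longrightarrow> subseg p s t \<in> P"
    and P_conn: "\<lbrakk>x \<in> mspace m; y \<in> mspace m\<rbrakk> \<Longrightarrow> \<exists>p\<in>P. seg_start p = x \<and> seg_end p = y"
    and P_rev: "p \<in> P \<Longrightarrow> rev_seg p \<in> P"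
begin

section \<open>Elementary estimates for special paths\<close>

abbreviation "d \<equiv> mdist m"
abbreviation "S \<equiv> mspace m"

lemma lo_hi: "p \<in> P \<Longrightarrow> lo p \<le> hi p"
  using P_seg by (auto simp: is_seg_def)

lemma pt_in: "p \<in> P \<Longrightarrow> t \<in> seg_dom p \<Longrightarrow> pt p t \<in> S"
  by (rule PiE_mem[of "pt p" "seg_dom p" "\<lambda>_. mspace m"]) (use P_seg in \<open>auto simp: is_seg_def\<close>)

lemma d_upper:
  "p \<in> P \<Longrightarrow> s \<in> seg_dom p \<Longrightarrow> t \<in> seg_dom p \<Longrightarrow> d (pt p s) (pt p t) \<le> L * \<bar>s - t\<bar> + \<kappa>"
  using P_improved unfolding improved_quasi_geodesic_def quasi_geodesic_def by blast

lemma d_upper_le: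
  assumes "p \<in> P" "s \<in> seg_dom p" "t \<in> seg_dom p" "\<bar>s - t\<bar> \<le> x"
  shows "d (pt p s) (pt p t) \<le> L * x + \<kappa>"
  using d_upper[OF assms(1-3)] mult_left_mono[OF assms(4), of L] L by linarith

lemma d_lower:
  assumes "p \<in> P" "s \<in> seg_dom p" "t \<in> seg_dom p"
  shows "\<bar>s - t\<bar> \<le> L * (d (pt p s) (pt p t) + \<kappa>)"
proof -
  have "1 / L * \<bar>s - t\<bar> - \<kappa> \<le> d (pt p s) (pt p t)"
    using P_improved assms unfolding improved_quasi_geodesic_def quasi_geodesic_def by blast
  then show ?thesis using L by (simp add: field_simps)
qed

lemma d_lower_le:
  assumes "p \<in> P" "s \<in> seg_dom p" "t \<in> seg_dom p" "d (pt p s) (pt p t) \<le> x"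
  shows "\<bar>s - t\<bar> \<le> L * (x + \<kappa>)"
  using d_lower[OF assms(1-3)] mult_left_mono[of "d (pt p s) (pt p t) + \<kappa>" "x + \<kappa>" L] assms(4) L
  by linarith

lemma P_continuous:
  "p \<in> P \<Longrightarrow> continuous_map (top_of_set (seg_dom p)) (mtopology_of m) (pt p)"
  using P_improved unfolding improved_quasi_geodesic_def by blast

text \<open>Bounds the diameter of a special path whose endpoints are at distance at most
  \<open>x\<close>: its duration is at most \<open>L * (x + \<kappa>)\<close>, to which the upper
  estimate is applied.\<close>

definition reach :: "real \<Rightarrow> real" where "reach x = L * (L * (x + \<kappa>)) + \<kappa>"

lemma reach_mono: "x \<le> y \<Longrightarrow> reach x \<le> reach y"
  using L by (simp add: reach_def)

lemma reach_nonneg: "0 \<le> x \<Longrightarrow> 0 \<le> reach x"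
  using L \<kappa> by (simp add: reach_def)

lemma seg_start_end_in:
  assumes "p \<in> P" shows "seg_start p \<in> S" "seg_end p \<in> S" "seg_image p \<subseteq> S"
    "seg_start p \<in> seg_image p" "seg_end p \<in> seg_image p"
  using pt_in[OF assms] lo_hi[OF assms] by (auto simp: seg_start_def seg_end_def seg_image_def)

lemma seg_dur_le:
  assumes "p \<in> P" "d (seg_start p) (seg_end p) \<le> x"
  shows "seg_dur p \<le> L * (x + \<kappa>)"
  using d_lower_le[OF assms(1), of "lo p" "hi p" x] lo_hi[OF assms(1)] assms(2)
  by (simp add: seg_dur_def seg_start_def seg_end_def)

lemma seg_diameter:
  assumes "p \<in> P" "d (seg_start p) (seg_end p) \<le> x" "z \<in> seg_image p" "z' \<in> seg_image p"
  shows "d z z' \<le> reach x"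
proof -
  obtain s t where s: "s \<in> seg_dom p" "z = pt p s" and t: "t \<in> seg_dom p" "z' = pt p t"
    using assms(3,4) by (auto simp: seg_image_def)
  then have "\<bar>s - t\<bar> \<le> seg_dur p" by (auto simp: seg_dur_def)
  also have "\<dots> \<le> L * (x + \<kappa>)" by (rule seg_dur_le[OF assms(1,2)])
  finally show ?thesis
    unfolding reach_def s(2) t(2) using d_upper_le[OF assms(1) s(1) t(1)] by blast
qed

text \<open>Thinness and midthinness see only the endpoints, the number of sides and the image of a
  polygonal line, so its parametrisation is dropped.\<close>

definition polyline :: "nat \<Rightarrow> 'p \<Rightarrow> 'p \<Rightarrow> 'p set \<Rightarrow> bool" where
  "polyline N x y A \<longleftrightarrow>
     (\<exists>\<alpha>. polygonal_line N P \<alpha> \<and> seg_start \<alpha> = x \<and> seg_end \<alpha> = y \<and> seg_image \<alpha> = A)"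

lemma polyline_mono: "polyline N x y A \<Longrightarrow> N \<le> N' \<Longrightarrow> polyline N' x y A"
  unfolding polyline_def polygonal_line_def using order_trans by blast

lemma polyline_special: "p \<in> P \<Longrightarrow> polyline 1 (seg_start p) (seg_end p) (seg_image p)"
  unfolding polyline_def polygonal_line_def using concatenation.single by blast

lemma concatenation_lo_hi: "concatenation P j \<alpha> \<Longrightarrow> lo \<alpha> \<le> hi \<alpha>"
  by (induction rule: concatenation.induct) (auto simp: lo_hi join_seg_def seg_dur_def intro: order_trans)

lemma polyline_join:
  assumes "polyline N x (seg_start p) A" "p \<in> P"
  shows "polyline (Suc N) x (seg_end p) (A \<union> seg_image p)"
proof -
  obtain j \<alpha> where \<alpha>: "j \<le> N" "concatenation P j \<alpha>" "seg_start \<alpha> = x" "seg_end \<alpha> = seg_start p"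
      "seg_image \<alpha> = A"
    using assms(1) unfolding polyline_def polygonal_line_def by blast
  note * = join_seg_simps[OF concatenation_lo_hi[OF \<alpha>(2)] lo_hi[OF assms(2)] \<alpha>(4)]
  show ?thesis
    unfolding polyline_def polygonal_line_def
    using concatenation.join[OF \<alpha>(2) assms(2) \<alpha>(4)] \<alpha> *
    by (intro exI[of _ "join_seg \<alpha> p"]) auto
qed

lemma polyline_concatenation:
  assumes "concatenation P j \<beta>" "polyline N x (seg_start \<beta>) A"
  shows "polyline (N + j) x (seg_end \<beta>) (A \<union> seg_image \<beta>)"
  using assms
proof (induction rule: concatenation.induct)
  case (single p)
  then show ?case using polyline_join by simp
next
  case (join j \<alpha> p)
  note * = join_seg_simps[OF concatenation_lo_hi[OF join.hyps(1)] lo_hi[OF join.hyps(2)] join.hyps(3)]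
  have "polyline (N + j) x (seg_start p) (A \<union> seg_image \<alpha>)"
    using join.IH join.prems join.hyps(3) * by simp
  from polyline_join[OF this join.hyps(2)] show ?case
    using * by (simp add: Un_assoc)
qed

lemma polyline_trans:
  assumes "polyline N x y A" "polyline N' y z B"
  shows "polyline (N + N') x z (A \<union> B)"
proof -
  obtain j \<beta> where \<beta>: "j \<le> N'" "concatenation P j \<beta>" "seg_start \<beta> = y" "seg_end \<beta> = z"
      "seg_image \<beta> = B"
    using assms(2) unfolding polyline_def polygonal_line_def by blast
  show ?thesis
    using polyline_mono[OF polyline_concatenation[OF \<beta>(2), of N x A]] assms(1) \<beta> by auto
qed

text \<open>Undirectedness enters here: every side is reversed. This reconciles midthinness, which
  concerns lines from the end of a segment to its start, with thinness, which treats both directions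
  alike.\<close>

lemma polyline_rev:
  assumes "polyline N x y A" shows "polyline N y x A"
proof -
  have "polyline j (seg_end \<alpha>) (seg_start \<alpha>) (seg_image \<alpha>)" if "concatenation P j \<alpha>" for j \<alpha>
    using that
  proof (induction rule: concatenation.induct)
    case (single p)
    then show ?case
      using polyline_special[OF P_rev[OF single]] rev_seg_simps[OF lo_hi[OF single]] by simp
  next
    case (join j \<alpha> p)
    note * = join_seg_simps[OF concatenation_lo_hi[OF join.hyps(1)] lo_hi[OF join.hyps(2)] join.hyps(3)]
    have "polyline 1 (seg_end p) (seg_end \<alpha>) (seg_image p)"
      using polyline_special[OF P_rev[OF join.hyps(2)]] rev_seg_simps[OF lo_hi[OF join.hyps(2)]]
        join.hyps(3) by simp
    from polyline_trans[OF this join.IH] show ?case using * by (simp add: Un_commute)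
  qed
  with assms show ?thesis
    unfolding polyline_def[of N x y A] polygonal_line_def using polyline_mono by blast
qed

lemma polyline_sub:
  assumes "p \<in> P" "s \<in> seg_dom p" "t \<in> seg_dom p"
  shows "polyline 1 (pt p s) (pt p t) (pt p ` {min s t..max s t})"
proof -
  have *: "polyline 1 (pt p s) (pt p t) (pt p ` {s..t})"
    if "s \<in> seg_dom p" "t \<in> seg_dom p" "s \<le> t" for s t
    using polyline_special[OF P_sub[OF assms(1), of s t]] that by simp
  show ?thesis
    using *[OF assms(2,3)] polyline_rev[OF *[OF assms(3,2)]]
    by (cases "s \<le> t") (auto simp: min_def max_def)
qed

lemma polyline_in:
  assumes "polyline N x y A" shows "A \<subseteq> S" "x \<in> A" "y \<in> A"
proof -
  have *: "seg_image \<alpha> \<subseteq> S \<and> seg_start \<alpha> \<in> seg_image \<alpha> \<and> seg_end \<alpha> \<in> seg_image \<alpha>"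
    if "concatenation P j \<alpha>" for j \<alpha>
    using that
  proof (induction rule: concatenation.induct)
    case (single p)
    then show ?case using seg_start_end_in by blast
  next
    case (join j \<alpha> p)
    note * = join_seg_simps[OF concatenation_lo_hi[OF join.hyps(1)] lo_hi[OF join.hyps(2)] join.hyps(3)]
    show ?case using join.IH seg_start_end_in[OF join.hyps(2)] unfolding * by blast
  qed
  from assms obtain j \<alpha> where "concatenation P j \<alpha>" "seg_start \<alpha> = x" "seg_end \<alpha> = y" "seg_image \<alpha> = A"
    unfolding polyline_def polygonal_line_def by blast
  with * show "A \<subseteq> S" "x \<in> A" "y \<in> A" by blast+
qed

lemma polyline_connect:
  assumes "x \<in> S" "y \<in> S" "d x y \<le> l"
  obtains A where "polyline 1 x y A" "\<And>z z'. z \<in> A \<Longrightarrow> z' \<in> A \<Longrightarrow> d z z' \<le> reach l"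
proof -
  obtain p where p: "p \<in> P" "seg_start p = x" "seg_end p = y"
    using P_conn assms by blast
  with polyline_special[OF p(1)] seg_diameter[OF p(1), of l] assms(3) that show ?thesis by simp
qed

definition thin :: "'p seg \<Rightarrow> nat \<Rightarrow> real \<Rightarrow> bool" where
  "thin h N \<rho> \<longleftrightarrow> (\<forall>s\<in>seg_dom h. \<forall>t\<in>seg_dom h. \<forall>u\<in>{min s t..max s t}. \<forall>A.
     polyline N (pt h s) (pt h t) A \<longrightarrow> (\<exists>z\<in>A. d z (pt h u) \<le> \<rho>))"

lemma thinD:
  assumes "thin h N \<rho>" "s \<in> seg_dom h" "t \<in> seg_dom h" "min s t \<le> u" "u \<le> max s t"
    "polyline N (pt h s) (pt h t) A"
  obtains z where "z \<in> A" "d z (pt h u) \<le> \<rho>"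
  using assms unfolding thin_def by (metis atLeastAtMost_iff)

text \<open>
  A coarse projection to \<open>h\<close>: the place where a special path from \<open>a\<close> to \<open>h\<close> first comes
  \<open>\<rho>\<close>-close to \<open>h\<close>.  Nearest points would not do, since special paths need not be geodesics.
\<close>

definition proj :: "'p seg \<Rightarrow> real \<Rightarrow> 'p \<Rightarrow> real \<Rightarrow> bool" where
  "proj h \<rho> a s \<longleftrightarrow> s \<in> seg_dom h \<and> (\<exists>p\<in>P. seg_start p = a \<and> d (seg_end p) (pt h s) \<le> \<rho> \<and>
     (\<forall>z\<in>seg_image p. \<forall>u\<in>seg_dom h. d z (pt h u) \<le> \<rho> \<longrightarrow> d z (pt h s) \<le> \<rho>))"

lemma proj_refl: "h \<in> P \<Longrightarrow> s \<in> seg_dom h \<Longrightarrow> 0 \<le> \<rho> \<Longrightarrow> proj h \<rho> (pt h s) s"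
  unfolding proj_def using pt_in[of h s]
  by (auto intro!: bexI[of _ "const_seg 0 (pt h s)"] P_const)

lemma continuous_on_d:
  assumes "continuous_map (top_of_set A) (mtopology_of m) f"
    "continuous_map (top_of_set B) (mtopology_of m) g"
  shows "continuous_on (A \<times> B) (\<lambda>x. d (f (fst x)) (g (snd x)))"
proof -
  have "continuous_map (top_of_set (A \<times> B)) (top_of_set A) fst"
    "continuous_map (top_of_set (A \<times> B)) (top_of_set B) snd"
    by (auto intro: continuous_intros)
  then have "continuous_map (top_of_set (A \<times> B)) (mtopology_of m) (f \<circ> fst)"
    "continuous_map (top_of_set (A \<times> B)) (mtopology_of m) (g \<circ> snd)"
    using assms continuous_map_compose by blast+
  from continuous_map_mdist[OF this] show ?thesis by (simp add: o_def)
qed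

text \<open>Ensures that extreme parameters at which two curves are \<open>r\<close>-close are
  attained: the first approach of a special path to \<open>h\<close>, and the two ends of an
  excursion away from \<open>h\<close>.\<close>

lemma compact_near:
  fixes A B :: "real set"
  assumes "continuous_map (top_of_set A) (mtopology_of m) f" "compact A"
    "continuous_map (top_of_set B) (mtopology_of m) g" "compact B"
  shows "compact {z \<in> A \<times> B. d (f (fst z)) (g (snd z)) \<le> r}"
proof -
  let ?K = "{z \<in> A \<times> B. d (f (fst z)) (g (snd z)) \<le> r}"
  have "closed ((A \<times> B) \<inter> (\<lambda>z. d (f (fst z)) (g (snd z))) -` {..r})"
    using assms by (intro continuous_closed_preimage closed_Times closed_atMost
        continuous_on_d) (simp_all add: compact_imp_closed)
  from compact_Int_closed[OF compact_Times[OF assms(2,4)] this]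
  have "compact ((A \<times> B) \<inter> ((A \<times> B) \<inter> (\<lambda>z. d (f (fst z)) (g (snd z))) -` {..r}))" .
  also have "(A \<times> B) \<inter> ((A \<times> B) \<inter> (\<lambda>z. d (f (fst z)) (g (snd z))) -` {..r}) = ?K"
    by auto
  finally show ?thesis .
qed

text \<open>Cut a special path from \<open>a\<close> to \<open>pt h x\<close> at the first time
  \<open>t\<close> at which it is \<open>\<rho>\<close>-close to \<open>h\<close>. On the truncated
  path only the endpoint is close to \<open>h\<close>, so any nearby point of \<open>h\<close>
  serves as projection. Both \<open>a\<close> and the cutting point lie on a path with endpoints at
  most \<open>l\<close> apart, whence \<open>reach l\<close>.\<close>

lemma proj_exists:
  assumes h: "h \<in> P" and x: "x \<in> seg_dom h" and a: "a \<in> S" "d a (pt h x) \<le> l" and \<rho>: "0 \<le> \<rho>"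
  obtains s where "proj h \<rho> a s" "d a (pt h s) \<le> reach l + \<rho>"
proof -
  obtain p where p: "p \<in> P" "seg_start p = a" "seg_end p = pt h x"
    using P_conn[OF a(1) pt_in[OF h x]] by blast
  define K where "K = {z \<in> seg_dom p \<times> seg_dom h. d (pt p (fst z)) (pt h (snd z)) \<le> \<rho>}"
  have "compact K"
    unfolding K_def
    by (rule compact_near[OF P_continuous[OF p(1)] compact_Icc P_continuous[OF h] compact_Icc])
  moreover have "(hi p, x) \<in> K"
    using p x lo_hi[OF p(1)] pt_in[OF h x] \<rho> by (auto simp: K_def seg_end_def)
  then have "K \<noteq> {}" by blast
  ultimately obtain z where z: "z \<in> K" "\<forall>z'\<in>K. fst z \<le> fst z'"
    using continuous_attains_inf[of K fst] continuous_on_fst[OF continuous_on_id] by blast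
  obtain t s where "z = (t, s)" by (rule prod.exhaust)
  with z have K: "(t, s) \<in> K" and min: "\<And>t' s'. (t', s') \<in> K \<Longrightarrow> t \<le> t'"
    by auto
  have t: "t \<in> seg_dom p" and s: "s \<in> seg_dom h" and ts: "d (pt p t) (pt h s) \<le> \<rho>"
    using K by (auto simp: K_def)
  have sub: "subseg p (lo p) t \<in> P" using P_sub[OF p(1), of "lo p" t] t by auto
  have "d (pt p w) (pt h s) \<le> \<rho>" if "w \<in> {lo p..t}" "u \<in> seg_dom h" "d (pt p w) (pt h u) \<le> \<rho>" for w u
  proof -
    have "(w, u) \<in> K" using that t by (auto simp: K_def)
    with min that have "w = t" by force
    with ts show ?thesis by simp
  qed
  then have "\<forall>z\<in>seg_image (subseg p (lo p) t). \<forall>u\<in>seg_dom h. d z (pt h u) \<le> \<rho> \<longrightarrow> d z (pt h s) \<le> \<rho>"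
    unfolding seg_simps by blast
  moreover have "seg_start (subseg p (lo p) t) = a" "seg_end (subseg p (lo p) t) = pt p t"
    using t p(2) by (simp_all add: seg_start_def subseg_def seg_end_def)
  ultimately have "proj h \<rho> a s"
    unfolding proj_def using s sub ts by metis
  moreover have "d a (pt p t) \<le> reach l"
    using seg_diameter[OF p(1), of l a "pt p t"] p a t seg_start_end_in(4)[OF p(1)]
    by (auto simp: seg_image_def)
  then have "d a (pt h s) \<le> reach l + \<rho>"
    using mdist_triangle[of a m "pt p t" "pt h s"] a pt_in[OF p(1) t] pt_in[OF h s] ts by linarith
  ultimately show ?thesis using that by blast
qed

text \<open>Close \<open>g\<close> up to a 5-gon from \<open>pt h s\<close> to \<open>pt h t\<close>
  by the two projecting paths and two short connections. The four added sides miss the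
  \<open>\<rho>\<close>-ball around \<open>pt h u\<close>: a connection has diameter at most
  \<open>reach \<rho>\<close> and contains \<open>pt h s\<close> or \<open>pt h t\<close>, and a
  point of a projecting path close to \<open>pt h u\<close> would, by the last clause of
  \<open>proj\<close>, be close to the projection as well. So thinness detects
  \<open>g\<close>.\<close>

lemma thin_meets:
  assumes h: "h \<in> P" and thin: "thin h 5 \<rho>"
    and g: "g \<in> P" "proj h \<rho> (seg_start g) s" "proj h \<rho> (seg_end g) t"
    and u: "u \<in> {min s t..max s t}"
    and far: "reach \<rho> + 2 * \<rho> < d (pt h u) (pt h s)" "reach \<rho> + 2 * \<rho> < d (pt h u) (pt h t)"
    and \<rho>: "0 \<le> \<rho>"
  obtains z where "z \<in> seg_image g" "d z (pt h u) \<le> \<rho>"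
proof -
  have s: "s \<in> seg_dom h" and t: "t \<in> seg_dom h" using g by (auto simp: proj_def)
  then have u': "u \<in> seg_dom h" using u by auto
  have approach: "\<exists>A. polyline 2 (pt h v) a A \<and> (\<forall>z\<in>A. \<rho> < d z (pt h u))"
    if pr: "proj h \<rho> a v" and far: "reach \<rho> + 2 * \<rho> < d (pt h u) (pt h v)" for a v
  proof -
    have v: "v \<in> seg_dom h" using pr by (auto simp: proj_def)
    obtain p where p: "p \<in> P" "seg_start p = a" "d (seg_end p) (pt h v) \<le> \<rho>"
        "\<And>z w. z \<in> seg_image p \<Longrightarrow> w \<in> seg_dom h \<Longrightarrow> d z (pt h w) \<le> \<rho> \<Longrightarrow> d z (pt h v) \<le> \<rho>"
      using pr unfolding proj_def by blast
    note in_S = pt_in[OF h v] pt_in[OF h u'] seg_start_end_in[OF p(1)]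
    obtain A where A: "polyline 1 (pt h v) (seg_end p) A"
        "\<And>z z'. z \<in> A \<Longrightarrow> z' \<in> A \<Longrightarrow> d z z' \<le> reach \<rho>"
      using polyline_connect[of "pt h v" "seg_end p" \<rho>] p(3) in_S by (metis mdist_commute)
    have 1: "polyline 2 (pt h v) a (A \<union> seg_image p)"
      using polyline_trans[OF A(1) polyline_rev[OF polyline_special[OF p(1)]]] p(2)
      by (simp add: numeral_2_eq_2)
    have "\<rho> < d z (pt h u)" if "z \<in> A" for z
      using A(2)[OF that polyline_in(2)[OF A(1)]] far mdist_triangle[of "pt h u" m z "pt h v"]
        polyline_in(1)[OF A(1)] that in_S mdist_commute[of m "pt h u" z] \<rho> by fastforce
    moreover have "\<rho> < d z (pt h u)" if "z \<in> seg_image p" for z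
    proof (rule ccontr)
      assume "\<not> ?thesis"
      then have "d z (pt h u) \<le> \<rho>" by simp
      moreover from p(4)[OF that u' this] have "d z (pt h v) \<le> \<rho>" .
      moreover have "z \<in> S" using that in_S by blast
      ultimately show False
        using far mdist_triangle[of "pt h u" m z "pt h v"] in_S mdist_commute[of m "pt h u" z]
          reach_nonneg[OF \<rho>] by fastforce
    qed
    ultimately show ?thesis using 1 by blast
  qed
  obtain A B where A: "polyline 2 (pt h s) (seg_start g) A" "\<And>z. z \<in> A \<Longrightarrow> \<rho> < d z (pt h u)"
    and B: "polyline 2 (pt h t) (seg_end g) B" "\<And>z. z \<in> B \<Longrightarrow> \<rho> < d z (pt h u)"
    using approach[OF g(2) far(1)] approach[OF g(3) far(2)] by blast
  have "polyline 5 (pt h s) (pt h t) (A \<union> seg_image g \<union> B)"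
    using polyline_trans[OF polyline_trans[OF A(1) polyline_special[OF g(1)]] polyline_rev[OF B(1)]]
    by simp
  then obtain z where "z \<in> A \<union> seg_image g \<union> B" "d z (pt h u) \<le> \<rho>"
    using thinD[OF thin s t] u by (metis atLeastAtMost_iff)
  with A(2) B(2) that show ?thesis by fastforce
qed

section \<open>Thin special paths are Morse\<close>

text \<open>If \<open>s\<close> and \<open>t\<close> are further apart than this, their mean is far
  enough from both for \<open>thin_meets\<close>.\<close>

definition drift :: "real \<Rightarrow> real" where "drift \<rho> = 2 * (L * (reach \<rho> + 2 * \<rho> + \<kappa>)) + 1"

lemma drift_ge_1: "0 \<le> \<rho> \<Longrightarrow> 1 \<le> drift \<rho>"
  using L \<kappa> reach_nonneg by (simp add: drift_def)

text \<open>Otherwise \<open>thin_meets\<close> at the middle parameter brings \<open>g\<close>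
  close to \<open>h\<close>. This is strong contraction in coarse form.\<close>

lemma proj_drift:
  assumes h: "h \<in> P" "thin h 5 \<rho>" and \<rho>: "0 \<le> \<rho>"
    and g: "g \<in> P" "proj h \<rho> (seg_start g) s" "proj h \<rho> (seg_end g) t"
    and avoid: "\<And>z u. z \<in> seg_image g \<Longrightarrow> u \<in> seg_dom h \<Longrightarrow> \<rho> < d z (pt h u)"
  shows "\<bar>s - t\<bar> \<le> drift \<rho>"
proof (rule ccontr)
  assume *: "\<not> ?thesis"
  define u where "u = (s + t) / 2"
  have s: "s \<in> seg_dom h" and t: "t \<in> seg_dom h" using g by (auto simp: proj_def)
  then have u: "u \<in> seg_dom h" by (auto simp: u_def)
  have us: "u \<in> {min s t..max s t}" by (auto simp: u_def min_def max_def)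
  have far: "reach \<rho> + 2 * \<rho> < d (pt h u) (pt h v)" if "v = s \<or> v = t" for v
  proof (rule ccontr)
    assume "\<not> ?thesis"
    then have "\<bar>u - v\<bar> \<le> L * (reach \<rho> + 2 * \<rho> + \<kappa>)"
      using d_lower_le[OF h(1) u, of v] that s t by auto
    moreover have "2 * \<bar>u - v\<bar> = \<bar>s - t\<bar>" using that by (auto simp: u_def field_simps)
    ultimately show False using * by (simp add: drift_def)
  qed
  obtain z where "z \<in> seg_image g" "d z (pt h u) \<le> \<rho>"
    using thin_meets[OF h g us far far \<rho>] by blast
  with avoid u show False by fastforce
qed

text \<open>
  The constants of the standard argument: outside the \<open>band\<close>-neighbourhood of \<open>h\<close>, a stretch of
  duration \<open>stride\<close> of a quasi-geodesic moves its projection by at most \<open>drift\<close>, so that an excursion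
  lasts at most \<open>excursion\<close>.
\<close>

definition stride :: "real \<Rightarrow> real \<Rightarrow> real" where "stride \<rho> Q = 2 * Q * L * drift \<rho>"
definition band :: "real \<Rightarrow> real \<Rightarrow> real \<Rightarrow> real" where
  "band \<rho> Q q = \<rho> + reach (Q * stride \<rho> Q + q)"
definition excursion :: "real \<Rightarrow> real \<Rightarrow> real \<Rightarrow> real" where
  "excursion \<rho> Q q = 2 * Q * (2 * (reach (band \<rho> Q q) + \<rho>) + 2 * L * drift \<rho> + \<kappa> + q)"
definition thin_gauge :: "real \<Rightarrow> real \<Rightarrow> real \<Rightarrow> real" where
  "thin_gauge \<rho> Q q = Q * excursion \<rho> Q q + q + band \<rho> Q q"

lemma band_nonneg:
  assumes "0 \<le> \<rho>" "1 \<le> Q" "0 \<le> q"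
  shows "\<rho> \<le> band \<rho> Q q" "0 \<le> stride \<rho> Q"
proof -
  show 1: "0 \<le> stride \<rho> Q"
    using assms L drift_ge_1[of \<rho>] by (simp add: stride_def)
  show "\<rho> \<le> band \<rho> Q q"
    using assms 1 by (simp add: band_def reach_nonneg)
qed

lemma band_mono:
  assumes "0 \<le> \<rho>" "1 \<le> Q" "Q \<le> Q'" "0 \<le> q" "q \<le> q'"
  shows "band \<rho> Q q \<le> band \<rho> Q' q'"
  using assms L drift_ge_1[of \<rho>] unfolding band_def stride_def
  by (intro add_left_mono reach_mono add_mono mult_mono) auto

lemma excursion_mono:
  assumes "0 \<le> \<rho>" "1 \<le> Q" "Q \<le> Q'" "0 \<le> q" "q \<le> q'"
  shows "0 \<le> excursion \<rho> Q q" "excursion \<rho> Q q \<le> excursion \<rho> Q' q'"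
proof -
  have b: "0 \<le> reach (band \<rho> Q q)"
    using band_nonneg(1)[OF assms(1,2,4)] assms(1) by (intro reach_nonneg) simp
  then show "0 \<le> excursion \<rho> Q q"
    using assms L \<kappa> drift_ge_1[of \<rho>] by (simp add: excursion_def)
  show "excursion \<rho> Q q \<le> excursion \<rho> Q' q'"
    using assms L \<kappa> drift_ge_1[of \<rho>] b band_mono[OF assms] unfolding excursion_def
    by (intro mult_mono add_mono reach_mono) auto
qed

lemma morse_gauge_thin_gauge:
  assumes "0 \<le> \<rho>" shows "morse_gauge (thin_gauge \<rho>)"
  unfolding morse_gauge_def
proof (intro conjI allI impI)
  have mono: "thin_gauge \<rho> Q q \<le> thin_gauge \<rho> Q' q'"
    if "1 \<le> Q" "Q \<le> Q'" "0 \<le> q" "q \<le> q'" for Q Q' q q'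
    using that excursion_mono[OF assms that] band_mono[OF assms that]
    unfolding thin_gauge_def by (intro add_mono mult_mono) auto
  fix Q q :: real
  show "0 \<le> thin_gauge \<rho> Q q" if "1 \<le> Q" "0 \<le> q"
    using that excursion_mono(1)[OF assms that(1) order_refl that(2) order_refl]
      band_nonneg(1)[OF assms that] assms by (simp add: thin_gauge_def)
  show "mono_on {1..} (\<lambda>Q. thin_gauge \<rho> Q q)" if "0 \<le> q"
    using that mono by (intro mono_onI) auto
  show "mono_on {0..} (thin_gauge \<rho> Q)" if "1 \<le> Q"
    using that mono by (intro mono_onI) auto
  show "continuous_on {0..} (thin_gauge \<rho> Q)"
    unfolding thin_gauge_def excursion_def band_def reach_def by (intro continuous_intros)
qed

text \<open>Two speeds are compared. The quasi-geodesic makes progress at rate at least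
  \<open>1 / Q\<close>, while its projection moves by at most \<open>drift\<close> per
  \<open>stride\<close>. Going through the projections bounds the distance between the ends of the
  excursion by half the rate \<open>1 / Q\<close> plus a constant, which limits the
  duration.\<close>

lemma excursion_bound:
  assumes h: "h \<in> P" "thin h 5 \<rho>" and \<rho>: "0 \<le> \<rho>"
    and \<eta>: "quasi_geodesic m Q q {v1..v2} \<eta>" and v: "v1 < v2"
    and near: "x1 \<in> seg_dom h" "x2 \<in> seg_dom h"
      "d (\<eta> v1) (pt h x1) \<le> band \<rho> Q q" "d (\<eta> v2) (pt h x2) \<le> band \<rho> Q q"
    and far: "\<And>w u. v1 < w \<Longrightarrow> w < v2 \<Longrightarrow> u \<in> seg_dom h \<Longrightarrow> band \<rho> Q q < d (\<eta> w) (pt h u)"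
  shows "v2 - v1 \<le> excursion \<rho> Q q"
proof -
  have Q: "1 \<le> Q" "0 \<le> q" and \<eta>_in: "\<And>w. w \<in> {v1..v2} \<Longrightarrow> \<eta> w \<in> S"
    and up: "\<And>w w'. w \<in> {v1..v2} \<Longrightarrow> w' \<in> {v1..v2} \<Longrightarrow> d (\<eta> w) (\<eta> w') \<le> Q * \<bar>w - w'\<bar> + q"
    and low: "\<And>w w'. w \<in> {v1..v2} \<Longrightarrow> w' \<in> {v1..v2} \<Longrightarrow> 1 / Q * \<bar>w - w'\<bar> - q \<le> d (\<eta> w) (\<eta> w')"
    using \<eta> unfolding quasi_geodesic_def by auto
  define \<delta> where "\<delta> = stride \<rho> Q"
  have \<delta>: "0 < \<delta>" using Q L drift_ge_1[OF \<rho>] by (simp add: \<delta>_def stride_def)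
  \<comment> \<open>The extra 1 gives at least two subintervals, so each of them has an endpoint
    strictly between \<open>v1\<close> and \<open>v2\<close>, where \<open>\<eta>\<close> is far
    from \<open>h\<close>.\<close>
  define n where "n = nat \<lceil>(v2 - v1) / \<delta>\<rceil> + 1"
  define w where "w = (\<lambda>i::nat. v1 + real i * ((v2 - v1) / real n))"
  have pos: "0 < (v2 - v1) / \<delta>" using v \<delta> by simp
  then have n: "2 \<le> n" "(v2 - v1) / \<delta> \<le> real n" "real n \<le> (v2 - v1) / \<delta> + 2"
    unfolding n_def by linarith+
  have stp: "(v2 - v1) / real n \<le> \<delta>" using n \<delta> by (simp add: field_simps)
  have w0: "w 0 = v1" "w n = v2" using n by (auto simp: w_def)
  have w_strict: "w i < w j" if "i < j" for i j
    using that v n by (simp add: w_def divide_strict_right_mono)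
  have w_in: "w i \<in> {v1..v2}" if "i \<le> n" for i
    using w_strict[of 0 i] w_strict[of i n] w0 that v by (cases "i = 0"; cases "i = n") auto
  obtain s0 where s0: "proj h \<rho> (\<eta> v1) s0" "d (\<eta> v1) (pt h s0) \<le> reach (band \<rho> Q q) + \<rho>"
    using proj_exists[OF h(1) near(1) _ near(3) \<rho>] \<eta>_in v by auto
  obtain s1 where s1: "proj h \<rho> (\<eta> v2) s1" "d (\<eta> v2) (pt h s1) \<le> reach (band \<rho> Q q) + \<rho>"
    using proj_exists[OF h(1) near(2) _ near(4) \<rho>] \<eta>_in v by auto
  have "\<exists>s. proj h \<rho> (\<eta> (w i)) s" if "i \<le> n" for i
    using proj_exists[OF h(1) near(1) \<eta>_in[OF w_in[OF that]] order_refl \<rho>] by blast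
  then have "\<exists>s. \<forall>i\<le>n. proj h \<rho> (\<eta> (w i)) (s i)" by metis
  then obtain s' where s': "\<And>i. i \<le> n \<Longrightarrow> proj h \<rho> (\<eta> (w i)) (s' i)" by blast
  \<comment> \<open>\<open>proj\<close> is a relation, so the values at the two ends can be those
    with controlled distance; in between only the drift is used.\<close>
  define s where "s = (\<lambda>i. if i = 0 then s0 else if i = n then s1 else s' i)"
  have s: "proj h \<rho> (\<eta> (w i)) (s i)" if "i \<le> n" for i
    using s' that s0 s1 w0 by (auto simp: s_def)
  have drift: "\<bar>s i - s (Suc i)\<bar> \<le> drift \<rho>" if i: "i < n" for i
  proof -
    have in_S: "\<eta> (w i) \<in> S" "\<eta> (w (Suc i)) \<in> S" using \<eta>_in w_in i by auto
    then obtain g where g: "g \<in> P" "seg_start g = \<eta> (w i)" "seg_end g = \<eta> (w (Suc i))"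
      using P_conn by blast
    have "w (Suc i) - w i = (v2 - v1) / real n" by (simp add: w_def add_divide_distrib distrib_right)
    then have "w (Suc i) - w i \<le> \<delta>" using stp by simp
    then have "Q * \<bar>w i - w (Suc i)\<bar> \<le> Q * \<delta>"
      using w_strict[of i "Suc i"] Q by (intro mult_left_mono) auto
    then have dd: "d (seg_start g) (seg_end g) \<le> Q * \<delta> + q"
      using up[of "w i" "w (Suc i)"] w_in i g by fastforce
    \<comment> \<open>At \<open>v1\<close> and \<open>v2\<close> themselves \<open>\<eta>\<close>
      may touch the band; the other endpoint of the subinterval keeps all of \<open>g\<close> more
      than \<open>\<rho>\<close> away from \<open>h\<close>.\<close>
    obtain j where j: "j = i \<or> j = Suc i" "0 < j" "j < n"
      using that[of "if i = 0 then 1 else i"] i n by auto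
    then have wj: "v1 < w j" "w j < v2" using w_strict[of 0 j] w_strict[of j n] w0 by auto
    have "\<rho> < d z (pt h u)" if z: "z \<in> seg_image g" and u: "u \<in> seg_dom h" for z u
    proof -
      have "\<eta> (w j) \<in> seg_image g" using j(1) g seg_start_end_in(4,5)[OF g(1)] by auto
      then have "d (\<eta> (w j)) z \<le> reach (Q * \<delta> + q)" using seg_diameter[OF g(1) dd _ z] by blast
      moreover have "band \<rho> Q q < d (\<eta> (w j)) (pt h u)" by (rule far[OF wj u])
      moreover have "d (\<eta> (w j)) (pt h u) \<le> d (\<eta> (w j)) z + d z (pt h u)"
        using j(1) in_S seg_start_end_in(3)[OF g(1)] z by (intro mdist_triangle pt_in[OF h(1) u]) auto
      ultimately show ?thesis by (simp add: band_def \<delta>_def)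
    qed
    then show ?thesis using proj_drift[OF h \<rho> g(1)] s[of i] s[of "Suc i"] i g by auto
  qed
  have "\<bar>s 0 - s i\<bar> \<le> real i * drift \<rho>" if "i \<le> n" for i
    using that
  proof (induction i)
    case (Suc i)
    then have "\<bar>s 0 - s i\<bar> \<le> real i * drift \<rho>" "\<bar>s i - s (Suc i)\<bar> \<le> drift \<rho>" using drift by auto
    moreover have "real (Suc i) * drift \<rho> = real i * drift \<rho> + drift \<rho>" by (simp add: algebra_simps)
    ultimately show ?case by linarith
  qed simp
  then have "\<bar>s0 - s1\<bar> \<le> real n * drift \<rho>" using n by (force simp: s_def)
  also have "\<dots> \<le> ((v2 - v1) / \<delta> + 2) * drift \<rho>"
    using n drift_ge_1[OF \<rho>] by (intro mult_right_mono) auto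
  finally have s01: "d (pt h s0) (pt h s1) \<le> L * (((v2 - v1) / \<delta> + 2) * drift \<rho>) + \<kappa>"
    using d_upper_le[OF h(1)] s0(1) s1(1) unfolding proj_def by blast
  have in_S: "\<eta> v1 \<in> S" "\<eta> v2 \<in> S" "pt h s0 \<in> S" "pt h s1 \<in> S"
    using \<eta>_in v pt_in[OF h(1)] s0(1) s1(1) unfolding proj_def by auto
  have "d (\<eta> v1) (\<eta> v2) \<le> d (\<eta> v1) (pt h s0) + d (pt h s0) (pt h s1) + d (\<eta> v2) (pt h s1)"
    using mdist_triangle[of "\<eta> v1" m "pt h s0" "\<eta> v2"] mdist_triangle[of "pt h s0" m "pt h s1" "\<eta> v2"]
      in_S mdist_commute[of m "\<eta> v2"] by fastforce
  then have "1 / Q * (v2 - v1) - q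
      \<le> 2 * (reach (band \<rho> Q q) + \<rho>) + (L * (((v2 - v1) / \<delta> + 2) * drift \<rho>) + \<kappa>)"
    using low[of v1 v2] v s01 s0(2) s1(2) by simp
  \<comment> \<open>\<open>stride\<close> is chosen so that
    \<open>L * drift \<rho> / \<delta> = 1 / (2 * Q)\<close>: the term can be absorbed by the lower
    bound \<open>(v2 - v1) / Q\<close>.\<close>
  moreover have "L * (((v2 - v1) / \<delta> + 2) * drift \<rho>) = (v2 - v1) / (2 * Q) + 2 * L * drift \<rho>"
    using Q L drift_ge_1[OF \<rho>] by (simp add: \<delta>_def stride_def field_simps)
  ultimately have "(v2 - v1) / (2 * Q) \<le> 2 * (reach (band \<rho> Q q) + \<rho>) + 2 * L * drift \<rho> + \<kappa> + q"
    by (simp add: add_divide_distrib diff_divide_distrib)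
  then show ?thesis
    using Q by (simp add: excursion_def field_simps)
qed

text \<open>If \<open>\<eta> w\<close> is outside the band, compactness yields the last time before
  \<open>w\<close> and the first time after \<open>w\<close> at which \<open>\<eta>\<close> is in
  it; both exist because \<open>\<eta>\<close> starts and ends on \<open>h\<close>. In between
  \<open>excursion_bound\<close> applies, and \<open>\<eta> w\<close> is compared with the point of
  \<open>h\<close> near the earlier time.\<close>

lemma thin_stability:
  assumes h: "h \<in> P" "thin h 5 \<rho>" and \<rho>: "0 \<le> \<rho>"
    and \<eta>: "quasi_geodesic m Q q {a..b} \<eta>" "continuous_map (top_of_set {a..b}) (mtopology_of m) \<eta>"
      "\<eta> a = seg_start h" "\<eta> b = seg_end h" and w: "w \<in> {a..b}"
  shows "\<exists>x\<in>seg_dom h. d (\<eta> w) (pt h x) \<le> thin_gauge \<rho> Q q"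
proof (cases "\<exists>x\<in>seg_dom h. d (\<eta> w) (pt h x) \<le> band \<rho> Q q")
  have Q: "1 \<le> Q" "0 \<le> q" using \<eta> by (auto simp: quasi_geodesic_def)
  case True
  moreover have "band \<rho> Q q \<le> thin_gauge \<rho> Q q"
    using excursion_mono(1)[OF \<rho> Q(1) order_refl Q(2) order_refl] Q by (simp add: thin_gauge_def)
  ultimately show ?thesis by (meson order_trans)
next
  case False
  have Q: "1 \<le> Q" "0 \<le> q" and \<eta>_in: "\<And>w. w \<in> {a..b} \<Longrightarrow> \<eta> w \<in> S"
    and up: "\<And>w w'. w \<in> {a..b} \<Longrightarrow> w' \<in> {a..b} \<Longrightarrow> d (\<eta> w) (\<eta> w') \<le> Q * \<bar>w - w'\<bar> + q"
    using \<eta> unfolding quasi_geodesic_def by auto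
  let ?R = "band \<rho> Q q"
  define K where "K = (\<lambda>A. {z \<in> A \<times> seg_dom h. d (\<eta> (fst z)) (pt h (snd z)) \<le> ?R})"
  have compact: "compact (K A)" if "compact A" "A \<subseteq> {a..b}" for A
    unfolding K_def
    using continuous_map_from_subtopology_mono[OF \<eta>(2) that(2)] that(1) h
    by (intro compact_near P_continuous) auto
  have R: "0 \<le> ?R" using band_nonneg(1)[OF \<rho> Q] \<rho> by simp
  have "(a, lo h) \<in> K {a..w}" "(b, hi h) \<in> K {w..b}"
    using w \<eta> lo_hi[OF h(1)] pt_in[OF h(1)] R by (auto simp: K_def seg_start_def seg_end_def)
  then have ne: "K {a..w} \<noteq> {}" "K {w..b} \<noteq> {}" by blast+
  have "compact (K {a..w})" "compact (K {w..b})" using w by (auto intro!: compact)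
  note continuous_attains_sup[OF this(1) ne(1) continuous_on_fst[OF continuous_on_id]]
    continuous_attains_inf[OF this(2) ne(2) continuous_on_fst[OF continuous_on_id]]
  then obtain z1 z2 where z: "z1 \<in> K {a..w}" "\<And>z. z \<in> K {a..w} \<Longrightarrow> fst z \<le> fst z1"
      "z2 \<in> K {w..b}" "\<And>z. z \<in> K {w..b} \<Longrightarrow> fst z2 \<le> fst z"
    by blast
  obtain v1 x1 where v1_eq: "z1 = (v1, x1)" by (rule prod.exhaust)
  obtain v2 x2 where v2_eq: "z2 = (v2, x2)" by (rule prod.exhaust)
  note v = v1_eq v2_eq
  have v1: "a \<le> v1" "v1 \<le> w" "x1 \<in> seg_dom h" "d (\<eta> v1) (pt h x1) \<le> ?R"
    and v2: "w \<le> v2" "v2 \<le> b" "x2 \<in> seg_dom h" "d (\<eta> v2) (pt h x2) \<le> ?R"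
    using z v by (auto simp: K_def)
  have "v1 \<noteq> w" "v2 \<noteq> w" using False v1 v2 by blast+
  then have strict: "v1 < w" "w < v2" using v1 v2 by simp_all
  have far: "?R < d (\<eta> w') (pt h u)" if "v1 < w'" "w' < v2" "u \<in> seg_dom h" for w' u
  proof (rule ccontr)
    assume "\<not> ?thesis"
    then have "(w', u) \<in> K {a..w} \<or> (w', u) \<in> K {w..b}"
      using that v1 v2 by (auto simp: K_def)
    then show False using z(2)[of "(w', u)"] z(4)[of "(w', u)"] v that by auto
  qed
  have "quasi_geodesic m Q q {v1..v2} \<eta>"
    using \<eta>(1) v1 v2 by (auto simp: quasi_geodesic_def is_interval_cc)
  from excursion_bound[OF h \<rho> this _ v1(3) v2(3) v1(4) v2(4) far] strict
  have "v2 - v1 \<le> excursion \<rho> Q q" by simp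
  then have "Q * \<bar>w - v1\<bar> \<le> Q * excursion \<rho> Q q"
    using strict Q by (intro mult_left_mono) auto
  then have "d (\<eta> w) (\<eta> v1) \<le> Q * excursion \<rho> Q q + q" using up[of w v1] w v1 by fastforce
  then have "d (\<eta> w) (pt h x1) \<le> thin_gauge \<rho> Q q"
    using mdist_triangle[of "\<eta> w" m "\<eta> v1" "pt h x1"] \<eta>_in[of w] \<eta>_in[of v1] w v1 pt_in[OF h(1)]
    by (auto simp: thin_gauge_def)
  then show ?thesis using v1 by blast
qed

text \<open>Allows the stability estimate, stated for curves joining the ends of \<open>h\<close>,
  to be used between any two points of \<open>h\<close>, as the Morse property demands.\<close>

lemma thin_subseg: "thin h N \<rho> \<Longrightarrow> lo h \<le> s \<Longrightarrow> t \<le> hi h \<Longrightarrow> thin (subseg h s t) N \<rho>"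
proof -
  assume h: "thin h N \<rho>" and st: "lo h \<le> s" "t \<le> hi h"
  show ?thesis
    unfolding thin_def
  proof (intro ballI allI impI)
    fix a b u A
    assume "a \<in> seg_dom (subseg h s t)" "b \<in> seg_dom (subseg h s t)" "u \<in> {min a b..max a b}"
      "polyline N (pt (subseg h s t) a) (pt (subseg h s t) b) A"
    moreover from this have "u \<in> {s..t}" by auto
    ultimately show "\<exists>z\<in>A. d z (pt (subseg h s t) u) \<le> \<rho>"
      using h st by (auto simp: subseg_def elim!: thinD[of h N \<rho> a b u A])
  qed
qed

lemma set_mdist_le: "a \<in> A \<Longrightarrow> d a x \<le> r \<Longrightarrow> set_mdist m A x \<le> r"
  unfolding set_mdist_def by (rule cINF_lower2) (auto intro!: bdd_belowI[of _ 0])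

lemma thin_imp_morse:
  assumes h: "h \<in> P" "thin h 5 \<rho>" and \<rho>: "0 \<le> \<rho>"
  shows "morse m (thin_gauge \<rho>) (seg_dom h) (pt h)"
  unfolding morse_def
proof (intro allI impI ballI)
  fix Q q s t a b \<eta> u
  assume s: "s \<in> seg_dom h" and t: "t \<in> seg_dom h" and st: "s \<le> t" and u: "u \<in> {a..b}"
    and \<eta>: "improved_quasi_geodesic m Q q {a..b} \<eta>" "\<eta> a = pt h s" "\<eta> b = pt h t"
  have "\<exists>x\<in>seg_dom (subseg h s t). d (\<eta> u) (pt (subseg h s t) x) \<le> thin_gauge \<rho> Q q"
    using \<eta> s t st by (intro thin_stability[OF P_sub[OF h(1)] thin_subseg[OF h(2)] \<rho> _ _ _ _ u])
      (auto simp: improved_quasi_geodesic_def)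
  then show "set_mdist m (pt h ` {s..t}) (\<eta> u) \<le> thin_gauge \<rho> Q q"
    by (auto simp: subseg_def mdist_commute[of m "\<eta> u"] intro!: set_mdist_le)
qed

section \<open>Special paths following a thin path\<close>

text \<open>Constants for a special path \<open>g\<close> following a thin \<open>h\<close>. When
  the parameter on \<open>h\<close> advances by 1, that of a \<open>\<rho>\<close>-close point on
  \<open>g\<close> changes by at most \<open>pace\<close>. In \<open>mid_radius\<close>,
  \<open>\<rho>\<close> is paid for passing from a polygonal line to \<open>h\<close>, again for
  passing from \<open>h\<close> to \<open>g\<close>, and the rest for moving along \<open>g\<close>
  during one \<open>pace\<close>. A separation \<open>spread\<close> on \<open>g\<close> keeps the
  middle away from both ends and leaves a duration \<open>B\<close>; a separation
  \<open>long_drift\<close> on \<open>h\<close> forces it.\<close>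

definition pace :: "real \<Rightarrow> real" where "pace \<rho> = L * (L + 2 * \<rho> + 2 * \<kappa>)"
definition mid_radius :: "real \<Rightarrow> real" where "mid_radius \<rho> = 2 * \<rho> + (L * pace \<rho> + \<kappa>)"
definition spread :: "real \<Rightarrow> real \<Rightarrow> real" where
  "spread \<rho> B = B + 2 * pace \<rho> + 2 * (L * (reach \<rho> + 3 * \<rho> + \<kappa>)) + 1"
definition long_drift :: "real \<Rightarrow> real \<Rightarrow> real" where
  "long_drift \<rho> B =
     2 * (L * (reach \<rho> + 2 * \<rho> + \<kappa>) + 1) + 1 + L * (2 * \<rho> + L * spread \<rho> B + 2 * \<kappa>)"

lemma long_drift_nonneg:
  assumes "0 \<le> \<rho>" "0 \<le> B"
  shows "0 \<le> pace \<rho>" "0 \<le> mid_radius \<rho>" "0 \<le> spread \<rho> B" "0 \<le> long_drift \<rho> B"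
proof -
  show 1: "0 \<le> pace \<rho>" "0 \<le> mid_radius \<rho>"
    using assms L \<kappa> by (simp_all add: pace_def mid_radius_def)
  show 2: "0 \<le> spread \<rho> B" using assms L \<kappa> 1 reach_nonneg[of \<rho>] by (simp add: spread_def)
  show "0 \<le> long_drift \<rho> B"
    using assms L \<kappa> 2 reach_nonneg[of \<rho>] by (simp add: long_drift_def)
qed

text \<open>By \<open>thin_meets\<close>, \<open>g\<close> passes close to points
  \<open>pt h (u i)\<close> with \<open>u i\<close> in unit steps between \<open>s\<close> and
  \<open>t\<close>, at parameters \<open>\<tau> i\<close>. These need not be monotone, but they
  change slowly, so one of them is near the middle of \<open>\<tau> 0\<close> and
  \<open>\<tau> J\<close>. Two short sides turn an \<open>n\<close>-gon between the points of
  \<open>g\<close> into an \<open>(n + 2)\<close>-gon between points of \<open>h\<close>; the short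
  sides are too far from the middle, so thinness of \<open>h\<close> detects the
  \<open>n\<close>-gon.\<close>

lemma bottleneck_subsegment:
  assumes h: "h \<in> P" and thin: "thin h (n + 2) \<rho>" and n: "5 \<le> n" and \<rho>: "0 \<le> \<rho>" and B: "0 \<le> B"
    and g: "g \<in> P" "proj h \<rho> (seg_start g) s" "proj h \<rho> (seg_end g) t"
    and long: "long_drift \<rho> B < \<bar>s - t\<bar>"
  obtains a b where "lo g \<le> a" "a \<le> b" "b \<le> hi g" "B \<le> b - a"
    "\<And>A. polyline n (pt g b) (pt g a) A \<Longrightarrow> \<exists>z\<in>A. d z (pt g ((a + b) / 2)) \<le> mid_radius \<rho>"
proof -
  \<comment> \<open>A margin at both ends of the parameter range, beyond which points of
    \<open>h\<close> are far enough from \<open>pt h s\<close> and \<open>pt h t\<close> for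
    \<open>thin_meets\<close>.\<close>
  define E1 where "E1 = L * (reach \<rho> + 2 * \<rho> + \<kappa>) + 1"
  define sg where "sg = (if s \<le> t then 1 else - 1 :: real)"
  define u where "u = (\<lambda>i::nat. s + sg * (E1 + real i))"
  define J where "J = nat \<lfloor>\<bar>s - t\<bar> - 2 * E1\<rfloor>"
  note nonneg = long_drift_nonneg[OF \<rho> B]
  have E1: "1 \<le> E1" using \<rho> L \<kappa> reach_nonneg[of \<rho>] by (simp add: E1_def)
  have long': "2 * E1 + 1 + L * (2 * \<rho> + L * spread \<rho> B + 2 * \<kappa>) < \<bar>s - t\<bar>"
    using long by (simp add: long_drift_def E1_def)
  have J0: "0 \<le> L * (2 * \<rho> + L * spread \<rho> B + 2 * \<kappa>)" using \<rho> L \<kappa> nonneg(3) by simp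
  then have J: "real J \<le> \<bar>s - t\<bar> - 2 * E1" "L * (2 * \<rho> + L * spread \<rho> B + 2 * \<kappa>) < real J"
    using long' unfolding J_def by linarith+
  have s: "s \<in> seg_dom h" and t: "t \<in> seg_dom h" using g by (auto simp: proj_def)
  have u_in: "u i \<in> {min s t..max s t}" and u_s: "E1 \<le> \<bar>u i - s\<bar>" and u_t: "E1 \<le> \<bar>u i - t\<bar>"
    if "i \<le> J" for i
  proof -
    have i: "real i \<le> \<bar>s - t\<bar> - 2 * E1" using that J(1) by (meson of_nat_le_iff order_trans)
    show "u i \<in> {min s t..max s t}" "E1 \<le> \<bar>u i - s\<bar>" "E1 \<le> \<bar>u i - t\<bar>"
      using i E1 by (auto simp: u_def sg_def)
  qed
  have u_dom: "u i \<in> seg_dom h" if "i \<le> J" for i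
    using u_in[OF that] s t by auto
  have u_diff: "\<bar>u i - u i'\<bar> = \<bar>real i - real i'\<bar>" for i i'
    by (auto simp: u_def sg_def)
  have far: "reach \<rho> + 2 * \<rho> < d (pt h x) (pt h y)"
    if "x \<in> seg_dom h" "y \<in> seg_dom h" "E1 \<le> \<bar>x - y\<bar>" for x y
  proof (rule ccontr)
    assume "\<not> ?thesis"
    then show False using d_lower_le[OF h that(1,2), of "reach \<rho> + 2 * \<rho>"] that(3) by (simp add: E1_def)
  qed
  have thin5: "thin h 5 \<rho>" using thin n polyline_mono[of 5 _ _ _ "n + 2"] unfolding thin_def by simp
  have "\<exists>\<tau>\<in>seg_dom g. d (pt g \<tau>) (pt h (u i)) \<le> \<rho>" if i: "i \<le> J" for i
  proof -
    obtain z where "z \<in> seg_image g" "d z (pt h (u i)) \<le> \<rho>"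
      by (rule thin_meets[OF h thin5 g u_in[OF i] far[OF u_dom[OF i] s u_s[OF i]]
            far[OF u_dom[OF i] t u_t[OF i]] \<rho>])
    then show ?thesis by (auto simp: seg_image_def)
  qed
  then have "\<exists>\<tau>. \<forall>i\<le>J. \<tau> i \<in> seg_dom g \<and> d (pt g (\<tau> i)) (pt h (u i)) \<le> \<rho>" by metis
  then obtain \<tau> where \<tau>: "\<And>i. i \<le> J \<Longrightarrow> \<tau> i \<in> seg_dom g"
    and \<tau>u: "\<And>i. i \<le> J \<Longrightarrow> d (pt g (\<tau> i)) (pt h (u i)) \<le> \<rho>" by blast
  have \<tau>_diff: "\<bar>\<tau> i - \<tau> i'\<bar> \<le> L * (x + 2 * \<rho> + \<kappa>)"
    if i: "i \<le> J" "i' \<le> J" and x: "d (pt h (u i)) (pt h (u i')) \<le> x" for i i' x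
  proof -
    note in_S = pt_in[OF g(1) \<tau>[OF i(1)]] pt_in[OF g(1) \<tau>[OF i(2)]]
      pt_in[OF h u_dom[OF i(1)]] pt_in[OF h u_dom[OF i(2)]]
    have "d (pt g (\<tau> i)) (pt g (\<tau> i')) \<le> x + 2 * \<rho>"
      using mdist_triangle[OF in_S(1,3,2)] mdist_triangle[OF in_S(3,4,2)] \<tau>u[OF i(1)] \<tau>u[OF i(2)] x
        mdist_commute[of m "pt g (\<tau> i')" "pt h (u i')"] by linarith
    then show ?thesis by (rule d_lower_le[OF g(1) \<tau>[OF i(1)] \<tau>[OF i(2)]])
  qed
  have step: "\<bar>\<tau> i - \<tau> (Suc i)\<bar> \<le> pace \<rho>" if "i < J" for i
  proof -
    have "d (pt h (u i)) (pt h (u (Suc i))) \<le> L * 1 + \<kappa>"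
      using that by (intro d_upper_le[OF h] u_dom) (auto simp: u_diff)
    then show ?thesis using \<tau>_diff[of i "Suc i" "L * 1 + \<kappa>"] that by (simp add: pace_def algebra_simps)
  qed
  have spread: "spread \<rho> B < \<bar>\<tau> 0 - \<tau> J\<bar>"
  proof (rule ccontr)
    assume "\<not> ?thesis"
    then have *: "d (pt g (\<tau> 0)) (pt g (\<tau> J)) \<le> L * spread \<rho> B + \<kappa>"
      by (intro d_upper_le[OF g(1)] \<tau>) auto
    note in_S = pt_in[OF g(1) \<tau>[of 0]] pt_in[OF g(1) \<tau>[of J]] pt_in[OF h u_dom[of 0]]
      pt_in[OF h u_dom[of J]]
    have "d (pt h (u 0)) (pt h (u J)) \<le> 2 * \<rho> + L * spread \<rho> B + \<kappa>"
      using mdist_triangle[of "pt h (u 0)" m "pt g (\<tau> 0)" "pt h (u J)"]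
        mdist_triangle[of "pt g (\<tau> 0)" m "pt g (\<tau> J)" "pt h (u J)"] in_S \<tau>u[of 0] \<tau>u[of J] *
        mdist_commute[of m "pt h (u 0)" "pt g (\<tau> 0)"] by simp
    then have "\<bar>u 0 - u J\<bar> \<le> L * (2 * \<rho> + L * spread \<rho> B + \<kappa> + \<kappa>)"
      by (intro d_lower_le[OF h] u_dom) auto
    then have "real J \<le> L * (2 * \<rho> + L * spread \<rho> B + 2 * \<kappa>)" by (simp add: u_diff add.assoc)
    then show False using J(2) by simp
  qed
  \<comment> \<open>The direction in which \<open>g\<close> follows \<open>h\<close> is unknown, so
    the two parameters are sorted.\<close>
  define a where "a = min (\<tau> 0) (\<tau> J)"
  define b where "b = max (\<tau> 0) (\<tau> J)"
  have ab: "b - a = \<bar>\<tau> 0 - \<tau> J\<bar>" by (simp add: a_def b_def)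
  have dom: "a \<in> seg_dom g" "b \<in> seg_dom g" using \<tau>[of 0] \<tau>[of J] by (auto simp: a_def b_def)
  then have mid: "(a + b) / 2 \<in> seg_dom g" by auto
  have "\<exists>i\<le>J. \<bar>\<tau> i - (a + b) / 2\<bar> \<le> pace \<rho>"
    by (rule discrete_ivt[of J \<tau> "pace \<rho>", OF step _ nonneg(1)]) (auto simp: a_def b_def min_def max_def)
  then obtain i where i: "i \<le> J" "\<bar>\<tau> i - (a + b) / 2\<bar> \<le> pace \<rho>" by blast
  have far_ends: "reach \<rho> + \<rho> < d (pt h (u i)) (pt h (u i'))" if i': "i' = 0 \<or> i' = J" for i'
  proof (rule ccontr)
    assume "\<not> ?thesis"
    then have "\<bar>\<tau> i - \<tau> i'\<bar> \<le> L * (reach \<rho> + \<rho> + 2 * \<rho> + \<kappa>)"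
      using i(1) i' by (intro \<tau>_diff) auto
    moreover have "\<bar>\<tau> i' - (a + b) / 2\<bar> = (b - a) / 2"
      using i' by (auto simp: a_def b_def min_def max_def abs_if field_simps)
    moreover have "\<bar>\<tau> i' - (a + b) / 2\<bar> \<le> \<bar>\<tau> i - \<tau> i'\<bar> + \<bar>\<tau> i - (a + b) / 2\<bar>" by argo
    moreover have "L * (reach \<rho> + \<rho> + 2 * \<rho> + \<kappa>) = L * (reach \<rho> + 3 * \<rho> + \<kappa>)" by (simp add: add.assoc)
    ultimately have "(b - a) / 2 \<le> pace \<rho> + L * (reach \<rho> + 3 * \<rho> + \<kappa>)" using i(2) by linarith
    then show False using spread B ab by (simp add: spread_def)
  qed
  have bottleneck: "\<exists>z\<in>A. d z (pt g ((a + b) / 2)) \<le> mid_radius \<rho>"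
    if A: "polyline n (pt g b) (pt g a) A" for A
  proof -
    have A': "polyline n (pt g (\<tau> 0)) (pt g (\<tau> J)) A"
      using A polyline_rev[OF A] by (simp add: a_def b_def min_def max_def split: if_splits)
    note in_S = pt_in[OF g(1) \<tau>[of 0]] pt_in[OF g(1) \<tau>[of J]] pt_in[OF h u_dom[of 0]]
      pt_in[OF h u_dom[of J]] pt_in[OF h u_dom[OF i(1)]] pt_in[OF g(1) \<tau>[OF i(1)]] pt_in[OF g(1) mid]
    obtain A0 where A0: "polyline 1 (pt h (u 0)) (pt g (\<tau> 0)) A0"
      "\<And>z z'. z \<in> A0 \<Longrightarrow> z' \<in> A0 \<Longrightarrow> d z z' \<le> reach \<rho>"
      using polyline_connect[OF in_S(3,1), of \<rho>] \<tau>u[of 0] mdist_commute[of m "pt h (u 0)" "pt g (\<tau> 0)"]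
      by auto
    obtain A1 where A1: "polyline 1 (pt g (\<tau> J)) (pt h (u J)) A1"
      "\<And>z z'. z \<in> A1 \<Longrightarrow> z' \<in> A1 \<Longrightarrow> d z z' \<le> reach \<rho>"
      using polyline_connect[OF in_S(2,4), of \<rho>] \<tau>u[of J] by auto
    have "polyline (1 + n + 1) (pt h (u 0)) (pt h (u J)) (A0 \<union> A \<union> A1)"
      by (rule polyline_trans[OF polyline_trans[OF A0(1) A'] A1(1)])
    then have pl: "polyline (n + 2) (pt h (u 0)) (pt h (u J)) (A0 \<union> A \<union> A1)" by simp
    have between: "min (u 0) (u J) \<le> u i" "u i \<le> max (u 0) (u J)"
      using i(1) by (auto simp: u_def sg_def)
    obtain z where z: "z \<in> A0 \<union> A \<union> A1" "d z (pt h (u i)) \<le> \<rho>"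
      by (rule thinD[OF thin u_dom[of 0] u_dom[of J] between pl]) auto
    have zS: "z \<in> S" using z(1) polyline_in(1)[OF pl] by blast
    have no: False if "x \<in> S" "d z x \<le> reach \<rho>" "x = pt h (u 0) \<or> x = pt h (u J)" for x
      using mdist_triangle[OF in_S(5) zS that(1)] that(2,3) far_ends[of 0] far_ends[of J] z(2)
        mdist_commute[of m z "pt h (u i)"] by auto
    have "z \<in> A"
      using z(1) no[OF in_S(3)] no[OF in_S(4)] A0(2)[of z "pt h (u 0)"] A1(2)[of z "pt h (u J)"]
        polyline_in(2)[OF A0(1)] polyline_in(3)[OF A1(1)] by auto
    moreover have "d z (pt g ((a + b) / 2)) \<le> mid_radius \<rho>"
      using mdist_triangle[OF zS in_S(5,7)] mdist_triangle[OF in_S(5,6,7)] z(2) \<tau>u[OF i(1)]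
        d_upper_le[OF g(1) \<tau>[OF i(1)] mid i(2)] mdist_commute[of m "pt h (u i)" "pt g (\<tau> i)"]
      by (simp add: mid_radius_def)
    ultimately show ?thesis by blast
  qed
  have "0 \<le> L * (reach \<rho> + 3 * \<rho> + \<kappa>)" using L \<kappa> \<rho> reach_nonneg[OF \<rho>] by simp
  then have "B \<le> b - a" using spread nonneg(1) ab unfolding spread_def by linarith
  then show ?thesis
    using dom B by (intro that[of a b, OF _ _ _ _ bottleneck]) auto
qed

section \<open>Morse special paths are thin\<close>

text \<open>A side of duration \<open>T\<close> takes at most \<open>T + 1\<close> steps, and
  \<open>T\<close> is bounded by the distance of its ends. The corner times \<open>t\<close> are
  kept because they form a partition of the domain: the distances between corners add up to at most
  the length, which is what navigability controls.\<close>

lemma concatenation_hops: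
  assumes "concatenation P j \<alpha>"
  shows "\<exists>t k. t 0 = lo \<alpha> \<and> t j = hi \<alpha> \<and> (\<forall>i<j. t i \<le> t (Suc i)) \<and>
    hops m (L + \<kappa>) (seg_image \<alpha>) k (seg_start \<alpha>) (seg_end \<alpha>) \<and>
    real k \<le> (\<Sum>i<j. L * d (pt \<alpha> (t i)) (pt \<alpha> (t (Suc i))) + (L * \<kappa> + 1))"
proof -
  have special: "\<exists>k. hops m (L + \<kappa>) (seg_image p) k (seg_start p) (seg_end p) \<and>
      real k \<le> L * d (seg_start p) (seg_end p) + (L * \<kappa> + 1)" if p: "p \<in> P" for p
  proof -
    have step: "d (pt p s) (pt p t) \<le> L + \<kappa>"
      if "s \<in> seg_dom p" "t \<in> seg_dom p" "\<bar>s - t\<bar> \<le> 1" for s t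
      using d_upper_le[OF p that] by simp
    obtain k where k: "hops m (L + \<kappa>) (seg_image p) k (pt p (lo p)) (pt p (hi p))"
        "real k \<le> hi p - lo p + 1"
      by (rule hops_curve[OF lo_hi[OF p], of "pt p" "seg_image p" m "L + \<kappa>"])
        (use step in \<open>auto simp: seg_image_def\<close>)
    moreover have "hi p - lo p \<le> L * (d (seg_start p) (seg_end p) + \<kappa>)"
      using seg_dur_le[OF p order_refl] by (simp add: seg_dur_def)
    ultimately show ?thesis
      by (intro exI[of _ k]) (simp add: seg_start_def seg_end_def distrib_left)
  qed
  show ?thesis
    using assms
  proof (induction rule: concatenation.induct)
    case (single p)
    obtain k where "hops m (L + \<kappa>) (seg_image p) k (seg_start p) (seg_end p)"
      "real k \<le> L * d (seg_start p) (seg_end p) + (L * \<kappa> + 1)" using special[OF single] by blast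
    then show ?case
      using lo_hi[OF single]
      by (intro exI[of _ "\<lambda>i. if i = 0 then lo p else hi p"] exI[of _ k])
        (simp add: seg_start_def seg_end_def)
  next
    case (join n \<alpha> p)
    obtain t k where t: "t 0 = lo \<alpha>" "t n = hi \<alpha>" "\<And>i. i < n \<Longrightarrow> t i \<le> t (Suc i)"
      and k: "hops m (L + \<kappa>) (seg_image \<alpha>) k (seg_start \<alpha>) (seg_end \<alpha>)"
        "real k \<le> (\<Sum>i<n. L * d (pt \<alpha> (t i)) (pt \<alpha> (t (Suc i))) + (L * \<kappa> + 1))"
      using join.IH by blast
    obtain k' where k': "hops m (L + \<kappa>) (seg_image p) k' (seg_start p) (seg_end p)"
      "real k' \<le> L * d (seg_start p) (seg_end p) + (L * \<kappa> + 1)" using special[OF join.hyps(2)] by blast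
    note dom = concatenation_lo_hi[OF join.hyps(1)] lo_hi[OF join.hyps(2)]
    note J = join_seg_simps[OF dom join.hyps(3)]
    define t' where "t' = t(Suc n := hi (join_seg \<alpha> p))"
    have mono: "t i \<le> t i'" if "i \<le> i'" "i' \<le> n" for i i'
      using that by (induction i' rule: dec_induct) (use t(3) in \<open>auto intro: order_trans\<close>)
    have pt: "pt (join_seg \<alpha> p) (t i) = pt \<alpha> (t i)" if "i \<le> n" for i
      using mono[of 0 i] mono[OF that] that t(1,2) dom(2) by (simp add: join_seg_def seg_dur_def)
    have "hops m (L + \<kappa>) (seg_image (join_seg \<alpha> p)) (k + k') (seg_start \<alpha>) (seg_end p)"
      unfolding J(3) using k(1) k'(1) join.hyps(3)
      by (intro hops_trans[of _ _ _ k' "seg_start p"]) (auto elim!: hops_mono)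
    moreover have "(\<Sum>i<n. L * d (pt (join_seg \<alpha> p) (t' i)) (pt (join_seg \<alpha> p) (t' (Suc i))) + (L * \<kappa> + 1))
        = (\<Sum>i<n. L * d (pt \<alpha> (t i)) (pt \<alpha> (t (Suc i))) + (L * \<kappa> + 1))"
      using pt by (intro sum.cong) (auto simp: t'_def)
    moreover have "pt (join_seg \<alpha> p) (t' n) = seg_start p"
      using pt[of n] t(2) join.hyps(3) by (simp add: t'_def seg_end_def)
    moreover have "pt (join_seg \<alpha> p) (t' (Suc n)) = seg_end p"
      using J(2) by (simp add: t'_def seg_end_def)
    moreover have "hi \<alpha> \<le> hi (join_seg \<alpha> p)" using dom by (simp add: join_seg_def seg_dur_def)
    moreover have "lo (join_seg \<alpha> p) = lo \<alpha>" by (simp add: join_seg_def)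
    ultimately show ?case
      using k(2) k'(2) J t
      by (intro exI[of _ t'] exI[of _ "k + k'"]) (auto simp: t'_def less_Suc_eq)
  qed
qed

lemma polygonal_line_hops:
  assumes "polygonal_line N P \<alpha>" "seg_length m \<alpha> \<le> ennreal l" "0 \<le> l"
  obtains k where "hops m (L + \<kappa>) (seg_image \<alpha>) k (seg_start \<alpha>) (seg_end \<alpha>)"
    "real k \<le> L * l + real N * (L * \<kappa> + 1)"
proof -
  obtain j where j: "j \<le> N" "concatenation P j \<alpha>" using assms(1) by (auto simp: polygonal_line_def)
  obtain t k where t: "t 0 = lo \<alpha>" "t j = hi \<alpha>" "\<forall>i<j. t i \<le> t (Suc i)"
    and k: "hops m (L + \<kappa>) (seg_image \<alpha>) k (seg_start \<alpha>) (seg_end \<alpha>)"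
      "real k \<le> (\<Sum>i<j. L * d (pt \<alpha> (t i)) (pt \<alpha> (t (Suc i))) + (L * \<kappa> + 1))"
    using concatenation_hops[OF j(2)] by blast
  have "(\<Sum>i<j. d (pt \<alpha> (t i)) (pt \<alpha> (t (Suc i)))) \<le> l"
    using curve_length_ge[OF t assms(2)[unfolded seg_length_def] assms(3)] .
  then have "L * (\<Sum>i<j. d (pt \<alpha> (t i)) (pt \<alpha> (t (Suc i)))) \<le> L * l"
    using L by (intro mult_left_mono) auto
  moreover have "real j * (L * \<kappa> + 1) \<le> real N * (L * \<kappa> + 1)"
    using j L \<kappa> by (intro mult_right_mono) auto
  ultimately have "real k \<le> L * l + real N * (L * \<kappa> + 1)"
    using k(2) by (simp add: sum.distrib sum_distrib_left[symmetric])
  with k(1) that show ?thesis by blast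
qed

text \<open>
  The points of \<open>h\<close> close to a sequence running from \<open>h s\<close> to \<open>h t\<close> cannot jump over \<open>h u\<close>.
\<close>

lemma no_jump:
  assumes h: "h \<in> P" and st: "s \<in> seg_dom h" "t \<in> seg_dom h" "u \<in> {s..t}"
    and z: "z 0 = pt h s" "z j = pt h t" "\<And>i. i \<le> j \<Longrightarrow> z i \<in> S"
      "\<And>i. i < j \<Longrightarrow> d (z i) (z (Suc i)) \<le> \<sigma>"
    and near: "\<And>i. i \<le> j \<Longrightarrow> \<exists>v\<in>{s..t}. d (pt h v) (z i) \<le> E" and E: "0 \<le> E" "0 \<le> \<sigma>"
  obtains i where "i \<le> j" "d (z i) (pt h u) \<le> E + reach (2 * E + \<sigma>)"
proof -
  \<comment> \<open>\<open>right i\<close> says that \<open>z i\<close> is close to the part of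
    \<open>h\<close> from \<open>u\<close> on. The least such index and its predecessor straddle
    \<open>u\<close>.\<close>
  define right where "right = (\<lambda>i. \<exists>v\<in>{u..t}. d (pt h v) (z i) \<le> E)"
  have dom: "v \<in> seg_dom h" if "v \<in> {s..t}" for v using that st by auto
  have "right j" unfolding right_def using z(2) E pt_in[OF h] st by (intro bexI[of _ t]) auto
  then have right: "right (LEAST i. right i)" "(LEAST i. right i) \<le> j"
    by (auto intro: LeastI Least_le)
  obtain i v v' where i: "i \<le> j" "v \<in> {s..u}" "v' \<in> {u..t}" "d (pt h v) (z i) \<le> E"
    "d (pt h v') (z i) \<le> E + \<sigma>"
  proof (cases "LEAST i. right i")
    \<comment> \<open>There is no predecessor, but \<open>z 0 = pt h s\<close> is itself on the part
      of \<open>h\<close> before \<open>u\<close>.\<close>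
    case 0
    have "d (pt h s) (z 0) \<le> E" using z(1) E pt_in[OF h st(1)] by simp
    moreover obtain v' where "v' \<in> {u..t}" "d (pt h v') (z 0) \<le> E"
      using right(1) 0 by (auto simp: right_def)
    ultimately show ?thesis using that[of 0 s v'] st E by auto
  next
    case (Suc i)
    then have ij: "i < j" using right(2) by simp
    have "\<not> right i" using not_less_Least[of i right] Suc by simp
    moreover obtain v where "v \<in> {s..t}" "d (pt h v) (z i) \<le> E" using near[of i] ij by auto
    ultimately have v: "v \<in> {s..u}" "d (pt h v) (z i) \<le> E" by (auto simp: right_def)
    obtain v' where v': "v' \<in> {u..t}" "d (pt h v') (z (Suc i)) \<le> E"
      using right(1) Suc by (auto simp: right_def)
    have "d (pt h v') (z i) \<le> d (pt h v') (z (Suc i)) + d (z (Suc i)) (z i)"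
      using v' st(3) ij by (intro mdist_triangle z(3) pt_in[OF h] dom) auto
    then have "d (pt h v') (z i) \<le> E + \<sigma>"
      using v'(2) z(4)[OF ij] mdist_commute[of m "z (Suc i)" "z i"] by linarith
    then show ?thesis using that[of i v v'] ij v v' by auto
  qed
  have vd: "v \<in> seg_dom h" "v' \<in> seg_dom h" "u \<in> seg_dom h" using i(2,3) st by auto
  note in_S = pt_in[OF h vd(1)] pt_in[OF h vd(2)] pt_in[OF h vd(3)] z(3)[OF i(1)]
  have "d (pt h v) (pt h v') \<le> 2 * E + \<sigma>"
    using mdist_triangle[OF in_S(1,4,2)] i(4,5) mdist_commute[of m "pt h v'" "z i"] by linarith
  then have "\<bar>v - v'\<bar> \<le> L * (2 * E + \<sigma> + \<kappa>)" by (rule d_lower_le[OF h vd(1,2)])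
  then have "\<bar>v - u\<bar> \<le> L * (2 * E + \<sigma> + \<kappa>)" using i(2,3) by auto
  then have "d (pt h v) (pt h u) \<le> reach (2 * E + \<sigma>)"
    unfolding reach_def by (rule d_upper_le[OF h vd(1,3)])
  then have "d (z i) (pt h u) \<le> E + reach (2 * E + \<sigma>)"
    using mdist_triangle[OF in_S(4,1,3)] i(4) mdist_commute[of m "pt h v" "z i"] by linarith
  with i(1) that show ?thesis by blast
qed

text \<open>Navigability wants endpoints within twice the radius of the centre, whereas
  \<open>s\<close> and \<open>t\<close> may be far from \<open>u\<close>. Two pieces of
  \<open>h\<close>, cut where the distance to \<open>pt h u\<close> first falls to \<open>R\<close>
  when approaching from \<open>s\<close> and from \<open>t\<close>, are added as sides.\<close>

lemma polyline_extend:
  assumes h: "h \<in> P" and st: "s \<in> seg_dom h" "t \<in> seg_dom h" "u \<in> {s..t}"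
    and A: "polyline N (pt h s) (pt h t) A" "\<And>z. z \<in> A \<Longrightarrow> R < d z (pt h u)" and R: "0 \<le> R"
  obtains s' t' B where "s' \<in> {s..u}" "t' \<in> {u..t}" "d (pt h s') (pt h u) = R" "d (pt h t') (pt h u) = R"
    "polyline (N + 2) (pt h s') (pt h t') B" "\<forall>z\<in>B. R \<le> d z (pt h u)"
proof -
  have u: "u \<in> seg_dom h" using st by auto
  let ?f = "\<lambda>v. d (pt h u) (pt h v)"
  have "continuous_map (top_of_set (seg_dom h)) euclideanreal (\<lambda>v. d (pt h u) (pt h v))"
    by (intro continuous_map_mdist P_continuous[OF h]) (simp add: pt_in[OF h u])
  then have cont: "continuous_on (seg_dom h) ?f" by simp
  have ends: "R < ?f s" "R < ?f t"
    using A(2) polyline_in[OF A(1)] mdist_commute[of m "pt h u"] by auto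
  have fu: "?f u = 0" using pt_in[OF h u] by simp
  obtain s' where s': "s' \<in> {s..u}" "?f s' = R" "\<And>w. w \<in> {s..s'} \<Longrightarrow> R \<le> ?f w"
    by (rule first_crossing[of s u ?f R])
      (use st u ends fu R in \<open>auto intro: continuous_on_subset[OF cont]\<close>)
  obtain t' where t': "t' \<in> {u..t}" "?f t' = R" "\<And>w. w \<in> {t'..t} \<Longrightarrow> R \<le> ?f w"
    by (rule last_crossing[of u t ?f R])
      (use st u ends fu R in \<open>auto intro: continuous_on_subset[OF cont]\<close>)
  have dom: "s' \<in> seg_dom h" "t' \<in> seg_dom h" using s'(1) t'(1) st by auto
  have pl: "polyline (1 + N + 1) (pt h s') (pt h t')
      (pt h ` {min s' s..max s' s} \<union> A \<union> pt h ` {min t t'..max t t'})"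
    by (intro polyline_trans[OF polyline_trans[OF polyline_sub[OF h dom(1) st(1)] A(1)]]
        polyline_sub[OF h st(2) dom(2)])
  have far: "R \<le> d z (pt h u)"
    if "z \<in> pt h ` {min s' s..max s' s} \<union> A \<union> pt h ` {min t t'..max t t'}" for z
    using that
  proof (elim UnE)
    assume "z \<in> pt h ` {min s' s..max s' s}"
    then obtain x where "z = pt h x" "x \<in> {s..s'}" using s'(1) by auto
    then show ?thesis using s'(3)[of x] mdist_commute[of m "pt h u" z] by simp
  next
    assume "z \<in> A"
    then show ?thesis using A(2) by force
  next
    assume "z \<in> pt h ` {min t t'..max t t'}"
    then obtain x where "z = pt h x" "x \<in> {t'..t}" using t'(1) by auto
    then show ?thesis using t'(3)[of x] mdist_commute[of m "pt h u" z] by simp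
  qed
  show ?thesis
  proof (rule that[OF s'(1) t'(1)])
    show "d (pt h s') (pt h u) = R" "d (pt h t') (pt h u) = R"
      using s'(2) t'(2) by (simp_all add: mdist_commute[of m _ "pt h u"])
    show "polyline (N + 2) (pt h s') (pt h t')
        (pt h ` {min s' s..max s' s} \<union> A \<union> pt h ` {min t t'..max t t'})" using pl by simp
  qed (use far in blast)
qed

end

locale navigable_system = path_system_on m P L \<kappa> + length_metric m
  for m :: "'p metric" and P and L \<kappa> +
  assumes navigable: "navigable m P"
begin

text \<open>The order of the constants is the point. A detour takes at most \<open>A1 * R\<close>
  steps and avoids a ball of radius \<open>R / C\<close>, so the weight \<open>W\<close> depends on
  a ratio that is free of \<open>R\<close>. This fixes the quasi-geodesic constants and, through the
  gauge, the closeness \<open>E\<close> to \<open>h\<close>. Then \<open>B\<close>, and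
  \<open>R = C * B\<close>, are chosen so large that following \<open>h\<close> at distance
  \<open>E\<close> is incompatible with avoiding the ball of radius \<open>B / 2\<close> around
  \<open>pt h u\<close>.\<close>

lemma morse_imp_thin:
  assumes M: "morse_gauge M"
  obtains R where "0 \<le> R" "\<And>h. h \<in> P \<Longrightarrow> morse m M (seg_dom h) (pt h) \<Longrightarrow> thin h N R"
proof -
  obtain C k where C: "(1::real) \<le> C"
    and nav: "\<And>R c n \<alpha>. C \<le> R \<Longrightarrow> c \<in> S \<Longrightarrow> polygonal_line n P \<alpha> \<Longrightarrow>
      R \<le> set_mdist m (seg_image \<alpha>) c \<Longrightarrow> d (seg_start \<alpha>) c \<le> 2 * R \<Longrightarrow> d (seg_end \<alpha>) c \<le> 2 * R \<Longrightarrow>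
      \<exists>p. polygonal_line (k * n) P p \<and> seg_start p = seg_start \<alpha> \<and> seg_end p = seg_end \<alpha> \<and>
        seg_length m p \<le> ennreal (C * real n * R) \<and> seg_image p \<inter> mcball_of m c (R / C) = {}"
    using navigable unfolding navigable_def by blast
  define \<sigma> where "\<sigma> = L + \<kappa>"
  define A1 where "A1 = L * (C * real (N + 2)) + real (k * (N + 2)) * (L * \<kappa> + 1)"
  define W where "W = nat \<lceil>4 * \<sigma> * A1 * C\<rceil> + 1"
  \<comment> \<open>The added 1 turns the bound on an infimum into an actual point of
    \<open>h\<close> at distance at most \<open>E\<close>.\<close>
  define E where "E = M (real W + \<sigma> + 1) (2 * \<sigma> + 5) + 1"
  define B where "B = 4 * \<sigma> + 2 * (E + reach (2 * E + \<sigma>)) + 1"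
  define R where "R = C * B"
  have \<sigma>: "1 \<le> \<sigma>" using L \<kappa> by (simp add: \<sigma>_def)
  have W: "1 \<le> W" "4 * \<sigma> * A1 * C < real W" unfolding W_def by linarith+
  have Q: "1 \<le> real W + \<sigma> + 1" "0 \<le> 2 * \<sigma> + 5" using \<sigma> by simp_all
  then have E: "1 \<le> E" using M unfolding morse_gauge_def E_def by simp
  have B: "1 \<le> B" "4 * \<sigma> \<le> B" "2 * (E + reach (2 * E + \<sigma>)) \<le> B"
    using \<sigma> E reach_nonneg[of "2 * E + \<sigma>"] by (simp_all add: B_def)
  have "C \<le> R" using C mult_left_mono[OF B(1), of C] by (simp add: R_def)
  moreover from this have "1 \<le> R" using C by linarith
  ultimately have R: "C \<le> R" "1 \<le> R" "R / C = B" using C by (simp_all add: R_def)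
  have core: "\<exists>z\<in>A. d z (pt h u) \<le> R"
    if h: "h \<in> P" and morse: "morse m M (seg_dom h) (pt h)"
      and st: "s \<in> seg_dom h" "t \<in> seg_dom h" "u \<in> {s..t}" and A: "polyline N (pt h s) (pt h t) A"
    for h s t u A
  proof (rule ccontr)
    assume "\<not> ?thesis"
    then have far: "R < d z (pt h u)" if "z \<in> A" for z using that by auto
    have u: "pt h u \<in> S" using st by (intro pt_in[OF h]) auto
    have R0: "0 \<le> R" using R(2) by simp
    obtain s' t' B' where s't': "s' \<in> {s..u}" "t' \<in> {u..t}" "d (pt h s') (pt h u) = R"
        "d (pt h t') (pt h u) = R"
      and B': "polyline (N + 2) (pt h s') (pt h t') B'" "\<forall>z\<in>B'. R \<le> d z (pt h u)"
      by (rule polyline_extend[OF h st A far R0])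
    obtain \<alpha> where \<alpha>: "polygonal_line (N + 2) P \<alpha>" "seg_start \<alpha> = pt h s'" "seg_end \<alpha> = pt h t'"
      "seg_image \<alpha> = B'" using B'(1) by (auto simp: polyline_def)
    have "B' \<noteq> {}" using polyline_in(2)[OF B'(1)] by blast
    then have "R \<le> set_mdist m (seg_image \<alpha>) (pt h u)"
      unfolding set_mdist_def \<alpha>(4) using B'(2) by (intro cINF_greatest) auto
    then obtain p where p: "polygonal_line (k * (N + 2)) P p" "seg_start p = pt h s'" "seg_end p = pt h t'"
        "seg_length m p \<le> ennreal (C * real (N + 2) * R)" "seg_image p \<inter> mcball_of m (pt h u) (R / C) = {}"
      using nav[OF R(1) u \<alpha>(1)] \<alpha> s't' R(2) by auto
    have "polyline (k * (N + 2)) (pt h s') (pt h t') (seg_image p)"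
      using p(1-3) unfolding polyline_def by blast
    note p_in = polyline_in(1)[OF this]
    have p_far: "\<forall>a\<in>seg_image p. B < d a (pt h u)"
    proof
      fix a assume a: "a \<in> seg_image p"
      then have "a \<notin> mcball_of m (pt h u) (R / C)" using p(5) by blast
      then show "B < d a (pt h u)"
        using a p_in u mdist_commute[of m "pt h u" a] by (auto simp: in_mcball_of R(3))
    qed
    have "0 \<le> C * real (N + 2) * R" using C R(2) by simp
    from polygonal_line_hops[OF p(1,4) this] obtain kk where
      kk: "hops m \<sigma> (seg_image p) kk (pt h s') (pt h t')"
        "real kk \<le> L * (C * real (N + 2) * R) + real (k * (N + 2)) * (L * \<kappa> + 1)"
      unfolding p(2,3) \<sigma>_def by blast
    \<comment> \<open>As \<open>R\<close> is at least 1, the additive term coming from the number of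
      sides is absorbed into a multiple of \<open>R\<close>.\<close>
    have "real (k * (N + 2)) * (L * \<kappa> + 1) * 1 \<le> real (k * (N + 2)) * (L * \<kappa> + 1) * R"
      using R(2) L \<kappa> by (intro mult_left_mono) auto
    moreover have "A1 * R = L * (C * real (N + 2) * R) + real (k * (N + 2)) * (L * \<kappa> + 1) * R"
      unfolding A1_def by (simp only: distrib_right mult.assoc)
    ultimately have "real kk \<le> A1 * R" using kk(2) by linarith
    then have "real kk * (4 * \<sigma>) \<le> A1 * R * (4 * \<sigma>)" using \<sigma> by (intro mult_right_mono) auto
    also have "\<dots> = (4 * \<sigma> * A1 * C) * B" by (simp add: R_def)
    also have "\<dots> < real W * B" using W(2) B(1) by (intro mult_strict_right_mono) auto
    finally have kk4: "real kk * (4 * \<sigma>) < real W * B" .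
    obtain j z where z': "z 0 = pt h s'" "z j = pt h t'" "\<forall>i\<le>j. z i \<in> S"
      "\<forall>i\<le>j. B / 2 < d (z i) (pt h u)" "\<forall>i<j. d (z i) (z (Suc i)) \<le> \<sigma>"
      "\<forall>i i'. i \<le> i' \<longrightarrow> i' \<le> j \<longrightarrow> real (i' - i) \<le> real W * (d (z i) (z i') + 2)"
      by (rule avoiding_quasi_geodesic[OF u kk(1) p_in p_far \<sigma> B(2) W(1) kk4])
    note z = z'(1,2) z'(3-6)[rule_format]
    have "0 \<le> \<sigma>" "1 \<le> real W" using \<sigma> W(1) by simp_all
    from improved_interpolate[of j z \<sigma> "real W", OF z(3,5) this z(6)]
    obtain \<eta> where \<eta>': "\<forall>i\<le>j. \<eta> (real i) = z i"
      "improved_quasi_geodesic m (real W + \<sigma> + 1) (2 * \<sigma> + 5) {0..real j} \<eta>"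
      by blast
    note \<eta> = \<eta>'(1)[rule_format] \<eta>'(2)
    have st': "s' \<in> seg_dom h" "t' \<in> seg_dom h" "s' \<le> t'" "u \<in> {s'..t'}" using s't' st by auto
    have near: "\<exists>v\<in>{s'..t'}. d (pt h v) (z i) \<le> E" if i: "i \<le> j" for i
    proof (rule ccontr)
      assume "\<not> ?thesis"
      then have "E \<le> set_mdist m (pt h ` {s'..t'}) (\<eta> (real i))"
        unfolding set_mdist_def using st'(3) \<eta>(1)[OF i] by (intro cINF_greatest) auto
      moreover have "set_mdist m (pt h ` {s'..t'}) (\<eta> (real i)) \<le> M (real W + \<sigma> + 1) (2 * \<sigma> + 5)"
        using morse[unfolded morse_def, rule_format, OF Q st'(1,2,3) _ \<eta>(2)] \<eta>(1)[of 0] \<eta>(1)[of j]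
          z(1,2) i by simp
      ultimately show False by (simp add: E_def)
    qed
    obtain i where i: "i \<le> j" "d (z i) (pt h u) \<le> E + reach (2 * E + \<sigma>)"
      by (rule no_jump[OF h st'(1,2,4) z(1,2,3,5) near]) (use E \<sigma> in auto)
    moreover have "E + reach (2 * E + \<sigma>) \<le> B / 2" using B(3) by simp
    ultimately have "d (z i) (pt h u) \<le> B / 2" by (meson order_trans)
    with z(4)[OF i(1)] show False by simp
  qed
  have "thin h N R" if h: "h \<in> P" "morse m M (seg_dom h) (pt h)" for h
    unfolding thin_def
  proof (intro ballI allI impI)
    fix s t u A assume st: "s \<in> seg_dom h" "t \<in> seg_dom h" "u \<in> {min s t..max s t}"
      and A: "polyline N (pt h s) (pt h t) A"
    show "\<exists>z\<in>A. d z (pt h u) \<le> R"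
    proof (cases "s \<le> t")
      case True
      then show ?thesis using core[OF h st(1,2) _ A] st(3) by simp
    next
      case False
      then show ?thesis using core[OF h st(2,1) _ polyline_rev[OF A]] st(3) by simp
    qed
  qed
  with that[of R] R(2) show ?thesis by simp
qed

end

section \<open>Metric graphs and contraction graphs\<close>

lemma gdist_le: "pl_path G x y l \<Longrightarrow> gdist G x y \<le> l"
proof -
  assume *: "pl_path G x y l"
  have "bdd_below {l. pl_path G x y l}"
    using pl_path_nonneg by (intro bdd_belowI[of _ 0]) auto
  with * show ?thesis by (auto simp: gdist_def intro: cInf_lower)
qed

lemma gdist_greatest:
  assumes "wf_digraph G" "Digraph_Component.connected G" "x \<in> gpoints G" "y \<in> gpoints G"
    and "\<And>l. pl_path G x y l \<Longrightarrow> c \<le> l"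
  shows "c \<le> gdist G x y"
  using pl_path_connected[OF assms(1-4)] assms(5) by (auto simp: gdist_def intro!: cInf_greatest)

text \<open>Each move is run at unit speed in the direction from \<open>s\<close> to
  \<open>t\<close>; parameters in different moves are compared through the junction.\<close>

lemma pl_path_curve:
  assumes G: "wf_digraph G" "Digraph_Component.connected G" and "pl_path G x y l"
  shows "\<exists>f. f 0 = x \<and> f l = y \<and> (\<forall>t\<in>{0..l}. f t \<in> gpoints G) \<and>
    (\<forall>s\<in>{0..l}. \<forall>t\<in>{0..l}. gdist G (f s) (f t) \<le> \<bar>s - t\<bar>)"
  using assms(3)
proof (induction rule: pl_path.induct)
  interpret Metric_space "gpoints G" "gdist G" by (rule Metric_space_gdist[OF G])
  {
    case (refl x)
    then show ?case by (intro exI[of _ "\<lambda>_. x"]) simp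
  next
    case (step x e s l t)
    obtain f where f: "f 0 = x" "f l = edge_point G e s" "\<forall>r\<in>{0..l}. f r \<in> gpoints G"
      "\<forall>r\<in>{0..l}. \<forall>r'\<in>{0..l}. gdist G (f r) (f r') \<le> \<bar>r - r'\<bar>" using step.IH by blast
    have l: "0 \<le> l" using pl_path_nonneg[OF step.hyps(1)] .
    define sg where "sg = (if s \<le> t then 1 else - 1 :: real)"
    define f' where "f' = (\<lambda>r. if r \<le> l then f r else edge_point G e (s + sg * (r - l)))"
    have f1: "f' r = f r" if "r \<in> {0..l}" for r using that by (simp add: f'_def)
    have f2: "f' r = edge_point G e (s + sg * (r - l))" if "r \<in> {l..l + \<bar>s - t\<bar>}" for r
      using that f(2) by (auto simp: f'_def)
    have par: "s + sg * (r - l) \<in> {0..1}" if "r \<in> {l..l + \<bar>s - t\<bar>}" for r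
      using that step.hyps(3,4) by (auto simp: sg_def)
    have in_G: "f' r \<in> gpoints G" if "r \<in> {0..l + \<bar>s - t\<bar>}" for r
      using that f(3) f1 f2[of r] edge_point_in[OF G(1) step.hyps(2) par[of r]] by (cases "r \<le> l") auto
    have 2: "gdist G (f' r) (f' r') \<le> \<bar>r - r'\<bar>"
      if "r \<in> {l..l + \<bar>s - t\<bar>}" "r' \<in> {l..l + \<bar>s - t\<bar>}" for r r'
    proof -
      have "gdist G (f' r) (f' r') \<le> \<bar>(s + sg * (r - l)) - (s + sg * (r' - l))\<bar>"
        unfolding f2[OF that(1)] f2[OF that(2)]
        by (intro gdist_le pl_path_edge[OF G(1) step.hyps(2)] par that)
      also have "\<dots> = \<bar>r - r'\<bar>" by (auto simp: sg_def)
      finally show ?thesis .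
    qed
    have 1: "gdist G (f' r) (f' r') \<le> \<bar>r - r'\<bar>" if "r \<in> {0..l}" "r' \<in> {0..l}" for r r'
      using f(4) f1 that by simp
    have 3: "gdist G (f' r) (f' r') \<le> \<bar>r - r'\<bar>"
      if "r \<in> {0..l}" "r' \<in> {l..l + \<bar>s - t\<bar>}" for r r'
    proof -
      have "gdist G (f' r) (f' r') \<le> gdist G (f' r) (f' l) + gdist G (f' l) (f' r')"
        using that l by (intro triangle in_G) auto
      also have "\<dots> \<le> \<bar>r - l\<bar> + \<bar>l - r'\<bar>" using that l by (intro add_mono 1 2) auto
      finally show ?thesis using that by auto
    qed
    have "gdist G (f' r) (f' r') \<le> \<bar>r - r'\<bar>"
      if "r \<in> {0..l + \<bar>s - t\<bar>}" "r' \<in> {0..l + \<bar>s - t\<bar>}" for r r'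
      using that 1[of r r'] 2[of r r'] 3[of r r'] 3[of r' r, unfolded commute[of "f' r'" "f' r"]
          abs_minus_commute[of r' r]] by (cases "r \<le> l"; cases "r' \<le> l") auto
    moreover have "f' 0 = x" using f1[of 0] f(1) l by simp
    moreover have "f' (l + \<bar>s - t\<bar>) = edge_point G e t"
      using f2[of "l + \<bar>s - t\<bar>"] by (auto simp: sg_def)
    ultimately show ?case using in_G by (intro exI[of _ f']) blast
  }
qed

lemma length_metric_graph:
  assumes G: "wf_digraph G" "Digraph_Component.connected G"
  shows "length_metric (graph_metric G)"
proof
  fix x y assume "x \<in> mspace (graph_metric G)" "y \<in> mspace (graph_metric G)"
  then have xy: "x \<in> gpoints G" "y \<in> gpoints G" by (simp_all add: mspace_graph_metric[OF G])
  \<comment> \<open>Otherwise \<open>gdist G x y + 1\<close> would be a lower bound of all path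
    lengths.\<close>
  obtain l where l: "pl_path G x y l" "l \<le> gdist G x y + 1"
    using gdist_greatest[OF G xy, of "gdist G x y + 1"] by (metis add_le_same_cancel1 linear not_one_le_zero)
  then show "\<exists>f l. 0 \<le> l \<and> l \<le> mdist (graph_metric G) x y + 1 \<and> f 0 = x \<and> f l = y \<and>
      (\<forall>t\<in>{0..l}. f t \<in> mspace (graph_metric G)) \<and>
      (\<forall>s\<in>{0..l}. \<forall>t\<in>{0..l}. mdist (graph_metric G) (f s) (f t) \<le> \<bar>s - t\<bar>)"
    using pl_path_curve[OF G l(1)] pl_path_nonneg[OF l(1)]
    unfolding mspace_graph_metric[OF G] mdist_graph_metric[OF G] by blast
qed

lemma gdist_same_edge:
  assumes "wf_digraph G" "Inner e s \<in> gpoints G" "Inner e t \<in> gpoints G"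
  shows "gdist G (Inner e s) (Inner e t) < 1"
proof -
  note s = gpoints_edge_point[OF assms(2)] and t = gpoints_edge_point[OF assms(3)]
  have "gdist G (Inner e s) (Inner e t) \<le> \<bar>s - t\<bar>"
    unfolding s(4) t(4) using s t by (intro gdist_le pl_path_edge[OF assms(1)]) auto
  then show ?thesis using s t by linarith
qed

text \<open>A curve missing all vertices stays locally, and by connectedness globally, in one open
  edge, where distances are below 1. This is needed because anti-contracting pairs are pairs of
  vertices, while \<open>h\<close> may start and end inside edges.\<close>

lemma path_hits_vertex:
  fixes a b :: real
  assumes G: "wf_digraph G" "Digraph_Component.connected G"
    and \<gamma>: "continuous_map (top_of_set {a..b}) (mtopology_of (graph_metric G)) \<gamma>" and ab: "a \<le> b"
    and far: "1 < gdist G (\<gamma> a) (\<gamma> b)"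
  shows "\<exists>t\<in>{a..b}. \<exists>v\<in>verts G. \<gamma> t = Vertex v"
proof (rule ccontr)
  assume none: "\<not> ?thesis"
  interpret Metric_space "gpoints G" "gdist G" by (rule Metric_space_gdist[OF G])
  have \<gamma>': "continuous_map (top_of_set {a..b}) mtopology \<gamma>"
    using \<gamma> by (simp add: mtopology_of_def mspace_graph_metric[OF G] mdist_graph_metric[OF G])
  have \<gamma>_in: "\<gamma> t \<in> gpoints G" if "t \<in> {a..b}" for t
    using continuous_map_image_subset_topspace[OF \<gamma>'] that by auto
  have inner: "\<exists>e s. \<gamma> t = Inner e s" if "t \<in> {a..b}" for t
    using none \<gamma>_in[OF that] that by (auto simp: gpoints_def)
  define e where "e = (\<lambda>t. SOME e. \<exists>s. \<gamma> t = Inner e s)"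
  have e: "\<exists>s. \<gamma> t = Inner (e t) s" if "t \<in> {a..b}" for t
    unfolding e_def using inner[OF that] by (rule someI_ex)
  have "e a = e b"
  proof (rule connected_local_const[of "{a..b}" a b e])
    show "\<forall>t\<in>{a..b}. \<forall>\<^sub>F t' in at t within {a..b}. e t = e t'"
    proof
      fix t assume t: "t \<in> {a..b}"
      obtain s where s: "\<gamma> t = Inner (e t) s" using e[OF t] by blast
      note * = gpoints_edge_point[OF \<gamma>_in[OF t, unfolded s]]
      have "0 < min s (1 - s)" using * by simp
      then obtain U where U: "openin (top_of_set {a..b}) U" "t \<in> U" "\<forall>y\<in>U. \<gamma> y \<in> mball (\<gamma> t) (min s (1 - s))"
        using \<gamma>'[unfolded continuous_map_to_metric, rule_format, of t "min s (1 - s)"] t by auto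
      have eq: "e t = e t'" if t': "t' \<in> U" for t'
      proof -
        have "t' \<in> {a..b}" using openin_imp_subset[OF U(1)] t' by blast
        then obtain s' where s': "\<gamma> t' = Inner (e t') s'" using e by blast
        have lt: "gdist G (Inner (e t) s) (\<gamma> t') < min s (1 - s)"
          using U(3) t' s by auto
        \<comment> \<open>A path shorter than the distance to both ends of the edge cannot leave the
          edge.\<close>
        have "\<exists>l. pl_path G (Inner (e t) s) (\<gamma> t') l \<and> l < min s (1 - s)"
        proof (rule ccontr)
          assume "\<not> ?thesis"
          then have "min s (1 - s) \<le> gdist G (Inner (e t) s) (\<gamma> t')"
            using \<gamma>_in[OF t] \<gamma>_in[OF \<open>t' \<in> {a..b}\<close>] s
            by (intro gdist_greatest[OF G]) (auto simp: not_less)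
          with lt show False by linarith
        qed
        then obtain l where l: "pl_path G (Inner (e t) s) (\<gamma> t') l" "l < min s (1 - s)" by blast
        show ?thesis using pl_path_from_Inner[OF l(1) HOL.refl *(2,3)] l(2) s' by auto
      qed
      obtain T where T: "open T" "U = {a..b} \<inter> T" using U(1) unfolding openin_open by blast
      have "t \<in> T" using U(2) T(2) by simp
      moreover have "\<forall>t'\<in>T. t' \<noteq> t \<longrightarrow> t' \<in> {a..b} \<longrightarrow> e t = e t'" using eq T(2) by blast
      ultimately show "\<forall>\<^sub>F t' in at t within {a..b}. e t = e t'"
        unfolding eventually_at_topological using T(1) by blast
    qed
  qed (use ab in auto)
  then obtain s s' where "\<gamma> a = Inner (e a) s" "\<gamma> b = Inner (e a) s'"
    using e[of a] e[of b] ab by auto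
  then show False
    using far gdist_same_edge[OF G(1), of "e a" s s'] \<gamma>_in[of a] \<gamma>_in[of b] ab by auto
qed

text \<open>Lower bounds for distances in a graph come from functions that vary little over every
  edge. The vertex function will be a projection to \<open>h\<close>; affine extension supplies the
  values inside old and new edges.\<close>

primrec affine_extension :: "('v, 'e) pre_digraph \<Rightarrow> ('v \<Rightarrow> real) \<Rightarrow> ('v, 'e) gpoint \<Rightarrow> real" where
  "affine_extension G f (Vertex v) = f v"
| "affine_extension G f (Inner e t) = (1 - t) * f (tail G e) + t * f (head G e)"

lemma affine_extension_edge_point:
  "affine_extension G f (edge_point G e t) = (1 - t) * f (tail G e) + t * f (head G e)"
  by (simp add: edge_point_def)

lemma affine_extension_lipschitz:
  assumes "pl_path G x y l" "\<And>e. e \<in> arcs G \<Longrightarrow> \<bar>f (tail G e) - f (head G e)\<bar> \<le> D"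
  shows "\<bar>affine_extension G f x - affine_extension G f y\<bar> \<le> D * l"
  using assms(1)
proof (induction rule: pl_path.induct)
  case (step x e s l t)
  have "affine_extension G f (edge_point G e s) - affine_extension G f (edge_point G e t)
      = (t - s) * (f (tail G e) - f (head G e))"
    by (simp add: affine_extension_edge_point algebra_simps)
  then have "\<bar>affine_extension G f (edge_point G e s) - affine_extension G f (edge_point G e t)\<bar>
      = \<bar>s - t\<bar> * \<bar>f (tail G e) - f (head G e)\<bar>"
    by (simp add: abs_mult abs_minus_commute[of s t])
  also have "\<dots> \<le> \<bar>s - t\<bar> * D" using assms(2)[OF step.hyps(2)] by (intro mult_left_mono) auto
  finally show ?case using step.IH by (simp add: algebra_simps)
qed simp

text \<open>The value inside an edge is a convex combination of the values at its two ends, which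
  are at distance at most 1 from the point.\<close>

lemma affine_extension_close:
  assumes "wf_digraph G" "x \<in> gpoints G"
    "\<And>v. v \<in> verts G \<Longrightarrow> gdist G (Vertex v) x \<le> 1 \<Longrightarrow> \<bar>f v - c\<bar> \<le> D"
  shows "\<bar>affine_extension G f x - c\<bar> \<le> D"
proof (cases x)
  case (Vertex v)
  have "gdist G (Vertex v) x \<le> 0" using gdist_le[OF pl_path.refl[OF assms(2)]] Vertex by simp
  then show ?thesis using assms(2) assms(3)[of v] Vertex by (auto simp: gpoints_def)
next
  case (Inner e t)
  note * = gpoints_edge_point[OF assms(2)[unfolded Inner]]
  have "gdist G (edge_point G e r) x \<le> 1" if "r \<in> {0..1}" for r
    unfolding Inner *(4)
    using gdist_le[OF pl_path_edge[OF assms(1) *(1) that, of t]] that *(2,3) by fastforce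
  from this[of 0] this[of 1]
  have "gdist G (Vertex (tail G e)) x \<le> 1" "gdist G (Vertex (head G e)) x \<le> 1"
    by (simp_all add: edge_point_def)
  then have D: "\<bar>f (tail G e) - c\<bar> \<le> D" "\<bar>f (head G e) - c\<bar> \<le> D"
    using assms(3) *(1) assms(1) by (simp_all add: wf_digraph.tail_in_verts wf_digraph.head_in_verts)
  have "affine_extension G f x - c = (1 - t) * (f (tail G e) - c) + t * (f (head G e) - c)"
    unfolding Inner by (simp add: algebra_simps)
  also have "\<bar>\<dots>\<bar> \<le> (1 - t) * \<bar>f (tail G e) - c\<bar> + t * \<bar>f (head G e) - c\<bar>"
    using *(2,3) abs_triangle_ineq[of "(1 - t) * (f (tail G e) - c)" "t * (f (head G e) - c)"]
    by (simp add: abs_mult)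
  also have "\<dots> \<le> (1 - t) * D + t * D"
    using *(2,3) D by (intro add_mono mult_left_mono) auto
  finally show ?thesis by (simp add: algebra_simps)
qed

section \<open>The inclusion into the contraction graph\<close>

lemma contraction_graph_simps [simp]:
  "verts (contraction_graph X \<K>) = verts X"
  "tail (contraction_graph X \<K>) = case_sum (tail X) fst"
  "head (contraction_graph X \<K>) = case_sum (head X) snd"
  by (simp_all add: contraction_graph_def)

lemma contraction_incl_in: "x \<in> gpoints X \<Longrightarrow> contraction_incl x \<in> gpoints (contraction_graph X \<K>)"
  by (auto simp: gpoints_def contraction_graph_def)

lemma contraction_incl_edge_point:
  "contraction_incl (edge_point X e t) = edge_point (contraction_graph X \<K>) (Inl e) t"
  by (simp add: edge_point_def)

lemma pl_path_contraction_incl: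
  "pl_path X x y l \<Longrightarrow> pl_path (contraction_graph X \<K>) (contraction_incl x) (contraction_incl y) l"
proof (induction rule: pl_path.induct)
  case (refl x)
  then show ?case by (intro pl_path.refl contraction_incl_in)
next
  case (step x e s l t)
  then show ?case
    unfolding contraction_incl_edge_point[where \<K> = \<K>]
    by (intro pl_path.step) (auto simp: contraction_graph_def)
qed

lemma gdist_contraction_incl_le:
  assumes "wf_digraph X" "Digraph_Component.connected X" "x \<in> gpoints X" "y \<in> gpoints X"
  shows "gdist (contraction_graph X \<K>) (contraction_incl x) (contraction_incl y) \<le> gdist X x y"
  using assms by (intro gdist_greatest gdist_le pl_path_contraction_incl)

section \<open>The contraction space\<close>

locale graph_path_system = navigable_system "graph_metric X" P L \<kappa>
  for X :: "('v, 'e) pre_digraph" and P L \<kappa> +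
  assumes wf: "wf_digraph X" and conn: "Digraph_Component.connected X"
begin

lemma S_eq: "S = gpoints X" and d_eq: "d = gdist X"
  by (rule mspace_graph_metric[OF wf conn], rule mdist_graph_metric[OF wf conn])

lemma contraction_space_simps:
  "mspace (contraction_space X \<K>) = gpoints (contraction_graph X \<K>)"
  "mdist (contraction_space X \<K>) = gdist (contraction_graph X \<K>)"
  unfolding contraction_space_def
  by (rule mspace_graph_metric mdist_graph_metric,
      rule wf_contraction_graph[OF wf] connected_contraction_graph[OF conn],
      rule connected_contraction_graph[OF conn])+

lemma anti_contracting_adjacent:
  assumes g: "g \<in> P" "seg_start g = Vertex x" "seg_end g = Vertex y"
    and anti: "anti_contracting (graph_metric X) (K, n, P) g"
  shows "gdist (contraction_graph X (K, n, P)) (Vertex x) (Vertex y) \<le> 1"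
proof -
  let ?Y = "contraction_graph X (K, n, P)"
  have "x \<in> verts X" "y \<in> verts X"
    using seg_start_end_in(1,2)[OF g(1)] g(2,3) by (auto simp: S_eq gpoints_def)
  then have "Inr (x, y) \<in> arcs ?Y" using g anti by (auto simp: contraction_graph_def)
  from pl_path_edge[OF wf_contraction_graph[OF wf] this, of 0 1] show ?thesis
    using gdist_le[of ?Y "Vertex x" "Vertex y" 1] by (simp add: edge_point_def)
qed

text \<open>
  With this gauge the two halves of a midthin segment leave the ball around its midpoint.
\<close>

definition base_gauge :: "real \<Rightarrow> ennreal" where "base_gauge r = ennreal (2 * (L * (r + \<kappa>)) + 1)"

lemma base_gauge: "contraction_gauge base_gauge" "full_gauge base_gauge"
  using L by (auto simp: contraction_gauge_def full_gauge_def base_gauge_def mono_on_def intro!: ennreal_leI)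

text \<open>During \<open>L * (1 + \<kappa>) + 1\<close> the path \<open>h\<close> moves by more
  than 1 and so meets a vertex; this is provided once at each end. Over the remaining
  \<open>Q * (1 + Q) + 1\<close> a \<open>(Q, Q)\<close>-quasi-geodesic must move by more than
  1.\<close>

definition window :: "real \<Rightarrow> real" where "window Q = 2 * (L * (1 + \<kappa>) + 1) + (Q * (1 + Q) + 1)"

lemma window_nonneg: "1 \<le> Q \<Longrightarrow> 0 \<le> window Q"
  using L \<kappa> by (simp add: window_def)

text \<open>The window contains a vertex near each end. If the segment between them were
  anti-contracting, a new edge would put their images at distance at most 1, too close for the
  quasi-geodesic. Hence it has a midthin piece from \<open>a\<close> to \<open>b\<close>, and
  \<open>base_gauge r \<le> K r \<le> b - a\<close> both bounds \<open>r\<close> and makes each half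
  longer than \<open>L * (r + \<kappa>)\<close>.\<close>

lemma midthin_in_window:
  assumes K: "\<forall>r\<ge>0. base_gauge r \<le> K r" and h: "h \<in> P" and Q: "1 \<le> Q"
    and qg: "quasi_geodesic (contraction_space X (K, n, P)) Q Q (seg_dom h) (contraction_incl \<circ> pt h)"
    and v: "lo h \<le> v" "v + window Q \<le> hi h"
  obtains a b r where "v \<le> a" "a \<le> b" "b \<le> v + window Q" "r \<le> window Q"
    "L * (r + \<kappa>) < (b - a) / 2"
    "\<forall>A. polyline n (pt h b) (pt h a) A \<longrightarrow> (\<exists>z\<in>A. d z (pt h ((a + b) / 2)) \<le> r)"
proof -
  let ?Y = "contraction_graph X (K, n, P)"
  define T0 where "T0 = L * (1 + \<kappa>) + 1"
  have T0: "0 \<le> T0" using L \<kappa> by (simp add: T0_def)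
  have T1: "0 \<le> Q * (1 + Q) + 1" using Q by simp
  have T: "window Q = 2 * T0 + (Q * (1 + Q) + 1)" by (simp add: window_def T0_def)
  have vertex: "\<exists>w\<in>{w0..w0 + T0}. \<exists>x\<in>verts X. pt h w = Vertex x" if w0: "lo h \<le> w0" "w0 + T0 \<le> hi h" for w0
  proof (rule path_hits_vertex[OF wf conn])
    show "continuous_map (top_of_set {w0..w0 + T0}) (mtopology_of (graph_metric X)) (pt h)"
      by (rule continuous_map_from_subtopology_mono[OF P_continuous[OF h]]) (use w0 in auto)
    show "w0 \<le> w0 + T0" using T0 by simp
    show "1 < gdist X (pt h w0) (pt h (w0 + T0))"
    proof (rule ccontr)
      assume "\<not> ?thesis"
      then have "\<bar>w0 - (w0 + T0)\<bar> \<le> L * (1 + \<kappa>)"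
        using w0 T0 by (intro d_lower_le[OF h]) (auto simp: d_eq)
      then show False by (simp add: T0_def)
    qed
  qed
  obtain v1 x1 where v1: "v1 \<in> {v..v + T0}" "pt h v1 = Vertex x1"
    using vertex[of v] v T T0 T1 by auto
  have "lo h \<le> v + window Q - T0" "v + window Q - T0 + T0 \<le> hi h" using v T T0 T1 by auto
  from vertex[OF this] obtain v2 x2 where
    v2: "v2 \<in> {v + window Q - T0..v + window Q}" "pt h v2 = Vertex x2" by auto
  have v12: "Q * (1 + Q) + 1 \<le> v2 - v1" "lo h \<le> v1" "v1 \<le> v2" "v2 \<le> hi h"
    using v1(1) v2(1) v T T0 T1 by auto
  define g where "g = subseg h v1 v2"
  have g: "g \<in> P" "seg_start g = Vertex x1" "seg_end g = Vertex x2"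
    using P_sub[OF h v12(2-4)] v12 v1 v2 by (simp_all add: g_def)
  have "\<not> anti_contracting (graph_metric X) (K, n, P) g"
  proof
    assume "anti_contracting (graph_metric X) (K, n, P) g"
    then have "gdist ?Y (Vertex x1) (Vertex x2) \<le> 1" by (rule anti_contracting_adjacent[OF g])
    moreover have "1 / Q * \<bar>v1 - v2\<bar> - Q \<le> gdist ?Y (Vertex x1) (Vertex x2)"
    proof -
      have "v1 \<in> seg_dom h" "v2 \<in> seg_dom h" using v12 by auto
      then have "1 / Q * \<bar>v1 - v2\<bar> - Q
          \<le> gdist ?Y ((contraction_incl \<circ> pt h) v1) ((contraction_incl \<circ> pt h) v2)"
        using qg unfolding quasi_geodesic_def contraction_space_simps by blast
      then show ?thesis using v1(2) v2(2) by simp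
    qed
    ultimately have "1 / Q * \<bar>v1 - v2\<bar> \<le> 1 + Q" by linarith
    then have "\<bar>v1 - v2\<bar> \<le> Q * (1 + Q)" using Q by (simp add: field_simps)
    then show False using v12(1) by linarith
  qed
  moreover have "lo g = v1" "hi g = v2" by (simp_all add: g_def)
  ultimately obtain a b where
    ab: "v1 \<le> a" "a \<le> b" "b \<le> v2" "midthin (graph_metric X) (K, n, P) (subseg g a b)"
    unfolding anti_contracting_def by blast
  have sub: "seg_start (subseg g a b) = pt h a" "seg_end (subseg g a b) = pt h b"
    "seg_mid (subseg g a b) = pt h ((a + b) / 2)"
    using ab(1-3) by (simp_all add: g_def subseg_def seg_start_def seg_end_def seg_mid_def)
  obtain r where r: "0 \<le> r" "K r \<le> ennreal (b - a)"
    and mid: "\<And>\<alpha>. polygonal_line n P \<alpha> \<Longrightarrow> seg_start \<alpha> = pt h b \<Longrightarrow> seg_end \<alpha> = pt h a \<Longrightarrow>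
      seg_image \<alpha> \<inter> mcball_of (graph_metric X) (pt h ((a + b) / 2)) r \<noteq> {}"
    using ab(4) unfolding midthin.simps sub seg_simps(3) by (elim exE conjE) blast
  have "base_gauge r \<le> ennreal (b - a)" using K r by (meson order_trans)
  then have r': "2 * (L * (r + \<kappa>)) + 1 \<le> b - a"
    using ab(2) by (simp add: base_gauge_def ennreal_le_iff)
  have "1 * (r + \<kappa>) \<le> L * (r + \<kappa>)" using L r(1) \<kappa> by (intro mult_right_mono) auto
  then have "r \<le> L * (r + \<kappa>)" using \<kappa> by simp
  moreover have "r \<le> y" if "r \<le> x" "2 * x + 1 \<le> y" for x y :: real using that r(1) by linarith
  ultimately have "r \<le> b - a" using r' by blast
  then have rT: "r \<le> window Q" using ab v1(1) v2(1) by auto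
  have thin: "\<exists>z\<in>A. d z (pt h ((a + b) / 2)) \<le> r" if "polyline n (pt h b) (pt h a) A" for A
  proof -
    obtain \<alpha> where \<alpha>: "polygonal_line n P \<alpha>" "seg_start \<alpha> = pt h b" "seg_end \<alpha> = pt h a" "seg_image \<alpha> = A"
      using \<open>polyline n (pt h b) (pt h a) A\<close> unfolding polyline_def by blast
    obtain z where "z \<in> A" "z \<in> mcball_of (graph_metric X) (pt h ((a + b) / 2)) r"
      using mid[OF \<alpha>(1-3)] \<alpha>(4) by blast
    then have "z \<in> A" "d z (pt h ((a + b) / 2)) \<le> r"
      by (simp_all add: in_mcball_of mdist_commute[of _ z])
    then show ?thesis by blast
  qed
  show ?thesis
    by (rule that[of a b r]) (use ab v1(1) v2(1) r' rT thin in auto)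
qed

text \<open>At most one window for the radius of the midthin ball, plus the distance along
  \<open>h\<close> from its centre back to \<open>u\<close>.\<close>

definition window_radius :: "real \<Rightarrow> real" where
  "window_radius Q = window Q + (L * window Q + \<kappa>)"

text \<open>A midthin piece is sought in the window following \<open>u\<close>. If the window does
  not fit before \<open>t\<close>, the endpoint \<open>pt h t\<close>, which lies on every line
  considered, is already close to \<open>pt h u\<close>.\<close>

lemma quasi_geodesic_imp_thin:
  assumes K: "\<forall>r\<ge>0. base_gauge r \<le> K r" and n: "7 \<le> n" and h: "h \<in> P" and Q: "1 \<le> Q"
    and qg: "quasi_geodesic (contraction_space X (K, n, P)) Q Q (seg_dom h) (contraction_incl \<circ> pt h)"
  shows "thin h 5 (window_radius Q)"
proof -
  note T = window_nonneg[OF Q]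
  have core: "\<exists>z\<in>A. d z (pt h u) \<le> window_radius Q"
    if st: "s \<in> seg_dom h" "t \<in> seg_dom h" "u \<in> {s..t}" and A: "polyline 5 (pt h s) (pt h t) A"
    for s t u A
  proof (cases "t - u \<le> window Q")
    case True
    then have "d (pt h t) (pt h u) \<le> L * window Q + \<kappa>"
      using st by (intro d_upper_le[OF h]) auto
    then show ?thesis
      using polyline_in(3)[OF A] T by (intro bexI[of _ "pt h t"]) (auto simp: window_radius_def)
  next
    case False
    then have "lo h \<le> u" "u + window Q \<le> hi h" using st by auto
    then obtain a b r where ab: "u \<le> a" "a \<le> b" "b \<le> u + window Q" "r \<le> window Q"
      "L * (r + \<kappa>) < (b - a) / 2"
      and mid: "\<forall>A. polyline n (pt h b) (pt h a) A \<longrightarrow> (\<exists>z\<in>A. d z (pt h ((a + b) / 2)) \<le> r)"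
      by (rule midthin_in_window[OF K h Q qg])
    have dom: "a \<in> seg_dom h" "b \<in> seg_dom h" "(a + b) / 2 \<in> seg_dom h" "u \<in> seg_dom h"
      using st ab False by auto
    have sa: "s \<le> a" "b \<le> t" using ab st False by auto
    \<comment> \<open>From \<open>b\<close> along \<open>h\<close> to \<open>t\<close>, through the
      reversed 5-gon to \<open>s\<close>, then along \<open>h\<close> to \<open>a\<close>: at most
      seven sides, in the direction used for midthinness.\<close>
    have "polyline (1 + 5 + 1) (pt h b) (pt h a)
        (pt h ` {min b t..max b t} \<union> A \<union> pt h ` {min s a..max s a})"
      by (intro polyline_trans[OF polyline_trans[OF polyline_sub[OF h dom(2) st(2)] polyline_rev[OF A]]]
          polyline_sub[OF h st(1) dom(1)])
    then have "polyline n (pt h b) (pt h a)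
        (pt h ` {min b t..max b t} \<union> A \<union> pt h ` {min s a..max s a})"
      by (rule polyline_mono) (use n in simp)
    then obtain z where z: "z \<in> pt h ` {min b t..max b t} \<union> A \<union> pt h ` {min s a..max s a}"
      "d z (pt h ((a + b) / 2)) \<le> r" using mid by blast
    \<comment> \<open>Since \<open>L * (r + \<kappa>)\<close> is less than half of
      \<open>b - a\<close>, the two added pieces of \<open>h\<close> miss the \<open>r\<close>-ball,
      and the point found there belongs to \<open>A\<close>.\<close>
    have "\<not> d (pt h w) (pt h ((a + b) / 2)) \<le> r" if "w \<in> seg_dom h" "w \<le> a \<or> b \<le> w" for w
    proof
      assume "d (pt h w) (pt h ((a + b) / 2)) \<le> r"
      then have "\<bar>w - (a + b) / 2\<bar> \<le> L * (r + \<kappa>)" by (rule d_lower_le[OF h that(1) dom(3)])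
      then have "\<bar>w - (a + b) / 2\<bar> < (b - a) / 2" using ab(5) by linarith
      then show False using that(2) by (auto simp: abs_if field_simps split: if_splits)
    qed
    moreover have "w \<in> seg_dom h \<and> (w \<le> a \<or> b \<le> w)"
      if "w \<in> {min b t..max b t} \<or> w \<in> {min s a..max s a}" for w
      using that sa st(1,2) dom(1,2) by auto
    ultimately have "z \<in> A" using z by blast
    have "\<bar>(a + b) / 2 - u\<bar> \<le> window Q" using ab by (auto simp: abs_if field_simps)
    then have "d (pt h ((a + b) / 2)) (pt h u) \<le> L * window Q + \<kappa>"
      by (rule d_upper_le[OF h dom(3,4)])
    moreover have "d z (pt h u) \<le> d z (pt h ((a + b) / 2)) + d (pt h ((a + b) / 2)) (pt h u)"
      using polyline_in(1)[OF A] \<open>z \<in> A\<close> by (intro mdist_triangle pt_in[OF h] dom) auto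
    ultimately show ?thesis using z(2) ab(4) \<open>z \<in> A\<close> by (intro bexI[of _ z]) (auto simp: window_radius_def)
  qed
  show ?thesis
    unfolding thin_def
  proof (intro ballI allI impI)
    fix s t u A assume st: "s \<in> seg_dom h" "t \<in> seg_dom h" "u \<in> {min s t..max s t}"
      and A: "polyline 5 (pt h s) (pt h t) A"
    show "\<exists>z\<in>A. d z (pt h u) \<le> window_radius Q"
    proof (cases "s \<le> t")
      case True
      then show ?thesis using core[OF st(1,2) _ A] st(3) by simp
    next
      case False
      then show ?thesis using core[OF st(2,1) _ polyline_rev[OF A]] st(3) by simp
    qed
  qed
qed

text \<open>Fullness makes \<open>K (mid_radius \<rho>)\<close> a real number. The summand
  \<open>L * (1 + \<kappa>) + 1\<close> exceeds the duration of any special path between points at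
  distance at most 1, so that one threshold serves old and new edges.\<close>

definition midthin_threshold :: "(real \<Rightarrow> ennreal) \<Rightarrow> real \<Rightarrow> real" where
  "midthin_threshold K \<rho> = enn2real (K (mid_radius \<rho>)) + L * (1 + \<kappa>) + 1"
definition contraction_drift :: "(real \<Rightarrow> ennreal) \<Rightarrow> real \<Rightarrow> real" where
  "contraction_drift K \<rho> = long_drift \<rho> (midthin_threshold K \<rho>)"

lemma midthin_threshold_nonneg: "0 \<le> midthin_threshold K \<rho>"
  using L \<kappa> by (simp add: midthin_threshold_def)

text \<open>A larger drift would give \<open>g\<close>, by \<open>bottleneck_subsegment\<close>, a
  subsegment that is midthin with radius \<open>mid_radius \<rho>\<close> and lasts longer than a
  special path between points at distance 1. Either alternative of \<open>short\<close> excludes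
  this: the first is for new edges, the second for old edges and for a vertex next to a point of
  \<open>h\<close>.\<close>

lemma contraction_drift_bound:
  assumes full: "full_gauge K" and n: "7 \<le> n" and h: "h \<in> P" "thin h (n + 2) \<rho>" and \<rho>: "0 \<le> \<rho>"
    and g: "g \<in> P" "proj h \<rho> (seg_start g) s" "proj h \<rho> (seg_end g) t"
    and short: "anti_contracting (graph_metric X) (K, n, P) g \<or> d (seg_start g) (seg_end g) \<le> 1"
  shows "\<bar>s - t\<bar> \<le> contraction_drift K \<rho>"
proof (rule ccontr)
  assume "\<not> ?thesis"
  then have long: "long_drift \<rho> (midthin_threshold K \<rho>) < \<bar>s - t\<bar>" by (simp add: contraction_drift_def)
  have n5: "5 \<le> n" using n by simp
  note nonneg = long_drift_nonneg[OF \<rho> midthin_threshold_nonneg]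
  have "\<exists>a b. lo g \<le> a \<and> a \<le> b \<and> b \<le> hi g \<and> midthin_threshold K \<rho> \<le> b - a \<and>
    (\<forall>A. polyline n (pt g b) (pt g a) A \<longrightarrow> (\<exists>z\<in>A. d z (pt g ((a + b) / 2)) \<le> mid_radius \<rho>))"
    by (rule bottleneck_subsegment[OF h n5 \<rho> midthin_threshold_nonneg g long]) blast
  then obtain a b where ab: "lo g \<le> a" "a \<le> b" "b \<le> hi g" "midthin_threshold K \<rho> \<le> b - a"
    and mid: "\<forall>A. polyline n (pt g b) (pt g a) A \<longrightarrow> (\<exists>z\<in>A. d z (pt g ((a + b) / 2)) \<le> mid_radius \<rho>)"
    by blast
  have "midthin (graph_metric X) (K, n, P) (subseg g a b)"
    unfolding midthin.simps
  proof (intro exI[of _ "mid_radius \<rho>"] conjI allI impI)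
    show "0 \<le> mid_radius \<rho>" by (rule nonneg(2))
    have "K (mid_radius \<rho>) = ennreal (enn2real (K (mid_radius \<rho>)))"
      using full nonneg(2) by (simp add: full_gauge_def less_top)
    also have "\<dots> \<le> ennreal (b - a)"
    proof (rule ennreal_leI)
      have "0 \<le> L * (1 + \<kappa>) + 1" using L \<kappa> by simp
      then show "enn2real (K (mid_radius \<rho>)) \<le> b - a"
        using ab(4) unfolding midthin_threshold_def by linarith
    qed
    finally show "K (mid_radius \<rho>) \<le> ennreal (seg_dur (subseg g a b))" by simp
    fix \<alpha>
    assume \<alpha>: "polygonal_line n P \<alpha> \<and> seg_start \<alpha> = seg_end (subseg g a b) \<and>
      seg_end \<alpha> = seg_start (subseg g a b)"
    then have pl: "polyline n (pt g b) (pt g a) (seg_image \<alpha>)"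
      using ab(2) unfolding polyline_def by auto
    then obtain z where z: "z \<in> seg_image \<alpha>" "d z (pt g ((a + b) / 2)) \<le> mid_radius \<rho>" using mid by blast
    have "z \<in> S" "pt g ((a + b) / 2) \<in> S"
      using polyline_in(1)[OF pl] z(1) pt_in[OF g(1), of "(a + b) / 2"] ab by auto
    then have "z \<in> mcball_of (graph_metric X) (seg_mid (subseg g a b)) (mid_radius \<rho>)"
      using z(2) ab(2) by (simp add: in_mcball_of seg_mid_subseg mdist_commute[of _ z])
    with z(1) show "seg_image \<alpha> \<inter> mcball_of (graph_metric X) (seg_mid (subseg g a b)) (mid_radius \<rho>) \<noteq> {}"
      by blast
  qed
  then have "\<not> anti_contracting (graph_metric X) (K, n, P) g"
    using ab(1-3) unfolding anti_contracting_def by blast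
  then have "seg_dur g \<le> L * (1 + \<kappa>)" using short seg_dur_le[OF g(1)] by blast
  moreover have "L * (1 + \<kappa>) + 1 \<le> b - a"
    using ab(4) enn2real_nonneg[of "K (mid_radius \<rho>)"] unfolding midthin_threshold_def by linarith
  ultimately show False using ab by (simp add: seg_dur_def)
qed

text \<open>Projection to \<open>h\<close> becomes a function on the contraction graph that varies
  by at most \<open>D\<close> over each edge and recovers, up to \<open>D\<close>, the parameter of
  a point of \<open>h\<close>. So \<open>\<bar>s - t\<bar>\<close> is at most
  \<open>D * l + 2 * D\<close> for every path of length \<open>l\<close>. The upper estimate holds
  because the inclusion does not increase distances.\<close>

lemma thin_imp_quasi_geodesic:
  assumes full: "full_gauge K" and n: "7 \<le> n" and h: "h \<in> P" "thin h (n + 2) \<rho>" and \<rho>: "0 \<le> \<rho>"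
    and Q: "Q = 2 * contraction_drift K \<rho> + L + \<kappa> + 1"
  shows "quasi_geodesic (contraction_space X (K, n, P)) Q Q (seg_dom h) (contraction_incl \<circ> pt h)"
proof -
  let ?Y = "contraction_graph X (K, n, P)"
  define D where "D = contraction_drift K \<rho>"
  have D: "0 \<le> D"
    using long_drift_nonneg(4)[OF \<rho> midthin_threshold_nonneg] by (simp add: D_def contraction_drift_def)
  have QD: "1 \<le> Q" "L \<le> Q" "\<kappa> \<le> Q" "2 * D \<le> Q" "D \<le> Q" using D L \<kappa> by (simp_all add: Q D_def)
  have wfY: "wf_digraph ?Y" "Digraph_Component.connected ?Y"
    by (rule wf_contraction_graph[OF wf], rule connected_contraction_graph[OF conn])
  have "\<exists>s. proj h \<rho> (Vertex v) s" if "v \<in> verts X" for v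
  proof -
    have "Vertex v \<in> S" using that by (simp add: S_eq gpoints_def)
    moreover have "lo h \<in> seg_dom h" using lo_hi[OF h(1)] by simp
    ultimately show ?thesis using proj_exists[OF h(1) _ _ order_refl \<rho>] by blast
  qed
  \<comment> \<open>Any choice will do, since the drift is bounded for all values of the relation
    \<open>proj\<close>.\<close>
  then obtain \<pi> where \<pi>: "\<And>v. v \<in> verts X \<Longrightarrow> proj h \<rho> (Vertex v) (\<pi> v)" by metis
  have short: "\<bar>s - t\<bar> \<le> D" if xy: "proj h \<rho> x s" "proj h \<rho> y t" "x \<in> S" "y \<in> S" "d x y \<le> 1" for x y s t
  proof -
    obtain g where g: "g \<in> P" "seg_start g = x" "seg_end g = y" using P_conn[OF xy(3,4)] by blast
    then show ?thesis
      unfolding D_def by (intro contraction_drift_bound[OF full n h \<rho> g(1)]) (use g xy in auto)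
  qed
  have arcs: "\<bar>\<pi> (tail ?Y e) - \<pi> (head ?Y e)\<bar> \<le> D" if e: "e \<in> arcs ?Y" for e
  proof (cases e)
    case (Inl e')
    then have e': "e' \<in> arcs X" using e by (auto simp: contraction_graph_def)
    then have verts: "tail X e' \<in> verts X" "head X e' \<in> verts X"
      using wf by (auto simp: wf_digraph.tail_in_verts wf_digraph.head_in_verts)
    have "gdist X (Vertex (tail X e')) (Vertex (head X e')) \<le> 1"
      using gdist_le[OF pl_path_edge[OF wf e', of 0 1]] by (simp add: edge_point_def)
    then show ?thesis
      using short[OF \<pi>[OF verts(1)] \<pi>[OF verts(2)]] verts Inl by (simp add: S_eq d_eq gpoints_def)
  next
    case (Inr xy)
    obtain x y where xy: "xy = (x, y)" by (rule prod.exhaust)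
    from e have verts: "x \<in> verts X" "y \<in> verts X"
      and "anti_contracting_pair (graph_metric X) (K, n, P) (Vertex x) (Vertex y)"
      unfolding Inr xy by (auto simp: contraction_graph_def)
    then obtain g where "g \<in> P" "seg_start g = Vertex x" "seg_end g = Vertex y"
      "anti_contracting (graph_metric X) (K, n, P) g" by auto
    then show ?thesis
      using contraction_drift_bound[OF full n h \<rho>, of g "\<pi> x" "\<pi> y"] \<pi>[OF verts(1)] \<pi>[OF verts(2)]
      by (simp add: Inr xy D_def)
  qed
  let ?f = "affine_extension ?Y \<pi>"
  have close: "\<bar>?f (contraction_incl (pt h s)) - s\<bar> \<le> D" if s: "s \<in> seg_dom h" for s
  proof -
    have hs: "pt h s \<in> gpoints X" using pt_in[OF h(1) s] by (simp add: S_eq)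
    have "\<bar>affine_extension X \<pi> (pt h s) - s\<bar> \<le> D"
    proof (rule affine_extension_close[OF wf hs])
      fix v assume v: "v \<in> verts X" "gdist X (Vertex v) (pt h s) \<le> 1"
      then show "\<bar>\<pi> v - s\<bar> \<le> D"
        using short[OF \<pi>[OF v(1)] proj_refl[OF h(1) s \<rho>]] hs by (simp add: S_eq d_eq gpoints_def)
    qed
    \<comment> \<open>On old edges the extension over the contraction graph is the extension over
      \<open>X\<close>.\<close>
    then show ?thesis by (cases "pt h s") simp_all
  qed
  show ?thesis
    unfolding quasi_geodesic_def contraction_space_simps
  proof (intro conjI ballI)
    show "contraction_incl \<circ> pt h \<in> seg_dom h \<rightarrow> gpoints ?Y"
      using pt_in[OF h(1)] by (auto simp: S_eq intro!: contraction_incl_in)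
    fix s t assume st: "s \<in> seg_dom h" "t \<in> seg_dom h"
    let ?x = "contraction_incl (pt h s)" and ?y = "contraction_incl (pt h t)"
    have in_X: "pt h s \<in> gpoints X" "pt h t \<in> gpoints X" using pt_in[OF h(1)] st by (simp_all add: S_eq)
    have in_Y: "?x \<in> gpoints ?Y" "?y \<in> gpoints ?Y" using in_X by (auto intro: contraction_incl_in)
    \<comment> \<open>After the division \<open>Q * Q\<close> becomes the additive constant
      \<open>Q\<close>; before it, it dominates \<open>2 * D\<close> because
      \<open>2 * D \<le> Q\<close> and \<open>Q\<close> is at least 1.\<close>
    have "(\<bar>s - t\<bar> - Q * Q) / Q \<le> gdist ?Y ?x ?y"
    proof (rule gdist_greatest[OF wfY in_Y])
      fix l assume l: "pl_path ?Y ?x ?y l"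
      have "\<bar>?f ?x - ?f ?y\<bar> \<le> D * l" by (rule affine_extension_lipschitz[OF l arcs])
      then have "\<bar>s - t\<bar> \<le> D * l + 2 * D" using close[OF st(1)] close[OF st(2)] by linarith
      moreover have "D * l \<le> Q * l" using QD pl_path_nonneg[OF l] by (intro mult_right_mono) auto
      moreover have "Q * 1 \<le> Q * Q" using QD by (intro mult_left_mono) auto
      ultimately have "\<bar>s - t\<bar> - Q * Q \<le> Q * l" using QD by linarith
      then show "(\<bar>s - t\<bar> - Q * Q) / Q \<le> l" using QD by (simp add: field_simps)
    qed
    then show "1 / Q * \<bar>s - t\<bar> - Q
        \<le> gdist ?Y ((contraction_incl \<circ> pt h) s) ((contraction_incl \<circ> pt h) t)"
      using QD by (simp add: diff_divide_distrib)
    have "gdist ?Y ?x ?y \<le> gdist X (pt h s) (pt h t)"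
      by (rule gdist_contraction_incl_le[OF wf conn in_X])
    also have "\<dots> \<le> L * \<bar>s - t\<bar> + \<kappa>" using d_upper[OF h(1) st] by (simp add: d_eq)
    also have "\<dots> \<le> Q * \<bar>s - t\<bar> + Q" using QD by (intro add_mono mult_right_mono) auto
    finally show "gdist ?Y ((contraction_incl \<circ> pt h) s) ((contraction_incl \<circ> pt h) t) \<le> Q * \<bar>s - t\<bar> + Q"
      by simp
  qed (use QD in \<open>auto simp: is_interval_cc\<close>)
qed

end

section \<open>Choice of constants and assembly of both directions\<close>

lemma quasi_geodesic_mono:
  assumes "quasi_geodesic m L \<kappa> I \<gamma>" "L \<le> L'" "\<kappa> \<le> \<kappa>'"
  shows "quasi_geodesic m L' \<kappa>' I \<gamma>"
  unfolding quasi_geodesic_def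
proof (intro conjI ballI)
  fix s t assume st: "s \<in> I" "t \<in> I"
  have *: "1 \<le> L" "0 \<le> \<kappa>" "1 / L * \<bar>s - t\<bar> - \<kappa> \<le> mdist m (\<gamma> s) (\<gamma> t)"
    "mdist m (\<gamma> s) (\<gamma> t) \<le> L * \<bar>s - t\<bar> + \<kappa>"
    using assms(1) st unfolding quasi_geodesic_def by blast+
  have "1 / L' * \<bar>s - t\<bar> \<le> 1 / L * \<bar>s - t\<bar>"
    using *(1) assms(2) by (intro mult_right_mono divide_left_mono) auto
  with * assms(3) show "1 / L' * \<bar>s - t\<bar> - \<kappa>' \<le> mdist m (\<gamma> s) (\<gamma> t)" by linarith
  have "L * \<bar>s - t\<bar> \<le> L' * \<bar>s - t\<bar>" using assms(2) by (intro mult_right_mono) auto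
  with * assms(3) show "mdist m (\<gamma> s) (\<gamma> t) \<le> L' * \<bar>s - t\<bar> + \<kappa>'" by linarith
qed (use assms in \<open>auto simp: quasi_geodesic_def\<close>)

text \<open>The inequalities for \<open>L\<close> and \<open>\<kappa>\<close> are part of being a
  quasi-geodesic and are read off from a trivial path, for which the space must have a
  point.\<close>

lemma path_system_constants:
  assumes "path_system m P" "mspace m \<noteq> {}"
  obtains L \<kappa> where "1 \<le> L" "0 \<le> \<kappa>" "\<forall>p\<in>P. improved_quasi_geodesic m L \<kappa> (seg_dom p) (pt p)"
proof -
  obtain L \<kappa> where *: "\<forall>p\<in>P. improved_quasi_geodesic m L \<kappa> (seg_dom p) (pt p)"
    using assms(1) unfolding path_system_def by blast
  obtain x where "x \<in> mspace m" using assms(2) by blast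
  then have "const_seg 0 x \<in> P" using assms(1) unfolding path_system_def by blast
  then have "1 \<le> L \<and> 0 \<le> \<kappa>"
    using * unfolding improved_quasi_geodesic_def quasi_geodesic_def by blast
  with * that show ?thesis by blast
qed

theorem theorem1p4:
  fixes X :: "('v, 'e) pre_digraph" and P :: "('v, 'e) gpoint seg set"
  assumes "wf_digraph X" and "Digraph_Component.connected X"
    and "path_system (graph_metric X) P"
    and "navigable (graph_metric X) P" and "undirected P"
  shows "\<exists>K0. contraction_gauge K0 \<and> full_gauge K0 \<and>
    (\<forall>K n. contraction_triple (graph_metric X) (K, n, P) \<and> full_gauge K \<and> (\<forall>r\<ge>0. K0 r \<le> K r) \<longrightarrow>
      (\<forall>h\<in>P. (\<exists>M. morse_gauge M \<and> morse (graph_metric X) M (seg_dom h) (pt h)) \<longleftrightarrow>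
         (\<exists>L \<kappa>. quasi_geodesic (contraction_space X (K, n, P)) L \<kappa> (seg_dom h)
            (contraction_incl \<circ> pt h))) \<and>
      (\<forall>M. morse_gauge M \<longrightarrow> (\<exists>Q\<ge>1. \<forall>h\<in>P.
         morse (graph_metric X) M (seg_dom h) (pt h) \<longrightarrow>
         quasi_geodesic (contraction_space X (K, n, P)) Q Q (seg_dom h)
           (contraction_incl \<circ> pt h))) \<and>
      (\<forall>Q\<ge>1. \<exists>M. morse_gauge M \<and> (\<forall>h\<in>P.
         quasi_geodesic (contraction_space X (K, n, P)) Q Q (seg_dom h)
           (contraction_incl \<circ> pt h) \<longrightarrow>
         morse (graph_metric X) M (seg_dom h) (pt h))))"
proof -
  have "verts X \<noteq> {}" using assms(2) unfolding connected_iff_rtrancl_on by blast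
  then have "mspace (graph_metric X) \<noteq> {}"
    by (simp add: mspace_graph_metric[OF assms(1,2)] gpoints_def)
  then obtain L \<kappa> where L: "1 \<le> L" "0 \<le> \<kappa>"
    "\<forall>p\<in>P. improved_quasi_geodesic (graph_metric X) L \<kappa> (seg_dom p) (pt p)"
    by (rule path_system_constants[OF assms(3)])
  interpret length_metric "graph_metric X" by (rule length_metric_graph[OF assms(1,2)])
  interpret graph_path_system X P L \<kappa>
  proof
    show "p \<in> P \<Longrightarrow> is_seg (mspace (graph_metric X)) p" for p
      using assms(3) unfolding path_system_def by blast
    show "x \<in> mspace (graph_metric X) \<Longrightarrow> const_seg a x \<in> P" for x a
      using assms(3) unfolding path_system_def by blast
    show "p \<in> P \<Longrightarrow> lo p \<le> s \<Longrightarrow> s \<le> t \<Longrightarrow> t \<le> hi p \<Longrightarrow> subseg p s t \<in> P" for p s t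
      using assms(3) unfolding path_system_def by blast
    show "x \<in> mspace (graph_metric X) \<Longrightarrow> y \<in> mspace (graph_metric X) \<Longrightarrow>
        \<exists>p\<in>P. seg_start p = x \<and> seg_end p = y" for x y
      using assms(3) unfolding path_system_def by blast
    show "p \<in> P \<Longrightarrow> rev_seg p \<in> P" for p using assms(5) unfolding undirected_def by blast
    show "navigable (graph_metric X) P" by (rule assms(4))
    show "Digraph_Component.connected X" by (rule assms(2))
  qed (use L wf_digraph.tail_in_verts[OF assms(1)] wf_digraph.head_in_verts[OF assms(1)] in auto)
  show ?thesis
  \<comment> \<open>\<open>base_gauge\<close> depends only on the constants \<open>L\<close> and
    \<open>\<kappa>\<close> of the path system, hence serves all triples at once.\<close>
  proof (rule exI[of _ base_gauge], rule conjI[OF base_gauge(1) conjI[OF base_gauge(2)]], intro allI impI)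
    fix K n
    assume *: "contraction_triple (graph_metric X) (K, n, P) \<and> full_gauge K \<and> (\<forall>r\<ge>0. base_gauge r \<le> K r)"
    then have n: "7 \<le> n" and full: "full_gauge K" and K: "\<forall>r\<ge>0. base_gauge r \<le> K r" by auto
    let ?m = "contraction_space X (K, n, P)"
    have A: "\<exists>Q\<ge>1. \<forall>h\<in>P. morse (graph_metric X) M (seg_dom h) (pt h) \<longrightarrow>
        quasi_geodesic ?m Q Q (seg_dom h) (contraction_incl \<circ> pt h)" if M: "morse_gauge M" for M
    proof -
      \<comment> \<open>The \<open>n\<close> sides of the lines in the definition of midthinness,
        plus the two short sides of \<open>bottleneck_subsegment\<close>.\<close>
      obtain R where R: "0 \<le> R" "\<And>h. h \<in> P \<Longrightarrow> morse (graph_metric X) M (seg_dom h) (pt h) \<Longrightarrow> thin h (n + 2) R"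
        using morse_imp_thin[OF M, of "n + 2"] by metis
      have "0 \<le> contraction_drift K R"
        using long_drift_nonneg(4)[OF R(1) midthin_threshold_nonneg] by (simp add: contraction_drift_def)
      then have "1 \<le> 2 * contraction_drift K R + L + \<kappa> + 1" using L \<kappa> by linarith
      moreover have "quasi_geodesic ?m (2 * contraction_drift K R + L + \<kappa> + 1)
          (2 * contraction_drift K R + L + \<kappa> + 1) (seg_dom h) (contraction_incl \<circ> pt h)"
        if "h \<in> P" "morse (graph_metric X) M (seg_dom h) (pt h)" for h
        by (rule thin_imp_quasi_geodesic[OF full n that(1) R(2)[OF that] R(1) HOL.refl])
      ultimately show ?thesis by blast
    qed
    have B: "\<exists>M. morse_gauge M \<and> (\<forall>h\<in>P. quasi_geodesic ?m Q Q (seg_dom h) (contraction_incl \<circ> pt h) \<longrightarrow>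
         morse (graph_metric X) M (seg_dom h) (pt h))" if Q: "1 \<le> Q" for Q
    proof -
      have R: "0 \<le> window_radius Q" using window_nonneg[OF Q] L \<kappa> by (simp add: window_radius_def)
      have "morse (graph_metric X) (thin_gauge (window_radius Q)) (seg_dom h) (pt h)"
        if "h \<in> P" "quasi_geodesic ?m Q Q (seg_dom h) (contraction_incl \<circ> pt h)" for h
        by (rule thin_imp_morse[OF that(1) quasi_geodesic_imp_thin[OF K n that(1) Q that(2)] R])
      with morse_gauge_thin_gauge[OF R] show ?thesis by blast
    qed
    have C: "\<forall>h\<in>P. (\<exists>M. morse_gauge M \<and> morse (graph_metric X) M (seg_dom h) (pt h)) \<longleftrightarrow>
         (\<exists>L \<kappa>. quasi_geodesic ?m L \<kappa> (seg_dom h) (contraction_incl \<circ> pt h))"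
    proof (intro ballI iffI; elim exE conjE)
      fix h M assume "h \<in> P" "morse_gauge M" "morse (graph_metric X) M (seg_dom h) (pt h)"
      then show "\<exists>L \<kappa>. quasi_geodesic ?m L \<kappa> (seg_dom h) (contraction_incl \<circ> pt h)"
        using A by blast
    next
      fix h L' \<kappa>' assume h: "h \<in> P"
        and qg: "quasi_geodesic ?m L' \<kappa>' (seg_dom h) (contraction_incl \<circ> pt h)"
      have "quasi_geodesic ?m (max L' \<kappa>') (max L' \<kappa>') (seg_dom h) (contraction_incl \<circ> pt h)"
        by (rule quasi_geodesic_mono[OF qg]) auto
      moreover from this have "1 \<le> max L' \<kappa>'" unfolding quasi_geodesic_def by blast
      ultimately show "\<exists>M. morse_gauge M \<and> morse (graph_metric X) M (seg_dom h) (pt h)"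
        using B h by blast
    qed
    show "(\<forall>h\<in>P. (\<exists>M. morse_gauge M \<and> morse (graph_metric X) M (seg_dom h) (pt h)) \<longleftrightarrow>
         (\<exists>L \<kappa>. quasi_geodesic ?m L \<kappa> (seg_dom h) (contraction_incl \<circ> pt h))) \<and>
      (\<forall>M. morse_gauge M \<longrightarrow> (\<exists>Q\<ge>1. \<forall>h\<in>P. morse (graph_metric X) M (seg_dom h) (pt h) \<longrightarrow>
         quasi_geodesic ?m Q Q (seg_dom h) (contraction_incl \<circ> pt h))) \<and>
      (\<forall>Q\<ge>1. \<exists>M. morse_gauge M \<and> (\<forall>h\<in>P.
         quasi_geodesic ?m Q Q (seg_dom h) (contraction_incl \<circ> pt h) \<longrightarrow>
         morse (graph_metric X) M (seg_dom h) (pt h)))"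
      using A B C by (intro conjI allI impI)
  qed
qed

end
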